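(* Let $x$ be a $T$-periodic brake orbit with linearization coefficients $P,Q,R$ and monodromy matrix $\gamma(T)$, and let $\mathbf C^\perp=\{\lambda\in\mathbf C:\operatorname{Im}\lambda>0\}$. Then $$\dim\bigoplus_{\lambda\in\sigma(\gamma(T))\cap(\mathbf C^\perp\cup\{\pm1\})}\ker(\gamma(T)-\lambda I_{2n})\le m^-(\Lambda_N)+m^0(\Lambda_N)-m^-(\Lambda_D)$$ and $$\dim\bigoplus_{\lambda\in\sigma(\gamma(T))\cap\mathbf C^\perp}\ker(\gamma(T)-\lambda I_{2n})\le m^-(\Lambda_N)-m^-(\Lambda_D).$$
   Context: **Brake orbit.** Let $L(t,x,\dot x)$ be a $C^2$ Lagrangian on $\mathbf R\times\mathbf R^n\times\mathbf R^n$, $T$-periodic in $t$, with $D^2_{vv}L$ everywhere positive definite. A brake periodic orbit is a solution $x$ of the Euler–Lagrange equation with $\dot x(0)=\dot x(T/2)=0$, $x(T/2+t)=x(T/2-t)$, $x(T+t)=x(t)$ for all $t\in\mathbf R$, whose linearization coefficients $P=\frac{\partial^2L}{\partial\dot x^2}$, $Q=\frac{\partial^2L}{\partial x\partial\dot x}$, $R=\frac{\partial^2L}{\partial x^2}$ along $x$ are (continuous) real $T$-periodic symmetric $n\times n$ matrices, $P(t)$ positive definite, satisfying $P(-t)=P(t)$, $Q(-t)=-Q(t)$, $R(-t)=R(t)$ for all $t\in\mathbf R$. **Monodromy.** $\gamma$ solves $\dot\gamma=J\mathcal B\gamma$, $\gamma(0)=I_{2n}$, with $J=\begin{bmatrix}0&-I_n\\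 I_n&0\end{bmatrix}$, $\mathcal B=\begin{bmatrix}P^{-1}&-P^{-1}Q\\ -Q^TP^{-1}&Q^TP^{-1}Q-R\end{bmatrix}$. $\gamma(T)$ acts on $\mathbf C^{2n}$; $\sigma$ denotes its spectrum. **Morse indices.** $\mathcal A\xi=-\frac{d}{dt}(P\dot \xi+Q\xi)+Q^T\dot \xi+R\xi$ is considered as a self-adjoint operator on $L^2([0,T],\mathbf C^n)$ with domain consisting of $\xi\in W^{1,2}([0,T],\mathbf C^n)$ with $y:=P\dot\xi+Q\xi\in W^{1,2}$ and subject to the boundary condition: $\Lambda_D$ means $\xi(0)=\xi(T)=0$ (Dirichlet), $\Lambda_N$ means $y(0)=y(T)=0$ (Neumann). $m^-(\cdot)$ is the number of negative eigenvalues with multiplicity of $\mathcal A$ under the given boundary condition, and $m^0(\cdot)$ is the dimension of its kernel. *)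

theory Defs
  imports "HOL-Analysis.Analysis" "HOL-Library.Function_Algebras"
begin

section \<open>Lagrangians and brake orbits\<close>

text \<open>Lagrangians are functions of the triple (t, x, v).\<close>

definition C2_function :: "('a::euclidean_space \<Rightarrow> real) \<Rightarrow> bool" where
  "C2_function f \<longleftrightarrow> (\<exists>(g :: 'a \<Rightarrow> 'a) (H :: 'a \<Rightarrow> 'a \<Rightarrow>\<^sub>L 'a).
     (\<forall>z. (f has_derivative (\<lambda>h. g z \<bullet> h)) (at z)) \<and>
     (\<forall>z. (g has_derivative blinfun_apply (H z)) (at z)) \<and>
     continuous_on UNIV H)"

definition dir_deriv :: "('a::real_vector \<Rightarrow> real) \<Rightarrow> 'a \<Rightarrow> 'a \<Rightarrow> real" where
  "dir_deriv f h z = deriv (\<lambda>s. f (z + s *\<^sub>R h)) 0"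

definition dir_x :: "'n \<Rightarrow> real \<times> (real^'n) \<times> (real^'n)" where
  "dir_x i = (0, axis i 1, 0)"

definition dir_v :: "'n \<Rightarrow> real \<times> (real^'n) \<times> (real^'n)" where
  "dir_v i = (0, 0, axis i 1)"

definition grad_x :: "(real \<times> (real^'n) \<times> (real^'n) \<Rightarrow> real) \<Rightarrow> real \<times> (real^'n) \<times> (real^'n) \<Rightarrow> real^'n" where
  "grad_x L z = (\<chi> i. dir_deriv L (dir_x i) z)"

definition grad_v :: "(real \<times> (real^'n) \<times> (real^'n) \<Rightarrow> real) \<Rightarrow> real \<times> (real^'n) \<times> (real^'n) \<Rightarrow> real^'n" where
  "grad_v L z = (\<chi> i. dir_deriv L (dir_v i) z)"

definition hess_vv :: "(real \<times> (real^'n) \<times> (real^'n) \<Rightarrow> real) \<Rightarrow> real \<times> (real^'n) \<times> (real^'n) \<Rightarrow> real^'n^'n" where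
  "hess_vv L z = (\<chi> i j. dir_deriv (dir_deriv L (dir_v i)) (dir_v j) z)"

text \<open>Rows of the mixed Hessian are indexed by v and columns by x, so that the linearization
  of the momentum along a variation \<open>\<xi>\<close> is \<open>P \<xi>' + Q \<xi>\<close>.\<close>

definition hess_vx :: "(real \<times> (real^'n) \<times> (real^'n) \<Rightarrow> real) \<Rightarrow> real \<times> (real^'n) \<times> (real^'n) \<Rightarrow> real^'n^'n" where
  "hess_vx L z = (\<chi> i j. dir_deriv (dir_deriv L (dir_v i)) (dir_x j) z)"

definition hess_xx :: "(real \<times> (real^'n) \<times> (real^'n) \<Rightarrow> real) \<Rightarrow> real \<times> (real^'n) \<times> (real^'n) \<Rightarrow> real^'n^'n" where
  "hess_xx L z = (\<chi> i j. dir_deriv (dir_deriv L (dir_x i)) (dir_x j) z)"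

definition pos_def_matrix :: "real^'n^'n \<Rightarrow> bool" where
  "pos_def_matrix A \<longleftrightarrow> (\<forall>u. u \<noteq> 0 \<longrightarrow> u \<bullet> (A *v u) > 0)"

definition admissible_lagrangian :: "real \<Rightarrow> (real \<times> (real^'n) \<times> (real^'n) \<Rightarrow> real) \<Rightarrow> bool" where
  "admissible_lagrangian T L \<longleftrightarrow>
     C2_function L \<and>
     (\<forall>t x v. L (t + T, x, v) = L (t, x, v)) \<and>
     (\<forall>z. pos_def_matrix (hess_vv L z))"

definition phase_curve :: "(real \<Rightarrow> real^'n) \<Rightarrow> real \<Rightarrow> real \<times> (real^'n) \<times> (real^'n)" where
  "phase_curve x t = (t, x t, vector_derivative x (at t))"

definition euler_lagrange :: "(real \<times> (real^'n) \<times> (real^'n) \<Rightarrow> real) \<Rightarrow> (real \<Rightarrow> real^'n) \<Rightarrow> bool" where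
  "euler_lagrange L x \<longleftrightarrow>
     x C1_differentiable_on UNIV \<and>
     (\<forall>t. ((\<lambda>s. grad_v L (phase_curve x s)) has_vector_derivative
            grad_x L (phase_curve x t)) (at t))"

text \<open>Linearization coefficients along a curve.\<close>

definition coeff_P :: "(real \<times> (real^'n) \<times> (real^'n) \<Rightarrow> real) \<Rightarrow> (real \<Rightarrow> real^'n) \<Rightarrow> real \<Rightarrow> real^'n^'n" where
  "coeff_P L x t = hess_vv L (phase_curve x t)"

definition coeff_Q :: "(real \<times> (real^'n) \<times> (real^'n) \<Rightarrow> real) \<Rightarrow> (real \<Rightarrow> real^'n) \<Rightarrow> real \<Rightarrow> real^'n^'n" where
  "coeff_Q L x t = hess_vx L (phase_curve x t)"

definition coeff_R :: "(real \<times> (real^'n) \<times> (real^'n) \<Rightarrow> real) \<Rightarrow> (real \<Rightarrow> real^'n) \<Rightarrow> real \<Rightarrow> real^'n^'n" where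
  "coeff_R L x t = hess_xx L (phase_curve x t)"

definition periodic_symmetric :: "real \<Rightarrow> (real \<Rightarrow> real^'n^'n) \<Rightarrow> bool" where
  "periodic_symmetric T A \<longleftrightarrow>
     continuous_on UNIV A \<and> (\<forall>t. A (t + T) = A t) \<and> (\<forall>t. transpose (A t) = A t)"

definition brake_coefficients ::
  "real \<Rightarrow> (real \<Rightarrow> real^'n^'n) \<Rightarrow> (real \<Rightarrow> real^'n^'n) \<Rightarrow> (real \<Rightarrow> real^'n^'n) \<Rightarrow> bool" where
  "brake_coefficients T P Q R \<longleftrightarrow>
     periodic_symmetric T P \<and> periodic_symmetric T Q \<and> periodic_symmetric T R \<and>
     (\<forall>t. pos_def_matrix (P t)) \<and>
     (\<forall>t. P (- t) = P t) \<and> (\<forall>t. Q (- t) = - Q t) \<and> (\<forall>t. R (- t) = R t)"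

definition brake_orbit :: "real \<Rightarrow> (real \<times> (real^'n) \<times> (real^'n) \<Rightarrow> real) \<Rightarrow> (real \<Rightarrow> real^'n) \<Rightarrow> bool" where
  "brake_orbit T L x \<longleftrightarrow>
     euler_lagrange L x \<and>
     vector_derivative x (at 0) = 0 \<and> vector_derivative x (at (T / 2)) = 0 \<and>
     (\<forall>t. x (T / 2 + t) = x (T / 2 - t)) \<and>
     (\<forall>t. x (T + t) = x t) \<and>
     brake_coefficients T (coeff_P L x) (coeff_Q L x) (coeff_R L x)"


section \<open>Monodromy\<close>

text \<open>Vectors of dimension 2n are indexed by \<open>'n + 'n\<close>.\<close>

definition block_matrix :: "'a^'n^'n \<Rightarrow> 'a^'n^'n \<Rightarrow> 'a^'n^'n \<Rightarrow> 'a^'n^'n \<Rightarrow> 'a^('n::finite + 'n)^('n + 'n)" where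
  "block_matrix A B C D = (\<chi> i j.
     case i of
       Inl a \<Rightarrow> (case j of Inl b \<Rightarrow> A $ a $ b | Inr b \<Rightarrow> B $ a $ b)
     | Inr a \<Rightarrow> (case j of Inl b \<Rightarrow> C $ a $ b | Inr b \<Rightarrow> D $ a $ b))"

definition J_matrix :: "real^('n::finite + 'n)^('n + 'n)" where
  "J_matrix = block_matrix 0 (- mat 1) (mat 1) 0"

definition B_matrix :: "real^'n^'n \<Rightarrow> real^'n^'n \<Rightarrow> real^'n^'n \<Rightarrow> real^('n::finite + 'n)^('n + 'n)" where
  "B_matrix P Q R = block_matrix
     (matrix_inv P)                       (- (matrix_inv P ** Q))
     (- (transpose Q ** matrix_inv P))    (transpose Q ** matrix_inv P ** Q - R)"

definition fundamental_solution ::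
  "(real \<Rightarrow> real^'n^'n) \<Rightarrow> (real \<Rightarrow> real^'n^'n) \<Rightarrow> (real \<Rightarrow> real^'n^'n) \<Rightarrow>
   (real \<Rightarrow> real^('n::finite + 'n)^('n + 'n)) \<Rightarrow> bool" where
  "fundamental_solution P Q R \<gamma> \<longleftrightarrow>
     \<gamma> 0 = mat 1 \<and>
     (\<forall>t. (\<gamma> has_vector_derivative (J_matrix ** B_matrix (P t) (Q t) (R t) ** \<gamma> t)) (at t))"

definition cmatrix :: "real^'n^'m \<Rightarrow> complex^'n^'m" where
  "cmatrix = map_matrix complex_of_real"

definition matrix_spectrum :: "complex^'m^'m \<Rightarrow> complex set" where
  "matrix_spectrum A = {\<mu>. \<not> invertible (A - mat \<mu>)}"

definition matrix_eigenspace :: "complex^'m^'m \<Rightarrow> complex \<Rightarrow> (complex^'m) set" where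
  "matrix_eigenspace A \<mu> = {v. (A - mat \<mu>) *v v = 0}"

text \<open>Complex dimension (\<open>vec.dim\<close>, not the real \<open>dim\<close>) of the internal direct sum of the
  eigenspaces for the eigenvalues in \<open>S\<close>; as eigenspaces of distinct eigenvalues are independent,
  the subspace they span is their direct sum.\<close>

definition eigensum_dim :: "complex^'m^'m \<Rightarrow> complex set \<Rightarrow> nat" where
  "eigensum_dim A S =
     vec.dim (vec.span (\<Union>\<mu> \<in> matrix_spectrum A \<inter> S. matrix_eigenspace A \<mu>))"

definition upper_half_plane :: "complex set" where
  "upper_half_plane = {\<mu>. Im \<mu> > 0}"


section \<open>Morse indices\<close>

definition L2_on :: "real \<Rightarrow> (real \<Rightarrow> complex^'n) \<Rightarrow> bool" where
  "L2_on T f \<longleftrightarrow>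
     f \<in> borel_measurable (lebesgue_on {0..T}) \<and>
     integrable (lebesgue_on {0..T}) (\<lambda>t. (norm (f t))\<^sup>2)"

text \<open>\<open>W12 T f g\<close>: on \<open>[0,T]\<close>, \<open>f\<close> is the absolutely continuous representative of an element
  of \<open>W\<^sup>1\<^sup>,\<^sup>2\<close> whose weak derivative is \<open>g\<close> (determined up to null sets). Boundary values in
  \<open>W\<^sup>1\<^sup>,\<^sup>2\<close> are those of this representative.\<close>

definition W12 :: "real \<Rightarrow> (real \<Rightarrow> complex^'n) \<Rightarrow> (real \<Rightarrow> complex^'n) \<Rightarrow> bool" where
  "W12 T f g \<longleftrightarrow> L2_on T g \<and> (\<forall>t\<in>{0..T}. (g has_integral (f t - f 0)) {0..t})"

text \<open>A boundary condition is a predicate on the function \<open>\<xi>\<close> and on its momentum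
  \<open>y = P \<xi>' + Q \<xi>\<close>.\<close>

type_synonym 'n boundary_condition =
  "real \<Rightarrow> (real \<Rightarrow> complex^'n) \<Rightarrow> (real \<Rightarrow> complex^'n) \<Rightarrow> bool"

definition Dirichlet :: "('n::finite) boundary_condition" where
  "Dirichlet T \<xi> y \<longleftrightarrow> \<xi> 0 = 0 \<and> \<xi> T = 0"

definition Neumann :: "('n::finite) boundary_condition" where
  "Neumann T \<xi> y \<longleftrightarrow> y 0 = 0 \<and> y T = 0"

text \<open>Graph of the operator: \<open>\<xi>\<close> lies in the domain and
  \<open>- (P \<xi>' + Q \<xi>)' + Q\<^sup>T \<xi>' + R \<xi> = \<eta>\<close> almost everywhere on \<open>[0,T]\<close>. Here \<open>g\<close> is \<open>\<xi>'\<close>,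
  \<open>y\<close> is the continuous representative of the momentum and \<open>h\<close> is \<open>y'\<close>.\<close>

definition sturm_graph ::
  "(real \<Rightarrow> real^'n^'n) \<Rightarrow> (real \<Rightarrow> real^'n^'n) \<Rightarrow> (real \<Rightarrow> real^'n^'n) \<Rightarrow> real \<Rightarrow>
   ('n::finite) boundary_condition \<Rightarrow> (real \<Rightarrow> complex^'n) \<Rightarrow> (real \<Rightarrow> complex^'n) \<Rightarrow> bool" where
  "sturm_graph P Q R T \<Lambda> \<xi> \<eta> \<longleftrightarrow> (\<exists>g y h.
     W12 T \<xi> g \<and> W12 T y h \<and>
     (AE t in lebesgue_on {0..T}. y t = cmatrix (P t) *v g t + cmatrix (Q t) *v \<xi> t) \<and>
     \<Lambda> T \<xi> y \<and>
     (AE t in lebesgue_on {0..T}.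
        \<eta> t = - h t + cmatrix (transpose (Q t)) *v g t + cmatrix (R t) *v \<xi> t))"

text \<open>Kernel of the operator minus \<open>\<mu>\<close>. Each class in \<open>L\<^sup>2\<close> is represented by its continuous
  representative on \<open>[0,T]\<close>, extended by 0 so that distinct functions are distinct classes.\<close>

definition sturm_eigenspace ::
  "(real \<Rightarrow> real^'n^'n) \<Rightarrow> (real \<Rightarrow> real^'n^'n) \<Rightarrow> (real \<Rightarrow> real^'n^'n) \<Rightarrow> real \<Rightarrow>
   ('n::finite) boundary_condition \<Rightarrow> real \<Rightarrow> (real \<Rightarrow> complex^'n) set" where
  "sturm_eigenspace P Q R T \<Lambda> \<mu> =
     {\<xi>. (\<forall>t. t \<notin> {0..T} \<longrightarrow> \<xi> t = 0) \<and>
         sturm_graph P Q R T \<Lambda> \<xi> (\<lambda>t. complex_of_real \<mu> *s \<xi> t)}"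

definition scale_cfun :: "complex \<Rightarrow> ('a \<Rightarrow> complex^'n) \<Rightarrow> 'a \<Rightarrow> complex^'n" where
  "scale_cfun c f = (\<lambda>t. c *s f t)"

global_interpretation cfun: vector_space "scale_cfun :: complex \<Rightarrow> ('a \<Rightarrow> complex^'n) \<Rightarrow> 'a \<Rightarrow> complex^'n"
  by unfold_locales
    (auto simp: scale_cfun_def fun_eq_iff vec.scale_right_distrib vec.scale_left_distrib)

text \<open>The operators are bounded below with compact resolvent, so the eigenspaces are
  finite-dimensional and the sum below is finite; since the operators are self-adjoint,
  all eigenvalues are real.\<close>

definition morse_index ::
  "(real \<Rightarrow> real^'n^'n) \<Rightarrow> (real \<Rightarrow> real^'n^'n) \<Rightarrow> (real \<Rightarrow> real^'n^'n) \<Rightarrow> real \<Rightarrow>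
   ('n::finite) boundary_condition \<Rightarrow> nat" where
  "morse_index P Q R T \<Lambda> =
     (\<Sum>\<mu> | \<mu> < 0 \<and> sturm_eigenspace P Q R T \<Lambda> \<mu> \<noteq> {0}.
        cfun.dim (sturm_eigenspace P Q R T \<Lambda> \<mu>))"

definition nullity ::
  "(real \<Rightarrow> real^'n^'n) \<Rightarrow> (real \<Rightarrow> real^'n^'n) \<Rightarrow> (real \<Rightarrow> real^'n^'n) \<Rightarrow> real \<Rightarrow>
   ('n::finite) boundary_condition \<Rightarrow> nat" where
  "nullity P Q R T \<Lambda> = cfun.dim (sturm_eigenspace P Q R T \<Lambda> 0)"

end

theory Submission
  imports Defs "HOL-Complex_Analysis.Great_Picard"
begin

text \<open>
  The index form of the Sturm-Liouville operator, restricted to solutions of the linearized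
  equation, is a boundary term. Let \<open>S\<close> be the sum of the eigenspaces of \<open>\<gamma>(T)\<close> for eigenvalues in
  \<open>{Im \<lambda> > 0} \<union> {1, -1}\<close>. Symplecticity of \<open>\<gamma>(T)\<close> together with the reflection \<open>t \<mapsto> T - t\<close>
  (brake symmetry) makes the form vanish on \<open>S\<close>. By Green's formula \<open>S\<close> is also orthogonal to the
  negative Dirichlet eigenfunctions, so \<open>S\<close> together with these spans a nonpositive subspace of
  dimension \<open>dim S + m\<^sup>-(\<Lambda>\<^sub>D)\<close>, which is at most \<open>m\<^sup>-(\<Lambda>\<^sub>N) + m\<^sup>0(\<Lambda>\<^sub>N)\<close>. Without the eigenvalues
  \<open>\<plusminus>1\<close> this subspace contains no Neumann kernel function, because such a function would give an
  element of \<open>S\<close> fixed by the reflection, which exchanges \<open>\<lambda>\<close> and \<open>1/\<lambda>\<close>; hence the nullity can be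
  dropped.

  Nonpositive subspaces are bounded by the Neumann index through a minimizing sequence for the
  Rayleigh quotient. Testing the almost Euler-Lagrange equation with the residual of its integrated
  form shows that the residual tends to 0 in \<open>L\<^sup>2\<close>; the theorem of Arzela and Ascoli applied to
  functions and momenta then yields a \<open>C\<^sup>1\<close> eigenfunction, so that no completeness of \<open>W\<^sup>1\<^sup>,\<^sup>2\<close> is
  needed.
\<close>

section \<open>Real matrices acting on complex vectors\<close>

text \<open>All forms are kept real: the inner product of complex vectors is the real part of the
  Hermitian one, so the index form is symmetric and a matrix with real entries has its transpose as
  adjoint. Since every dimension in the claim is complex, complex linearity has to be recovered, by
  letting a scalar run through one argument of a real identity.

  The definitions of \<open>morse_index\<close> and \<open>nullity\<close> pose an obstacle of their
  own: a sum over an infinite set and the dimension of an infinite-dimensional space would have the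
  value 0. Finiteness of the nonpositive spectrum and of its multiplicities must therefore precede
  any counting; coercivity of the form provides both at once.

  Functions are never expanded in eigenfunctions. It suffices that the form is positive on the
  complement of the finitely many nonpositive Neumann eigenspaces, so that a subspace of too large a
  dimension would meet this complement.\<close>

definition cmv :: "real^'n^'m \<Rightarrow> complex^'n \<Rightarrow> complex^'m"
  where "cmv A u = cmatrix A *v u"

lemma cmv_nth: "cmv A u $ i = (\<Sum>j\<in>UNIV. complex_of_real (A $ i $ j) * u $ j)"
  by (simp add: cmv_def cmatrix_def map_matrix_def matrix_vector_mult_def)

lemma cmv_add: "cmv A (u + v) = cmv A u + cmv A v"
  by (simp add: cmv_def matrix_vector_right_distrib)

lemma cmv_diff: "cmv A (u - v) = cmv A u - cmv A v"
  by (simp add: cmv_def matrix_vector_mult_diff_distrib)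

lemma cmv_0 [simp]: "cmv A 0 = 0"
  by (simp add: cmv_def)

lemma cmv_minus: "cmv A (- u) = - cmv A u"
  using cmv_diff[of A 0 u] by simp

lemma cmv_vscale: "cmv A (c *s u) = c *s cmv A u"
  by (simp add: cmv_def vec.scale)

lemma cmv_scaleR: "cmv A (c *\<^sub>R u) = c *\<^sub>R cmv A u"
  by (simp add: vec_eq_iff cmv_nth scaleR_sum_right)

lemma cmv_add_left: "cmv (A + B) u = cmv A u + cmv B u"
  by (simp add: vec_eq_iff cmv_nth algebra_simps sum.distrib)

lemma cmv_diff_left: "cmv (A - B) u = cmv A u - cmv B u"
  by (simp add: vec_eq_iff cmv_nth algebra_simps sum_subtractf)

lemma cmv_minus_left: "cmv (- A) u = - cmv A u"
  by (simp add: vec_eq_iff cmv_nth sum_negf)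

lemma cmv_zero_left [simp]: "cmv 0 u = 0"
  by (simp add: vec_eq_iff cmv_nth)

lemma cmv_mult: "cmv (A ** B) u = cmv A (cmv B u)"
proof -
  have "cmatrix (A ** B) = cmatrix A ** cmatrix B"
    by (simp add: cmatrix_def map_matrix_def matrix_matrix_mult_def vec_eq_iff)
  then show ?thesis
    by (simp add: cmv_def matrix_vector_mul_assoc)
qed

lemma cmv_mat: "cmv (mat a) u = complex_of_real a *s u"
  by (simp add: vec_eq_iff cmv_nth mat_def if_distrib[of complex_of_real]
      if_distrib[of "\<lambda>x. x * _"] sum.delta cong: if_cong)

lemma cmv_mat1 [simp]: "cmv (mat 1) u = u"
  by (simp add: cmv_mat)

lemma of_real_vscale: "complex_of_real c *s u = c *\<^sub>R u" for u :: "complex^'n"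
  by (simp add: vec_eq_iff) (simp add: scaleR_conv_of_real)

lemma cmv_adjoint: "cmv A u \<bullet> w = u \<bullet> cmv (transpose A) w"
proof -
  have "cmv A u \<bullet> w = (\<Sum>i\<in>UNIV. \<Sum>j\<in>UNIV. A $ i $ j * (u $ j \<bullet> w $ i))"
    by (simp add: inner_vec_def cmv_nth inner_sum_left flip: scaleR_conv_of_real)
  also have "\<dots> = (\<Sum>j\<in>UNIV. \<Sum>i\<in>UNIV. A $ i $ j * (u $ j \<bullet> w $ i))"
    by (rule sum.swap)
  also have "\<dots> = u \<bullet> cmv (transpose A) w"
    by (simp add: inner_vec_def cmv_nth inner_sum_right transpose_def flip: scaleR_conv_of_real)
  finally show ?thesis .
qed

lemma inner_vscale: "(c *s u) \<bullet> w = u \<bullet> (cnj c *s w)" for u w :: "complex^'n"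
  unfolding inner_vec_def by (intro sum.cong) (auto simp: inner_complex_def algebra_simps)

lemma bounded_linear_vscale: "bounded_linear (\<lambda>u. c *s u)" for c :: complex
  by (intro linear_conv_bounded_linear[THEN iffD1] linearI)
     (auto simp: vec_eq_iff algebra_simps)

lemma continuous_on_cmv [continuous_intros]:
  assumes "continuous_on S A" "continuous_on S f"
  shows "continuous_on S (\<lambda>t. cmv (A t) (f t))"
proof -
  have "continuous_on S (\<lambda>t. cmv (A t) (f t) $ i)" for i
    unfolding cmv_nth using assms by (intro continuous_intros)
  then have "continuous_on S (\<lambda>t. \<chi> i. cmv (A t) (f t) $ i)"
    by (rule continuous_on_vec_lambda)
  then show ?thesis by simp
qed

lemma transpose_minus_mat:
  "transpose (A - mat a) = transpose A - mat a" for A :: "'a::ab_group_add^'n^'n"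
  by (auto simp: vec_eq_iff transpose_def mat_def)

text \<open>The real inner product has no mixed terms between real and imaginary parts, so the value
  is the real quadratic form at the real part plus that at the imaginary part, and one of these
  parts is nonzero.\<close>

lemma pos_def_complex:
  fixes A :: "real^'n^'n"
  assumes "pos_def_matrix A" "u \<noteq> 0"
  shows "cmv A u \<bullet> u > 0"
proof -
  let ?r = "\<chi> i. Re (u $ i)" and ?s = "\<chi> i. Im (u $ i)"
  have "cmv A u \<bullet> u = ?r \<bullet> (A *v ?r) + ?s \<bullet> (A *v ?s)"
    by (simp add: inner_vec_def cmv_nth matrix_vector_mult_def inner_complex_def
        sum.distrib[symmetric] algebra_simps sum_distrib_left sum_distrib_right)
  moreover have "?r \<noteq> 0 \<or> ?s \<noteq> 0"
    using assms(2) by (auto simp: vec_eq_iff complex_eq_iff)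
  moreover have "?r \<bullet> (A *v ?r) \<ge> 0" "?s \<bullet> (A *v ?s) \<ge> 0"
    using assms(1) by (metis inner_zero_left less_eq_real_def pos_def_matrix_def)+
  moreover have "?r \<noteq> 0 \<Longrightarrow> ?r \<bullet> (A *v ?r) > 0" "?s \<noteq> 0 \<Longrightarrow> ?s \<bullet> (A *v ?s) > 0"
    using assms(1) unfolding pos_def_matrix_def by blast+
  ultimately show ?thesis by linarith
qed

lemma pos_def_invertible:
  fixes A :: "real^'n^'n"
  assumes "pos_def_matrix A"
  shows "A ** matrix_inv A = mat 1" "matrix_inv A ** A = mat 1"
proof -
  have "invertible A"
  proof -
    have "\<forall>u. A *v u = 0 \<longrightarrow> u = 0"
      using assms unfolding pos_def_matrix_def by (metis inner_zero_right less_irrefl)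
    then show ?thesis
      by (metis invertible_left_inverse matrix_left_invertible_ker)
  qed
  then show "A ** matrix_inv A = mat 1" "matrix_inv A ** A = mat 1"
    unfolding invertible_def matrix_inv_def by (metis (mono_tags, lifting) someI_ex)+
qed

lemma quadratic_nonneg_imp:
  fixes a b c :: real
  assumes "\<And>s. a + 2 * s * b + s\<^sup>2 * c \<ge> 0" "a \<ge> 0" "c \<ge> 0"
  shows "b\<^sup>2 \<le> a * c"
proof (cases "c = 0")
  case True
  have "b = 0"
  proof (rule ccontr)
    assume "b \<noteq> 0"
    \<comment> \<open>For \<open>c = 0\<close> the expression is affine in \<open>s\<close>; the
      chosen \<open>s\<close> makes it equal to -1.\<close>
    then show False
      using assms(1)[of "- (a + 1) / (2 * b)"] True by (simp add: field_simps)
  qed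
  then show ?thesis using True by simp
next
  case False
  then have "c > 0" using assms by simp
  \<comment> \<open>The minimizer of the quadratic polynomial in \<open>s\<close>.\<close>
  have "0 \<le> a + 2 * (- b / c) * b + (- b / c)\<^sup>2 * c" by (rule assms(1))
  also have "\<dots> = a - b\<^sup>2 / c"
    using False by (simp add: field_simps power2_eq_square)
  finally show ?thesis using \<open>c > 0\<close> by (simp add: field_simps)
qed

section \<open>Continuously differentiable functions and the index form\<close>

lemma integral_Cauchy_Schwarz:
  fixes f g :: "real \<Rightarrow> real"
  assumes f: "continuous_on {a..b} f" and g: "continuous_on {a..b} g"
  shows "(integral {a..b} (\<lambda>t. f t * g t))\<^sup>2
           \<le> integral {a..b} (\<lambda>t. (f t)\<^sup>2) * integral {a..b} (\<lambda>t. (g t)\<^sup>2)"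
proof (rule quadratic_nonneg_imp)
  fix s :: real
  have i: "(\<lambda>t. (f t)\<^sup>2) integrable_on {a..b}" "(\<lambda>t. (g t)\<^sup>2) integrable_on {a..b}"
    "(\<lambda>t. f t * g t) integrable_on {a..b}"
    using f g by (auto intro!: integrable_continuous_real continuous_intros)
  have "0 \<le> integral {a..b} (\<lambda>t. (f t + s * g t)\<^sup>2)"
    using f g by (intro integral_nonneg integrable_continuous_real continuous_intros) auto
  also have "\<dots> = integral {a..b} (\<lambda>t. ((f t)\<^sup>2 + (2 * s) * (f t * g t)) + s\<^sup>2 * (g t)\<^sup>2)"
    by (rule integral_cong) (simp add: power2_eq_square algebra_simps)
  also have "\<dots> = integral {a..b} (\<lambda>t. (f t)\<^sup>2) + 2 * s * integral {a..b} (\<lambda>t. f t * g t)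
                 + s\<^sup>2 * integral {a..b} (\<lambda>t. (g t)\<^sup>2)"
  proof -
    have "((\<lambda>t. ((f t)\<^sup>2 + (2 * s) * (f t * g t)) + s\<^sup>2 * (g t)\<^sup>2) has_integral
        integral {a..b} (\<lambda>t. (f t)\<^sup>2) + 2 * s * integral {a..b} (\<lambda>t. f t * g t)
                 + s\<^sup>2 * integral {a..b} (\<lambda>t. (g t)\<^sup>2)) {a..b}"
      by (intro has_integral_add has_integral_mult_right integrable_integral i)
    then show ?thesis by (rule integral_unique)
  qed
  finally show "0 \<le> \<dots>" .
next
  show "0 \<le> integral {a..b} (\<lambda>t. (f t)\<^sup>2)" "0 \<le> integral {a..b} (\<lambda>t. (g t)\<^sup>2)"
    using f g by (auto intro!: integral_nonneg integrable_continuous_real continuous_intros)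
qed

lemma integral_norm_square_le:
  fixes f :: "real \<Rightarrow> 'a::real_normed_vector"
  assumes f: "continuous_on {a..b} f" and "a \<le> b"
  shows "(integral {a..b} (\<lambda>t. norm (f t)))\<^sup>2 \<le> (b - a) * integral {a..b} (\<lambda>t. (norm (f t))\<^sup>2)"
  using integral_Cauchy_Schwarz[of a b "\<lambda>t. norm (f t)" "\<lambda>_. 1"] assms
  by (simp add: continuous_on_norm mult.commute)

text \<open>The sum of the absolute values of the entries dominates the operator norm and is visibly
  continuous in \<open>t\<close>; compactness of the interval then gives one constant.\<close>

lemma continuous_matrix_bound:
  fixes A :: "real \<Rightarrow> real^'n^'m"
  assumes "continuous_on {a..b} A"
  obtains K where "K > 0" "\<And>t u. t \<in> {a..b} \<Longrightarrow> norm (cmv (A t) u) \<le> K * norm u"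
proof -
  define F where "F t = (\<Sum>i\<in>UNIV. \<Sum>j\<in>UNIV. \<bar>A t $ i $ j\<bar>)" for t
  have "continuous_on {a..b} F"
    unfolding F_def using assms by (intro continuous_intros)
  then have "bounded (F ` {a..b})"
    by (intro compact_imp_bounded compact_continuous_image) auto
  then obtain K where K: "K > 0" "\<And>t. t \<in> {a..b} \<Longrightarrow> norm (F t) \<le> K"
    unfolding bounded_pos by auto
  have "norm (cmv (A t) u) \<le> F t * norm u" for t u
  proof -
    have "norm (cmv (A t) u) \<le> (\<Sum>i\<in>UNIV. norm (cmv (A t) u $ i))"
      unfolding norm_vec_def by (rule L2_set_le_sum) auto
    also have "\<dots> \<le> (\<Sum>i\<in>UNIV. \<Sum>j\<in>UNIV. \<bar>A t $ i $ j\<bar> * norm u)"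
      unfolding cmv_nth
      by (intro sum_mono order_trans[OF norm_sum])
         (auto simp: norm_mult Finite_Cartesian_Product.norm_nth_le mult_left_mono)
    finally show ?thesis by (simp add: F_def sum_distrib_right)
  qed
  moreover have "F t * norm u \<le> K * norm u" if "t \<in> {a..b}" for t and u :: "complex^'n"
    using K(2)[OF that] by (intro mult_right_mono) auto
  ultimately show ?thesis using that K(1) by (meson order_trans)
qed

text \<open>A continuous positive function on the compact product of the interval with the unit
  sphere has a positive minimum; homogeneity of degree 2 extends the bound to all vectors.\<close>

lemma continuous_pos_def_bound:
  fixes A :: "real \<Rightarrow> real^'n^'n"
  assumes "continuous_on {a..b} A" "\<And>t. t \<in> {a..b} \<Longrightarrow> pos_def_matrix (A t)"
  obtains \<alpha> where "\<alpha> > 0" "\<And>t u. t \<in> {a..b} \<Longrightarrow> cmv (A t) u \<bullet> u \<ge> \<alpha> * (norm u)\<^sup>2"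
proof (cases "a \<le> b")
  case False
  then show ?thesis using that[of 1] by auto
next
  case True
  let ?K = "{a..b} \<times> sphere (0 :: complex^'n) 1"
  have cont: "continuous_on ?K (\<lambda>x. cmv (A (fst x)) (snd x) \<bullet> snd x)"
    by (intro continuous_intros continuous_on_compose2[OF assms(1)]) auto
  have comp: "compact ?K" by (intro compact_Times compact_Icc compact_sphere)
  obtain e :: "complex^'n" where "norm e = 1" using vector_choose_size[of 1] by auto
  then have ne: "?K \<noteq> {}" using True by (metis SigmaI all_not_in_conv atLeastAtMost_iff mem_sphere_0 order_refl)
  obtain x where x: "x \<in> ?K"
    "\<forall>z\<in>?K. cmv (A (fst x)) (snd x) \<bullet> snd x \<le> cmv (A (fst z)) (snd z) \<bullet> snd z"
    using continuous_attains_inf[OF comp ne cont] by (elim bexE) blast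
  define \<alpha> where "\<alpha> = cmv (A (fst x)) (snd x) \<bullet> snd x"
  have "\<alpha> > 0" unfolding \<alpha>_def using x(1) by (intro pos_def_complex assms(2)) auto
  moreover have "cmv (A t) u \<bullet> u \<ge> \<alpha> * (norm u)\<^sup>2" if "t \<in> {a..b}" for t u
  proof (cases "u = 0")
    case False
    define v where "v = (1 / norm u) *\<^sub>R u"
    have "v \<in> sphere 0 1" using False by (simp add: v_def)
    then have "\<alpha> \<le> cmv (A t) v \<bullet> v"
      using x(2)[rule_format, of "(t, v)"] that by (simp add: \<alpha>_def)
    also have "\<dots> = cmv (A t) u \<bullet> u / (norm u)\<^sup>2"
      by (simp add: v_def cmv_scaleR power2_eq_square)
    finally show ?thesis using False by (simp add: field_simps)
  qed auto
  ultimately show ?thesis using that by blast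
qed

text \<open>Continuity of the inverse matrix is bypassed: coercivity bounds
  \<open>\<alpha> * norm (v t - v s)\<close> by the norm of \<open>w t - cmv (A t) (v s)\<close>,
  which is continuous in \<open>t\<close> and vanishes at \<open>t = s\<close>.\<close>

lemma continuous_on_matrix_solve:
  fixes A :: "real \<Rightarrow> real^'n^'n"
  assumes A: "continuous_on {a..b} A" "\<And>t. t \<in> {a..b} \<Longrightarrow> pos_def_matrix (A t)"
    and w: "continuous_on {a..b} w"
    and v: "\<And>t. t \<in> {a..b} \<Longrightarrow> cmv (A t) (v t) = w t"
  shows "continuous_on {a..b} v"
proof -
  obtain \<alpha> where \<alpha>: "\<alpha> > 0" "\<And>t u. t \<in> {a..b} \<Longrightarrow> cmv (A t) u \<bullet> u \<ge> \<alpha> * (norm u)\<^sup>2"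
    using continuous_pos_def_bound[OF A] by blast
  have *: "\<alpha> * norm (v t - v s) \<le> norm (w t - cmv (A t) (v s))" if "t \<in> {a..b}" for t s
  proof (cases "v t = v s")
    case False
    have "cmv (A t) (v t - v s) = w t - cmv (A t) (v s)"
      by (simp add: cmv_diff v[OF that])
    then have "\<alpha> * (norm (v t - v s))\<^sup>2 \<le> (w t - cmv (A t) (v s)) \<bullet> (v t - v s)"
      using \<alpha>(2)[OF that, of "v t - v s"] by simp
    also have "\<dots> \<le> norm (w t - cmv (A t) (v s)) * norm (v t - v s)"
      by (rule norm_cauchy_schwarz)
    finally show ?thesis using False by (simp add: power2_eq_square)
  qed auto
  show ?thesis
    unfolding continuous_on_def
  proof
    fix s assume s: "s \<in> {a..b}"
    have "continuous_on {a..b} (\<lambda>t. norm (w t - cmv (A t) (v s)) / \<alpha>)"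
      using \<alpha>(1) by (intro continuous_intros w A(1)) auto
    then have "((\<lambda>t. norm (w t - cmv (A t) (v s)) / \<alpha>) \<longlongrightarrow> norm (w s - cmv (A s) (v s)) / \<alpha>)
        (at s within {a..b})"
      using s by (simp only: continuous_on_def)
    then have lim: "((\<lambda>t. norm (w t - cmv (A t) (v s)) / \<alpha>) \<longlongrightarrow> 0) (at s within {a..b})"
      by (simp only: v[OF s] diff_self norm_zero div_0)
    have "norm (v t - v s) \<le> norm (w t - cmv (A t) (v s)) / \<alpha>" if "t \<in> {a..b}" for t
      using *[OF that, of s] \<alpha>(1) by (simp add: field_simps)
    then have "\<forall>\<^sub>F t in at s within {a..b}.
        norm (v t - v s) \<le> norm (w t - cmv (A t) (v s)) / \<alpha>"
      unfolding eventually_at_filter by (intro always_eventually) blast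
    then have "((\<lambda>t. v t - v s) \<longlongrightarrow> 0) (at s within {a..b})"
      by (rule Lim_null_comparison) (rule lim)
    then show "(v \<longlongrightarrow> v s) (at s within {a..b})"
      by (rule LIM_zero_cancel)
  qed
qed

lemma scale_cfun_apply: "scale_cfun c f t = c *s f t"
  by (simp add: scale_cfun_def)

section \<open>Continuously differentiable functions on [0,T]\<close>

locale interval =
  fixes T :: real
  assumes T_pos: "T > 0"
begin

definition Dv :: "(real \<Rightarrow> complex^'n) \<Rightarrow> real \<Rightarrow> complex^'n"
  where "Dv \<xi> t = vector_derivative \<xi> (at t within {0..T})"

text \<open>The form domain, in place of \<open>W\<^sup>1\<^sup>,\<^sup>2\<close>. Extension by 0
  follows the convention of \<open>sturm_eigenspace\<close>: functions that agree on [0,T] are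
  equal, which makes the L2 product definite. Derivatives at the end points are one-sided.\<close>

definition C1 :: "(real \<Rightarrow> complex^'n) set" where
  "C1 = {\<xi>. (\<forall>t. t \<notin> {0..T} \<longrightarrow> \<xi> t = 0) \<and>
           (\<forall>t\<in>{0..T}. (\<xi> has_vector_derivative Dv \<xi> t) (at t within {0..T})) \<and>
           continuous_on {0..T} (Dv \<xi>)}"

lemma C1_zero_outside: "\<xi> \<in> C1 \<Longrightarrow> t \<notin> {0..T} \<Longrightarrow> \<xi> t = 0"
  by (simp add: C1_def)

lemma C1_deriv: "\<xi> \<in> C1 \<Longrightarrow> t \<in> {0..T} \<Longrightarrow> (\<xi> has_vector_derivative Dv \<xi> t) (at t within {0..T})"
  by (simp add: C1_def)

lemma C1_cont_Dv: "\<xi> \<in> C1 \<Longrightarrow> continuous_on {0..T} (Dv \<xi>)"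
  by (simp add: C1_def)

lemma C1_cont: "\<xi> \<in> C1 \<Longrightarrow> continuous_on {0..T} \<xi>"
  unfolding continuous_on_eq_continuous_within
  using C1_deriv has_vector_derivative_continuous by blast

lemma Dv_eq:
  "t \<in> {0..T} \<Longrightarrow> (\<xi> has_vector_derivative d) (at t within {0..T}) \<Longrightarrow> Dv \<xi> t = d"
  unfolding Dv_def using T_pos by (intro vector_derivative_within_closed_interval)

lemma C1_I:
  assumes "\<And>t. t \<notin> {0..T} \<Longrightarrow> \<xi> t = 0"
    and "\<And>t. t \<in> {0..T} \<Longrightarrow> (\<xi> has_vector_derivative g t) (at t within {0..T})"
    and "continuous_on {0..T} g"
  shows "\<xi> \<in> C1"
proof -
  have "Dv \<xi> t = g t" if "t \<in> {0..T}" for t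
    using assms(2) that by (intro Dv_eq)
  then show ?thesis
    using assms continuous_on_cong[of "{0..T}" "{0..T}" "Dv \<xi>" g] by (simp add: C1_def)
qed

lemma Dv_add:
  "\<xi> \<in> C1 \<Longrightarrow> \<eta> \<in> C1 \<Longrightarrow> t \<in> {0..T} \<Longrightarrow> Dv (\<xi> + \<eta>) t = Dv \<xi> t + Dv \<eta> t"
  by (intro Dv_eq) (auto simp: plus_fun_def intro!: has_vector_derivative_add C1_deriv)

lemma Dv_scale:
  "\<xi> \<in> C1 \<Longrightarrow> t \<in> {0..T} \<Longrightarrow> Dv (scale_cfun c \<xi>) t = c *s Dv \<xi> t"
  unfolding scale_cfun_def
  by (intro Dv_eq bounded_linear.has_vector_derivative[OF bounded_linear_vscale] C1_deriv) auto

lemma subspace_C1: "cfun.subspace (C1 :: (real \<Rightarrow> complex^'n) set)"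
proof (rule cfun.subspaceI)
  show "(0 :: real \<Rightarrow> complex^'n) \<in> C1"
    by (rule C1_I[where g = "\<lambda>_. 0"]) (auto simp: zero_fun_def)
next
  fix \<xi> \<eta> :: "real \<Rightarrow> complex^'n" assume *: "\<xi> \<in> C1" "\<eta> \<in> C1"
  show "\<xi> + \<eta> \<in> C1"
    by (rule C1_I[where g = "\<lambda>t. Dv \<xi> t + Dv \<eta> t"])
       (use * in \<open>auto simp: plus_fun_def C1_zero_outside
          intro!: has_vector_derivative_add C1_deriv continuous_intros C1_cont_Dv\<close>)
next
  fix \<xi> :: "real \<Rightarrow> complex^'n" and c assume *: "\<xi> \<in> C1"
  show "scale_cfun c \<xi> \<in> C1"
    by (rule C1_I[where g = "\<lambda>t. c *s Dv \<xi> t"])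
       (use * in \<open>auto simp: scale_cfun_def C1_zero_outside
          intro!: bounded_linear.has_vector_derivative[OF bounded_linear_vscale]
            bounded_linear.continuous_on[OF bounded_linear_vscale] C1_deriv C1_cont_Dv\<close>)
qed

lemmas C1_add = cfun.subspace_add[OF subspace_C1]
lemmas C1_scale = cfun.subspace_scale[OF subspace_C1]
lemmas C1_diff = cfun.subspace_diff[OF subspace_C1]
lemmas C1_0 = cfun.subspace_0[OF subspace_C1]
lemmas C1_sum = cfun.subspace_sum[OF subspace_C1]

lemma C1_increment:
  assumes "\<xi> \<in> C1" "s \<in> {0..T}" "t \<in> {0..T}" "s \<le> t"
  shows "(Dv \<xi> has_integral (\<xi> t - \<xi> s)) {s..t}"
proof (rule fundamental_theorem_of_calculus[OF assms(4)])
  fix r assume r: "r \<in> {s..t}"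
  have "(\<xi> has_vector_derivative Dv \<xi> r) (at r within {0..T})"
    using C1_deriv[OF assms(1)] assms r by auto
  then show "(\<xi> has_vector_derivative Dv \<xi> r) (at r within {s..t})"
    by (rule has_vector_derivative_within_subset) (use assms in auto)
qed

definition L2 :: "(real \<Rightarrow> complex^'n) \<Rightarrow> (real \<Rightarrow> complex^'n) \<Rightarrow> real"
  where "L2 \<xi> \<eta> = integral {0..T} (\<lambda>t. \<xi> t \<bullet> \<eta> t)"

definition DD :: "(real \<Rightarrow> complex^'n) \<Rightarrow> real"
  where "DD \<xi> = integral {0..T} (\<lambda>t. (norm (Dv \<xi> t))\<^sup>2)"

lemma DD_nonneg: "\<xi> \<in> C1 \<Longrightarrow> DD \<xi> \<ge> 0"
  unfolding DD_def
  by (intro integral_nonneg integrable_continuous_real continuous_intros C1_cont_Dv) auto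

text \<open>Cauchy-Schwarz for the derivative against the constant 1. The Hoelder constant depends
  on the energy \<open>DD\<close> alone, which serves both the estimate on a grid and
  equicontinuity.\<close>

lemma C1_Hoelder_le:
  assumes "\<xi> \<in> C1" "s \<in> {0..T}" "t \<in> {0..T}" "s \<le> t"
  shows "(norm (\<xi> t - \<xi> s))\<^sup>2 \<le> (t - s) * DD \<xi>"
proof -
  have c: "continuous_on {s..t} (Dv \<xi>)"
    using C1_cont_Dv[OF assms(1)] by (rule continuous_on_subset) (use assms in auto)
  have "norm (\<xi> t - \<xi> s) = norm (integral {s..t} (Dv \<xi>))"
    using C1_increment[OF assms] by (simp add: integral_unique)
  also have "\<dots> \<le> integral {s..t} (\<lambda>r. norm (Dv \<xi> r))"
    by (intro integral_norm_bound_integral integrable_continuous_real continuous_intros c) auto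
  finally have "(norm (\<xi> t - \<xi> s))\<^sup>2 \<le> (integral {s..t} (\<lambda>r. norm (Dv \<xi> r)))\<^sup>2"
    by (intro power_mono) auto
  also have "\<dots> \<le> (t - s) * integral {s..t} (\<lambda>r. (norm (Dv \<xi> r))\<^sup>2)"
    by (rule integral_norm_square_le[OF c assms(4)])
  also have "\<dots> \<le> (t - s) * DD \<xi>"
    unfolding DD_def using assms
    by (intro mult_left_mono integral_subset_le integrable_continuous_real continuous_intros c
        C1_cont_Dv) auto
  finally show ?thesis .
qed

lemma C1_Hoelder:
  assumes "\<xi> \<in> C1" "s \<in> {0..T}" "t \<in> {0..T}"
  shows "(norm (\<xi> t - \<xi> s))\<^sup>2 \<le> \<bar>t - s\<bar> * DD \<xi>"
  using C1_Hoelder_le[of \<xi> s t] C1_Hoelder_le[of \<xi> t s] assms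
  by (cases "s \<le> t") (auto simp: norm_minus_commute)

end

section \<open>The index form and solutions of the linearized equation\<close>

locale coefficients = interval T for T +
  fixes P Q R :: "real \<Rightarrow> real^'n^'n"
  assumes cont_P: "continuous_on {0..T} P"
    and cont_Q: "continuous_on {0..T} Q"
    and cont_R: "continuous_on {0..T} R"
    and sym_P: "t \<in> {0..T} \<Longrightarrow> transpose (P t) = P t"
    and sym_R: "t \<in> {0..T} \<Longrightarrow> transpose (R t) = R t"
begin

lemma cont_Qt: "continuous_on {0..T} (\<lambda>t. transpose (Q t))"
  unfolding transpose_def by (intro continuous_intros cont_Q)

lemmas cont_coeffs = cont_P cont_Q cont_R cont_Qt

definition momentum :: "(real \<Rightarrow> complex^'n) \<Rightarrow> real \<Rightarrow> complex^'n"
  where "momentum \<xi> t = cmv (P t) (Dv \<xi> t) + cmv (Q t) (\<xi> t)"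

definition force :: "(real \<Rightarrow> complex^'n) \<Rightarrow> real \<Rightarrow> complex^'n"
  where "force \<xi> t = cmv (transpose (Q t)) (Dv \<xi> t) + cmv (R t) (\<xi> t)"

text \<open>The polarized second variation, as the real part of a Hermitian form. Momentum is paired
  with \<open>Dv \<eta>\<close> and force with \<open>\<eta>\<close>, so that the integrand is a
  total derivative as soon as \<xi> is a solution.\<close>

definition B :: "(real \<Rightarrow> complex^'n) \<Rightarrow> (real \<Rightarrow> complex^'n) \<Rightarrow> real"
  where "B \<xi> \<eta> = integral {0..T} (\<lambda>t. momentum \<xi> t \<bullet> Dv \<eta> t + force \<xi> t \<bullet> \<eta> t)"

lemma cont_momentum: "\<xi> \<in> C1 \<Longrightarrow> continuous_on {0..T} (momentum \<xi>)"
  unfolding momentum_def by (intro continuous_intros cont_coeffs C1_cont_Dv C1_cont)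

lemma cont_force: "\<xi> \<in> C1 \<Longrightarrow> continuous_on {0..T} (force \<xi>)"
  unfolding force_def by (intro continuous_intros cont_coeffs C1_cont_Dv C1_cont)

lemma cont_B_integrand:
  "\<xi> \<in> C1 \<Longrightarrow> \<eta> \<in> C1 \<Longrightarrow> continuous_on {0..T} (\<lambda>t. momentum \<xi> t \<bullet> Dv \<eta> t + force \<xi> t \<bullet> \<eta> t)"
  by (intro continuous_intros cont_momentum cont_force C1_cont_Dv C1_cont)

lemma momentum_add:
  "\<xi> \<in> C1 \<Longrightarrow> \<eta> \<in> C1 \<Longrightarrow> t \<in> {0..T} \<Longrightarrow> momentum (\<xi> + \<eta>) t = momentum \<xi> t + momentum \<eta> t"
  by (simp add: momentum_def Dv_add cmv_add)

lemma force_add: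
  "\<xi> \<in> C1 \<Longrightarrow> \<eta> \<in> C1 \<Longrightarrow> t \<in> {0..T} \<Longrightarrow> force (\<xi> + \<eta>) t = force \<xi> t + force \<eta> t"
  by (simp add: force_def Dv_add cmv_add)

lemma momentum_scale:
  "\<xi> \<in> C1 \<Longrightarrow> t \<in> {0..T} \<Longrightarrow> momentum (scale_cfun c \<xi>) t = c *s momentum \<xi> t"
  by (simp add: momentum_def Dv_scale cmv_vscale vec.scale_right_distrib scale_cfun_apply)

lemma force_scale:
  "\<xi> \<in> C1 \<Longrightarrow> t \<in> {0..T} \<Longrightarrow> force (scale_cfun c \<xi>) t = c *s force \<xi> t"
  by (simp add: force_def Dv_scale cmv_vscale vec.scale_right_distrib scale_cfun_apply)

text \<open>The terms with \<open>P\<close> and \<open>R\<close> are symmetric because the matrices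
  are; the two mixed terms are exchanged, since the adjoint of \<open>Q\<close> is its
  transpose.\<close>

lemma B_sym: "B \<xi> \<eta> = B \<eta> \<xi>"
  unfolding B_def
proof (rule integral_cong)
  fix t assume t: "t \<in> {0..T}"
  have "cmv (P t) (Dv \<xi> t) \<bullet> Dv \<eta> t = cmv (P t) (Dv \<eta> t) \<bullet> Dv \<xi> t"
    by (metis cmv_adjoint inner_commute transpose_transpose sym_P[OF t] sym_R[OF t])
  moreover have "cmv (R t) (\<xi> t) \<bullet> \<eta> t = cmv (R t) (\<eta> t) \<bullet> \<xi> t"
    by (metis cmv_adjoint inner_commute transpose_transpose sym_P[OF t] sym_R[OF t])
  moreover have "cmv (Q t) (\<xi> t) \<bullet> Dv \<eta> t = cmv (transpose (Q t)) (Dv \<eta> t) \<bullet> \<xi> t"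
    by (metis cmv_adjoint inner_commute transpose_transpose sym_P[OF t] sym_R[OF t])
  moreover have "cmv (transpose (Q t)) (Dv \<xi> t) \<bullet> \<eta> t = cmv (Q t) (\<eta> t) \<bullet> Dv \<xi> t"
    by (metis cmv_adjoint inner_commute transpose_transpose sym_P[OF t] sym_R[OF t])
  ultimately show "momentum \<xi> t \<bullet> Dv \<eta> t + force \<xi> t \<bullet> \<eta> t
      = momentum \<eta> t \<bullet> Dv \<xi> t + force \<eta> t \<bullet> \<xi> t"
    by (simp add: momentum_def force_def inner_add_left)
qed

lemma B_add_left:
  assumes "\<xi> \<in> C1" "\<xi>' \<in> C1" "\<eta> \<in> C1"
  shows "B (\<xi> + \<xi>') \<eta> = B \<xi> \<eta> + B \<xi>' \<eta>"
proof -
  have "B (\<xi> + \<xi>') \<eta> = integral {0..T} (\<lambda>t. (momentum \<xi> t \<bullet> Dv \<eta> t + force \<xi> t \<bullet> \<eta> t) +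
                          (momentum \<xi>' t \<bullet> Dv \<eta> t + force \<xi>' t \<bullet> \<eta> t))"
    unfolding B_def
    by (rule integral_cong) (simp add: assms momentum_add force_add inner_add_left)
  also have "\<dots> = B \<xi> \<eta> + B \<xi>' \<eta>"
    unfolding B_def
    by (intro Henstock_Kurzweil_Integration.integral_add integrable_continuous_real
        cont_B_integrand assms)
  finally show ?thesis .
qed

lemma B_add_right:
  assumes "\<xi> \<in> C1" "\<eta> \<in> C1" "\<eta>' \<in> C1"
  shows "B \<xi> (\<eta> + \<eta>') = B \<xi> \<eta> + B \<xi> \<eta>'"
  using B_add_left[of \<eta> \<eta>' \<xi>] assms by (simp add: B_sym)

text \<open>A complex scalar crosses to the other argument conjugated. This is what remains of
  sesquilinearity in a real form, and it suffices to rebuild complex identities.\<close>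

lemma B_scale:
  assumes "\<xi> \<in> C1" "\<eta> \<in> C1"
  shows "B (scale_cfun c \<xi>) \<eta> = B \<xi> (scale_cfun (cnj c) \<eta>)"
  unfolding B_def
  by (rule integral_cong)
     (simp add: assms momentum_scale force_scale Dv_scale inner_vscale, simp add: scale_cfun_def)

lemma B_scale_real:
  assumes "\<xi> \<in> C1" "\<eta> \<in> C1"
  shows "B (scale_cfun (complex_of_real c) \<xi>) \<eta> = c * B \<xi> \<eta>"
proof -
  have "B (scale_cfun (complex_of_real c) \<xi>) \<eta>
      = integral {0..T} (\<lambda>t. c * (momentum \<xi> t \<bullet> Dv \<eta> t + force \<xi> t \<bullet> \<eta> t))"
    unfolding B_def
    by (rule integral_cong)
       (simp add: assms momentum_scale force_scale of_real_vscale algebra_simps)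
  then show ?thesis by (simp add: B_def)
qed

lemma B_0_left: "\<eta> \<in> C1 \<Longrightarrow> B 0 \<eta> = 0"
  using B_scale_real[of "0" \<eta> 0] C1_0 by (simp add: scale_cfun_def zero_fun_def)

lemma B_diff_left:
  assumes "\<xi> \<in> C1" "\<xi>' \<in> C1" "\<eta> \<in> C1"
  shows "B (\<xi> - \<xi>') \<eta> = B \<xi> \<eta> - B \<xi>' \<eta>"
  using B_add_left[of "\<xi> - \<xi>'" \<xi>' \<eta>] assms C1_diff[of \<xi> \<xi>'] by simp

lemma B_diff_right:
  assumes "\<xi> \<in> C1" "\<eta> \<in> C1" "\<eta>' \<in> C1"
  shows "B \<xi> (\<eta> - \<eta>') = B \<xi> \<eta> - B \<xi> \<eta>'"
  using B_diff_left[of \<eta> \<eta>' \<xi>] assms by (simp add: B_sym)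

lemma B_sum_left:
  assumes "\<And>i. i \<in> A \<Longrightarrow> f i \<in> C1" "\<eta> \<in> C1"
  shows "B (\<Sum>i\<in>A. f i) \<eta> = (\<Sum>i\<in>A. B (f i) \<eta>)"
  using assms
proof (induction A rule: infinite_finite_induct)
  case (insert a A)
  have "B (\<Sum>i\<in>insert a A. f i) \<eta> = B (f a + (\<Sum>i\<in>A. f i)) \<eta>"
    by (subst sum.insert[OF insert.hyps]) (rule refl)
  also have "\<dots> = B (f a) \<eta> + B (\<Sum>i\<in>A. f i) \<eta>"
    using insert.prems by (intro B_add_left C1_sum) auto
  also have "\<dots> = (\<Sum>i\<in>insert a A. B (f i) \<eta>)"
    using insert by simp
  finally show ?case .
qed (auto simp: B_0_left)

lemma B_sum_right:
  assumes "\<And>i. i \<in> A \<Longrightarrow> f i \<in> C1" "\<eta> \<in> C1"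
  shows "B \<eta> (\<Sum>i\<in>A. f i) = (\<Sum>i\<in>A. B \<eta> (f i))"
  using B_sum_left[OF assms] by (simp add: B_sym)

text \<open>Stated on a subspace because the form is in general indefinite on \<open>C1\<close>; it
  is applied on the complement of the nonpositive Neumann eigenfunctions.\<close>

lemma B_Cauchy_Schwarz:
  assumes W: "cfun.subspace W" "W \<subseteq> C1" and nonneg: "\<And>\<xi>. \<xi> \<in> W \<Longrightarrow> B \<xi> \<xi> \<ge> 0"
    and "\<xi> \<in> W" "\<eta> \<in> W"
  shows "(B \<xi> \<eta>)\<^sup>2 \<le> B \<xi> \<xi> * B \<eta> \<eta>"
proof (rule quadratic_nonneg_imp)
  fix s :: real
  let ?\<eta> = "scale_cfun (complex_of_real s) \<eta>"
  have m: "\<xi> \<in> C1" "\<eta> \<in> C1" "?\<eta> \<in> C1" "\<xi> + ?\<eta> \<in> C1"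
    using assms by (auto intro!: C1_add C1_scale)
  have "0 \<le> B (\<xi> + ?\<eta>) (\<xi> + ?\<eta>)"
    using assms by (intro nonneg cfun.subspace_add[OF W(1)] cfun.subspace_scale[OF W(1)])
  also have "\<dots> = B \<xi> \<xi> + 2 * B ?\<eta> \<xi> + B ?\<eta> ?\<eta>"
    using m by (simp add: B_add_left B_add_right B_sym[of \<xi> ?\<eta>])
  also have "\<dots> = B \<xi> \<xi> + 2 * s * B \<xi> \<eta> + s\<^sup>2 * B \<eta> \<eta>"
    using m by (simp add: B_scale_real B_sym[of \<eta> ?\<eta>] B_sym[of \<eta> \<xi>] power2_eq_square)
  finally show "0 \<le> \<dots>" .
qed (use assms in auto)

text \<open>The equation in first-order form. With \<open>P\<close> and \<open>Q\<close> only
  continuous, \<xi> may lack a second derivative, whereas its momentum is differentiable.\<close>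

definition solution :: "(real \<Rightarrow> complex^'n) \<Rightarrow> bool"
  where "solution \<xi> \<longleftrightarrow> \<xi> \<in> C1 \<and>
    (\<forall>t\<in>{0..T}. (momentum \<xi> has_vector_derivative force \<xi> t) (at t within {0..T}))"

lemma solution_C1: "solution \<xi> \<Longrightarrow> \<xi> \<in> C1"
  by (simp add: solution_def)

text \<open>Along a solution the integrand of the form is the derivative of
  \<open>momentum \<xi> t \<bullet> \<phi> t\<close>, so only boundary values survive.\<close>

lemma B_solution:
  assumes "solution \<xi>" "\<phi> \<in> C1"
  shows "B \<xi> \<phi> = momentum \<xi> T \<bullet> \<phi> T - momentum \<xi> 0 \<bullet> \<phi> 0"
proof -
  have "((\<lambda>t. momentum \<xi> t \<bullet> Dv \<phi> t + force \<xi> t \<bullet> \<phi> t) has_integral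
      (momentum \<xi> T \<bullet> \<phi> T - momentum \<xi> 0 \<bullet> \<phi> 0)) {0..T}"
  proof (rule fundamental_theorem_of_calculus)
    fix t assume t: "t \<in> {0..T}"
    have "(momentum \<xi> has_vector_derivative force \<xi> t) (at t within {0..T})"
      using assms t by (simp add: solution_def)
    then show "((\<lambda>t. momentum \<xi> t \<bullet> \<phi> t) has_vector_derivative
        (momentum \<xi> t \<bullet> Dv \<phi> t + force \<xi> t \<bullet> \<phi> t)) (at t within {0..T})"
      using bounded_bilinear.has_vector_derivative[OF bounded_bilinear_inner] C1_deriv[OF assms(2) t]
      by blast
  qed (use T_pos in auto)
  then show ?thesis unfolding B_def by (rule integral_unique)
qed

lemma solution_add:
  assumes "solution \<xi>" "solution \<eta>"
  shows "solution (\<xi> + \<eta>)"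
  unfolding solution_def
proof (intro conjI ballI)
  show "\<xi> + \<eta> \<in> C1" using assms by (simp add: solution_def C1_add)
  fix t assume t: "t \<in> {0..T}"
  have "((\<lambda>s. momentum \<xi> s + momentum \<eta> s) has_vector_derivative force \<xi> t + force \<eta> t)
      (at t within {0..T})"
    using assms t by (intro has_vector_derivative_add) (auto simp: solution_def)
  then show "(momentum (\<xi> + \<eta>) has_vector_derivative force (\<xi> + \<eta>) t) (at t within {0..T})"
    using assms t
    by (subst has_vector_derivative_cong_ev[where g = "\<lambda>s. momentum \<xi> s + momentum \<eta> s"])
       (auto simp: momentum_add force_add solution_C1 eventually_nhds
        intro!: always_eventually exI[of _ UNIV])
qed

lemma solution_scale:
  assumes "solution \<xi>"
  shows "solution (scale_cfun c \<xi>)"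
  unfolding solution_def
proof (intro conjI ballI)
  show "scale_cfun c \<xi> \<in> C1" using assms by (simp add: solution_def C1_scale)
  fix t assume t: "t \<in> {0..T}"
  have "((\<lambda>s. c *s momentum \<xi> s) has_vector_derivative c *s force \<xi> t) (at t within {0..T})"
    by (rule bounded_linear.has_vector_derivative[OF bounded_linear_vscale])
       (use assms t in \<open>auto simp: solution_def\<close>)
  then show "(momentum (scale_cfun c \<xi>) has_vector_derivative force (scale_cfun c \<xi>) t)
      (at t within {0..T})"
    using assms t
    by (subst has_vector_derivative_cong_ev[where g = "\<lambda>s. c *s momentum \<xi> s"])
       (auto simp: momentum_scale force_scale solution_C1 eventually_nhds
        intro!: always_eventually exI[of _ UNIV])
qed

end

context interval
begin

text \<open>With P = Q = 0 and R = 1 the index form becomes the L2 product. Positivity of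
  \<open>P\<close> is therefore reserved for a later locale, and \<open>L2\<close> inherits the
  whole algebra of the form.\<close>

lemma L2_coefficients: "coefficients T (\<lambda>_. 0) (\<lambda>_. 0) (\<lambda>_. mat 1 :: real^'n^'n)"
  by unfold_locales (use T_pos in \<open>auto simp: transpose_def mat_def vec_eq_iff\<close>)

lemma L2_eq_B: "L2 = coefficients.B T (\<lambda>_. 0) (\<lambda>_. 0) (\<lambda>_. mat 1 :: real^'n^'n)"
proof -
  interpret L: coefficients T "\<lambda>_. 0" "\<lambda>_. 0" "\<lambda>_. mat 1 :: real^'n^'n"
    by (rule L2_coefficients)
  have "transpose (0 :: real^'n^'n) = 0"
    by (simp add: transpose_def vec_eq_iff)
  then have "L.momentum \<xi> t = 0" "L.force \<xi> t = \<xi> t" for \<xi> t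
    by (simp_all add: L.momentum_def L.force_def)
  then show ?thesis
    by (intro ext) (simp add: L2_def L.B_def)
qed

lemmas L2_sym = coefficients.B_sym[OF L2_coefficients, folded L2_eq_B]
  and L2_add_left = coefficients.B_add_left[OF L2_coefficients, folded L2_eq_B]
  and L2_add_right = coefficients.B_add_right[OF L2_coefficients, folded L2_eq_B]
  and L2_diff_left = coefficients.B_diff_left[OF L2_coefficients, folded L2_eq_B]
  and L2_diff_right = coefficients.B_diff_right[OF L2_coefficients, folded L2_eq_B]
  and L2_scale = coefficients.B_scale[OF L2_coefficients, folded L2_eq_B]
  and L2_scale_real = coefficients.B_scale_real[OF L2_coefficients, folded L2_eq_B]
  and L2_0_left = coefficients.B_0_left[OF L2_coefficients, folded L2_eq_B]
  and L2_sum_left = coefficients.B_sum_left[OF L2_coefficients, folded L2_eq_B]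
  and L2_sum_right = coefficients.B_sum_right[OF L2_coefficients, folded L2_eq_B]

lemma L2_self: "L2 \<xi> \<xi> = integral {0..T} (\<lambda>t. (norm (\<xi> t))\<^sup>2)"
  by (simp add: L2_def power2_norm_eq_inner)

lemma L2_nonneg: "\<xi> \<in> C1 \<Longrightarrow> L2 \<xi> \<xi> \<ge> 0"
  unfolding L2_self
  by (intro integral_nonneg integrable_continuous_real continuous_intros C1_cont) auto

lemma integral_norm_square_eq_0:
  fixes f :: "real \<Rightarrow> complex^'n"
  assumes "continuous_on {0..T} f" "integral {0..T} (\<lambda>t. (norm (f t))\<^sup>2) = 0" "t \<in> {0..T}"
  shows "f t = 0"
proof -
  have "(\<lambda>t. (norm (f t))\<^sup>2) integrable_on {0..T}"
    by (intro integrable_continuous_real continuous_intros assms)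
  then have "((\<lambda>t. (norm (f t))\<^sup>2) has_integral 0) {0..T}"
    using assms(2) by (metis integrable_integral)
  then have "(norm (f t))\<^sup>2 = 0"
    using has_integral_0_cbox_imp_0[of 0 T "\<lambda>t. (norm (f t))\<^sup>2" t] assms T_pos
      continuous_on_power[OF continuous_on_norm[OF assms(1)]]
    by auto
  then show ?thesis by simp
qed

lemma L2_eq_0: "\<xi> \<in> C1 \<Longrightarrow> L2 \<xi> \<xi> = 0 \<Longrightarrow> \<xi> = 0"
proof
  fix t assume *: "\<xi> \<in> C1" "L2 \<xi> \<xi> = 0"
  show "\<xi> t = 0 t"
    using integral_norm_square_eq_0[OF C1_cont[OF *(1)], of t] C1_zero_outside[OF *(1), of t] *(2)
    by (cases "t \<in> {0..T}") (auto simp: L2_self)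
qed

end

section \<open>Dimension counting\<close>

text \<open>Gaussian elimination, by induction on the set of equations. It is phrased with bare
  coefficients \<open>m e f\<close>, so it can be fed with values of functionals on any family of
  vectors.\<close>

lemma homogeneous_system_nontrivial:
  fixes m :: "'e \<Rightarrow> 'f \<Rightarrow> 'a::field"
  assumes "finite E" "finite F" "card E < card F"
  shows "\<exists>a. (\<exists>f\<in>F. a f \<noteq> 0) \<and> (\<forall>e\<in>E. (\<Sum>f\<in>F. a f * m e f) = 0)"
  using assms
proof (induction E arbitrary: F m rule: finite_induct)
  case empty
  then have "F \<noteq> {}" by auto
  then show ?case by (intro exI[of _ "\<lambda>_. 1"]) auto
next
  case (insert e E)
  show ?case
  proof (cases "\<forall>f\<in>F. m e f = 0")
    case True
    from insert have "card E < card F" by simp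
    from insert.IH[OF insert.prems(1) this, of m] obtain a where
      "\<exists>f\<in>F. a f \<noteq> 0" "\<forall>e\<in>E. (\<Sum>f\<in>F. a f * m e f) = 0" by blast
    with True show ?thesis by (intro exI[of _ a]) auto
  next
    case False
    then obtain g where g: "g \<in> F" "m e g \<noteq> 0" by blast
    \<comment> \<open>Equation \<open>e\<close> eliminates the unknown of the pivot \<open>g\<close>
      from the other equations, whose coefficient at \<open>g\<close> becomes 0.\<close>
    define m' where "m' e' f = m e' f - m e' g * m e f / m e g" for e' f
    have "card E < card (F - {g})" using insert g by simp
    from insert.IH[OF _ this, of m'] insert.prems(1) obtain a where
      a: "\<exists>f\<in>F - {g}. a f \<noteq> 0" "\<forall>e\<in>E. (\<Sum>f\<in>F - {g}. a f * m' e f) = 0" by blast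
    \<comment> \<open>Back substitution: the value at \<open>g\<close> is the one that solves
      equation \<open>e\<close>.\<close>
    define b where "b = a(g := - (\<Sum>f\<in>F - {g}. a f * m e f) / m e g)"
    have sum_b: "(\<Sum>f\<in>F. b f * m e' f) = (\<Sum>f\<in>F - {g}. a f * m' e' f)" for e'
    proof -
      have "(\<Sum>f\<in>F. b f * m e' f) = b g * m e' g + (\<Sum>f\<in>F - {g}. b f * m e' f)"
        using insert.prems g by (intro sum.remove) auto
      also have "(\<Sum>f\<in>F - {g}. b f * m e' f) = (\<Sum>f\<in>F - {g}. a f * m e' f)"
        by (intro sum.cong) (auto simp: b_def)
      also have "b g * m e' g = - (\<Sum>f\<in>F - {g}. a f * (m e' g * m e f / m e g))"
        using g by (simp add: b_def sum_distrib_left sum_distrib_right sum_divide_distrib mult_ac)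
      finally show ?thesis
        by (simp add: m'_def right_diff_distrib sum_subtractf)
    qed
    have "(\<Sum>f\<in>F - {g}. a f * m' e f) = 0"
      using g by (simp add: m'_def)
    then have "\<forall>e'\<in>insert e E. (\<Sum>f\<in>F. b f * m e' f) = 0"
      using a(2) unfolding sum_b by auto
    moreover have "\<exists>f\<in>F. b f \<noteq> 0"
      using a(1) by (auto simp: b_def)
    ultimately show ?thesis by blast
  qed
qed

context vector_space
begin

text \<open>Linearity is asked on \<open>W\<close> only, since products given by integrals are
  additive on \<open>C1\<close> but not on all functions. The bounds for nonpositive subspaces rest
  on this lemma.\<close>

lemma exists_common_zero:
  assumes F: "finite F" "independent F" and E: "finite E" "card E < card F"
    and sub: "subspace W" "F \<subseteq> W"
    and add: "\<And>e x y. e \<in> E \<Longrightarrow> x \<in> W \<Longrightarrow> y \<in> W \<Longrightarrow> l e (x + y) = l e x + l e y"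
    and hom: "\<And>e x c. e \<in> E \<Longrightarrow> x \<in> W \<Longrightarrow> l e (scale c x) = c * l e x"
  obtains z where "z \<in> span F" "z \<noteq> 0" "\<And>e. e \<in> E \<Longrightarrow> l e z = 0"
proof -
  obtain a where a: "\<exists>f\<in>F. a f \<noteq> 0" "\<forall>e\<in>E. (\<Sum>f\<in>F. a f * l e f) = 0"
    using homogeneous_system_nontrivial[OF E(1) F(1) E(2), of l] by blast
  define z where "z = (\<Sum>f\<in>F. scale (a f) f)"
  have l_sum: "l e (\<Sum>f\<in>G. scale (a f) f) = (\<Sum>f\<in>G. a f * l e f)" if "G \<subseteq> F" "e \<in> E" for G e
    using finite_subset[OF that(1) F(1)] that
  proof (induction G rule: finite_induct)
    case empty
    \<comment> \<open>\<open>l e 0 = 0\<close> is extracted from homogeneity with the scalar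
      0.\<close>
    have "l e (scale 0 0) = 0 * l e 0" using empty sub by (intro hom) (auto simp: subspace_0)
    then show ?case by simp
  next
    case (insert f G)
    have "(\<Sum>f\<in>G. scale (a f) f) \<in> W"
      using insert sub by (intro subspace_sum subspace_scale) auto
    moreover have "f \<in> W" using insert sub by auto
    ultimately show ?case
      using insert by (simp add: add hom subspace_scale[OF sub(1)])
  qed
  show ?thesis
  proof
    show "z \<in> span F" unfolding z_def by (intro span_sum span_scale span_base)
    show "z \<noteq> 0"
      using a(1) independentD[OF F(2) F(1) order_refl, of a] by (auto simp: z_def)
    show "l e z = 0" if "e \<in> E" for e
      using a(2) that l_sum[OF order_refl that] by (simp add: z_def)
  qed
qed

lemma independent_disjoint_Un:
  assumes A: "independent A" and B: "independent B" and AB: "span A \<inter> span B \<subseteq> {0}"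
  shows "independent (A \<union> B)" "A \<inter> B = {}"
proof -
  have "0 \<notin> A" using A dependent_zero by blast
  then show "A \<inter> B = {}" using AB span_base[of _ A] span_base[of _ B] by blast
  show "independent (A \<union> B)"
    unfolding dependent_explicit
  proof safe
    fix S u v assume S: "finite S" "S \<subseteq> A \<union> B" "v \<in> S" "u v \<noteq> 0" "(\<Sum>v\<in>S. scale (u v) v) = 0"
    have eq: "S = (S \<inter> A) \<union> (S - A)" by blast
    have "(\<Sum>v\<in>S. scale (u v) v) = (\<Sum>v\<in>S \<inter> A. scale (u v) v) + (\<Sum>v\<in>S - A. scale (u v) v)"
      by (subst eq, rule sum.union_disjoint) (use S(1) in auto)
    then have s: "(\<Sum>v\<in>S \<inter> A. scale (u v) v) = - (\<Sum>v\<in>S - A. scale (u v) v)"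
      using S(5) by (simp add: eq_neg_iff_add_eq_0)
    have "(\<Sum>v\<in>S \<inter> A. scale (u v) v) \<in> span A"
      by (intro span_sum span_scale span_base) auto
    moreover have "(\<Sum>v\<in>S \<inter> A. scale (u v) v) \<in> span B"
      unfolding s using S(2) by (intro span_neg span_sum span_scale span_base) auto
    ultimately have z: "(\<Sum>v\<in>S \<inter> A. scale (u v) v) = 0" using AB by blast
    then have z': "(\<Sum>v\<in>S - A. scale (u v) v) = 0" using s by simp
    show False
    proof (cases "v \<in> A")
      case True
      then show False using independentD[OF A _ _ z] S by auto
    next
      case False
      then show False using independentD[OF B _ _ z'] S by auto
    qed
  qed
qed

lemma span_UN_sum:
  assumes "finite M" "x \<in> span (\<Union>i\<in>M. b i)"
  obtains d where "\<And>i. i \<in> M \<Longrightarrow> d i \<in> span (b i)" "x = (\<Sum>i\<in>M. d i)"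
proof -
  have "\<exists>d. (\<forall>i\<in>M. d i \<in> span (b i)) \<and> x = (\<Sum>i\<in>M. d i)"
    using assms
  proof (induction M arbitrary: x rule: finite_induct)
    case empty
    then show ?case by simp
  next
    case (insert i M)
    then obtain y z where yz: "y \<in> span (b i)" "z \<in> span (\<Union>i\<in>M. b i)" "x = y + z"
      by (auto simp: span_Un)
    from insert.IH[OF yz(2)] obtain d where d: "\<forall>i\<in>M. d i \<in> span (b i)" "z = (\<Sum>i\<in>M. d i)" by blast
    have "(\<Sum>j\<in>M. (d(i := y)) j) = (\<Sum>j\<in>M. d j)"
      using insert.hyps by (intro sum.cong) auto
    then show ?case
      using insert.hyps d yz by (intro exI[of _ "d(i := y)"]) auto
  qed
  then show ?thesis using that by blast
qed

lemma independent_UN_direct: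
  assumes "finite M" "\<And>i. i \<in> M \<Longrightarrow> independent (b i)" "\<And>i. i \<in> M \<Longrightarrow> finite (b i)"
    and direct: "\<And>d. (\<And>i. i \<in> M \<Longrightarrow> d i \<in> span (b i)) \<Longrightarrow> (\<Sum>i\<in>M. d i) = 0 \<Longrightarrow> \<forall>i\<in>M. d i = 0"
  shows "independent (\<Union>i\<in>M. b i) \<and> card (\<Union>i\<in>M. b i) = (\<Sum>i\<in>M. card (b i))"
  using assms
proof (induction M rule: finite_induct)
  case empty
  then show ?case by (simp add: independent_empty)
next
  case (insert i M)
  have IH: "independent (\<Union>i\<in>M. b i) \<and> card (\<Union>i\<in>M. b i) = (\<Sum>i\<in>M. card (b i))"
  proof (rule insert.IH)
    fix d assume d: "\<And>i. i \<in> M \<Longrightarrow> d i \<in> span (b i)" "(\<Sum>i\<in>M. d i) = 0"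
    have "(\<Sum>j\<in>M. (d(i := 0)) j) = (\<Sum>j\<in>M. d j)"
      using insert.hyps by (intro sum.cong) auto
    then have "(\<Sum>j\<in>insert i M. (d(i := 0)) j) = 0"
      using insert.hyps d(2) by simp
    then have "\<forall>j\<in>insert i M. (d(i := 0)) j = 0"
      by (intro insert.prems(3)) (use d(1) local.span_zero in auto)
    then show "\<forall>i\<in>M. d i = 0" using insert.hyps by (auto split: if_splits)
  qed (use insert.prems in auto)
  have "span (b i) \<inter> span (\<Union>i\<in>M. b i) \<subseteq> {0}"
  proof
    fix x assume x: "x \<in> span (b i) \<inter> span (\<Union>i\<in>M. b i)"
    then obtain d where d: "\<And>i. i \<in> M \<Longrightarrow> d i \<in> span (b i)" "x = (\<Sum>i\<in>M. d i)"
      using span_UN_sum[OF insert.hyps(1)] by blast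
    \<comment> \<open>A vector \<open>x\<close> in both spans yields a vanishing sum with component
      \<open>- x\<close> at the new index, so directness forces \<open>x = 0\<close>.\<close>
    have "(\<Sum>j\<in>M. (d(i := - x)) j) = (\<Sum>j\<in>M. d j)"
      using insert.hyps by (intro sum.cong) auto
    then have "(\<Sum>j\<in>insert i M. (d(i := - x)) j) = 0"
      using insert.hyps d(2) by simp
    then have "\<forall>j\<in>insert i M. (d(i := - x)) j = 0"
      by (intro insert.prems(3)) (use d(1) x in \<open>auto intro: span_neg\<close>)
    then show "x \<in> {0}" by simp
  qed
  from independent_disjoint_Un[OF _ _ this] insert.prems(1) IH
  have "independent (b i \<union> (\<Union>i\<in>M. b i))" "b i \<inter> (\<Union>i\<in>M. b i) = {}" by auto
  then show ?case
    using IH insert by (simp add: card_Un_disjoint)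
qed

end

section \<open>Coercivity and finiteness of nonpositive subspaces\<close>

locale sturm_liouville = coefficients T P Q R
  for T and P Q R :: "real \<Rightarrow> real^'n^'n" +
  assumes pos_P: "t \<in> {0..T} \<Longrightarrow> pos_def_matrix (P t)"
begin

lemma B_integrand_self:
  "momentum \<xi> t \<bullet> Dv \<xi> t + force \<xi> t \<bullet> \<xi> t
    = cmv (P t) (Dv \<xi> t) \<bullet> Dv \<xi> t + 2 * (cmv (Q t) (\<xi> t) \<bullet> Dv \<xi> t) + cmv (R t) (\<xi> t) \<bullet> \<xi> t"
proof -
  have "cmv (transpose (Q t)) (Dv \<xi> t) \<bullet> \<xi> t = cmv (Q t) (\<xi> t) \<bullet> Dv \<xi> t"
    by (metis cmv_adjoint inner_commute)
  then show ?thesis by (simp add: momentum_def force_def inner_add_left)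
qed

text \<open>Garding's inequality. Half of the lower bound \<open>a\<close> for \<open>P\<close>
  absorbs the mixed term with \<open>Q\<close>, the other half is kept.\<close>

lemma B_coercive:
  obtains \<alpha> b where "\<alpha> > 0" "b \<ge> 0" "\<And>\<xi>. \<xi> \<in> C1 \<Longrightarrow> B \<xi> \<xi> \<ge> \<alpha> * DD \<xi> - b * L2 \<xi> \<xi>"
proof -
  obtain a where a: "a > 0" "\<And>t u. t \<in> {0..T} \<Longrightarrow> cmv (P t) u \<bullet> u \<ge> a * (norm u)\<^sup>2"
    using continuous_pos_def_bound[OF cont_P pos_P] by blast
  obtain q where q: "q > 0" "\<And>t u. t \<in> {0..T} \<Longrightarrow> norm (cmv (Q t) u) \<le> q * norm u"
    using continuous_matrix_bound[OF cont_Q] by blast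
  obtain r where r: "r > 0" "\<And>t u. t \<in> {0..T} \<Longrightarrow> norm (cmv (R t) u) \<le> r * norm u"
    using continuous_matrix_bound[OF cont_R] by blast
  \<comment> \<open>The term \<open>2 * q\<^sup>2 / a\<close> is the price of completing the square
    of the mixed term against half of \<open>a\<close>; \<open>r\<close> accounts for
    \<open>R\<close>.\<close>
  define b where "b = 2 * q\<^sup>2 / a + r"
  have "b \<ge> 0" using a(1) r(1) by (simp add: b_def)
  moreover have "B \<xi> \<xi> \<ge> (a / 2) * DD \<xi> - b * L2 \<xi> \<xi>" if "\<xi> \<in> C1" for \<xi>
  proof -
    have ptw: "(a / 2) * (norm (Dv \<xi> t))\<^sup>2 - b * (norm (\<xi> t))\<^sup>2
        \<le> momentum \<xi> t \<bullet> Dv \<xi> t + force \<xi> t \<bullet> \<xi> t" if t: "t \<in> {0..T}" for t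
    proof -
      let ?g = "Dv \<xi> t" and ?x = "\<xi> t"
      have "\<bar>cmv (Q t) ?x \<bullet> ?g\<bar> \<le> norm (cmv (Q t) ?x) * norm ?g"
        by (rule Cauchy_Schwarz_ineq2)
      also have "\<dots> \<le> (q * norm ?x) * norm ?g"
        by (intro mult_right_mono q t) auto
      finally have 1: "2 * (cmv (Q t) ?x \<bullet> ?g) \<ge> - (2 * q * norm ?x * norm ?g)" by simp
      have "\<bar>cmv (R t) ?x \<bullet> ?x\<bar> \<le> norm (cmv (R t) ?x) * norm ?x"
        by (rule Cauchy_Schwarz_ineq2)
      also have "\<dots> \<le> (r * norm ?x) * norm ?x"
        by (intro mult_right_mono r t) auto
      finally have 2: "cmv (R t) ?x \<bullet> ?x \<ge> - (r * (norm ?x)\<^sup>2)" by (simp add: power2_eq_square)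
      have "0 \<le> (a * norm ?g - 2 * q * norm ?x)\<^sup>2 / (2 * a)" using a(1) by simp
      also have "\<dots> = (a / 2) * (norm ?g)\<^sup>2 - 2 * q * norm ?x * norm ?g + 2 * q\<^sup>2 / a * (norm ?x)\<^sup>2"
        using a(1) by (simp add: power2_eq_square field_simps)
      finally show ?thesis
        unfolding B_integrand_self b_def using 1 2 a(2)[OF t, of ?g] by (simp add: algebra_simps)
    qed
    have i: "(\<lambda>t. (norm (Dv \<xi> t))\<^sup>2) integrable_on {0..T}" "(\<lambda>t. (norm (\<xi> t))\<^sup>2) integrable_on {0..T}"
      by (intro integrable_continuous_real continuous_intros C1_cont_Dv C1_cont that)+
    have "((\<lambda>t. (a / 2) * (norm (Dv \<xi> t))\<^sup>2 - b * (norm (\<xi> t))\<^sup>2) has_integral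
        (a / 2) * DD \<xi> - b * L2 \<xi> \<xi>) {0..T}"
      unfolding DD_def L2_self
      by (intro has_integral_diff has_integral_mult_right integrable_integral i)
    moreover have "((\<lambda>t. momentum \<xi> t \<bullet> Dv \<xi> t + force \<xi> t \<bullet> \<xi> t) has_integral B \<xi> \<xi>) {0..T}"
      unfolding B_def by (intro integrable_integral integrable_continuous_real cont_B_integrand that)
    ultimately show ?thesis
      by (rule has_integral_le) (rule ptw)
  qed
  ultimately show ?thesis using a(1) that[of "a / 2" b] by simp
qed

text \<open>Boundedness of the form in the norm of \<open>W\<^sup>1\<^sup>,\<^sup>2\<close>. It
  controls arbitrary test functions in the minimization argument.\<close>

lemma B_upper:
  obtains C where "C > 0" "\<And>\<xi>. \<xi> \<in> C1 \<Longrightarrow> B \<xi> \<xi> \<le> C * (DD \<xi> + L2 \<xi> \<xi>)"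
proof -
  obtain p where p: "p > 0" "\<And>t u. t \<in> {0..T} \<Longrightarrow> norm (cmv (P t) u) \<le> p * norm u"
    using continuous_matrix_bound[OF cont_P] by blast
  obtain q where q: "q > 0" "\<And>t u. t \<in> {0..T} \<Longrightarrow> norm (cmv (Q t) u) \<le> q * norm u"
    using continuous_matrix_bound[OF cont_Q] by blast
  obtain r where r: "r > 0" "\<And>t u. t \<in> {0..T} \<Longrightarrow> norm (cmv (R t) u) \<le> r * norm u"
    using continuous_matrix_bound[OF cont_R] by blast
  define C where "C = p + q + r"
  have "C > 0" using p q r by (simp add: C_def)
  moreover have "B \<xi> \<xi> \<le> C * (DD \<xi> + L2 \<xi> \<xi>)" if "\<xi> \<in> C1" for \<xi>
  proof -
    have ptw: "momentum \<xi> t \<bullet> Dv \<xi> t + force \<xi> t \<bullet> \<xi> t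
        \<le> C * ((norm (Dv \<xi> t))\<^sup>2 + (norm (\<xi> t))\<^sup>2)" if t: "t \<in> {0..T}" for t
    proof -
      let ?g = "Dv \<xi> t" and ?x = "\<xi> t"
      have "cmv (P t) ?g \<bullet> ?g \<le> (p * norm ?g) * norm ?g"
        by (intro order_trans[OF norm_cauchy_schwarz] mult_right_mono p t) auto
      moreover have "cmv (R t) ?x \<bullet> ?x \<le> (r * norm ?x) * norm ?x"
        by (intro order_trans[OF norm_cauchy_schwarz] mult_right_mono r t) auto
      moreover have "cmv (Q t) ?x \<bullet> ?g \<le> (q * norm ?x) * norm ?g"
        by (intro order_trans[OF norm_cauchy_schwarz] mult_right_mono q t) auto
      moreover have "q * (2 * norm ?x * norm ?g) \<le> q * ((norm ?x)\<^sup>2 + (norm ?g)\<^sup>2)"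
        using q(1) sum_squares_bound[of "norm ?x" "norm ?g"] by (intro mult_left_mono) auto
      moreover have "p * (norm ?x)\<^sup>2 \<ge> 0" "r * (norm ?g)\<^sup>2 \<ge> 0" using p(1) r(1) by auto
      ultimately show ?thesis
        unfolding B_integrand_self C_def by (simp add: algebra_simps power2_eq_square)
    qed
    have i: "(\<lambda>t. (norm (Dv \<xi> t))\<^sup>2) integrable_on {0..T}" "(\<lambda>t. (norm (\<xi> t))\<^sup>2) integrable_on {0..T}"
      by (intro integrable_continuous_real continuous_intros C1_cont_Dv C1_cont that)+
    have I1: "((\<lambda>t. C * ((norm (Dv \<xi> t))\<^sup>2 + (norm (\<xi> t))\<^sup>2)) has_integral
        C * (DD \<xi> + L2 \<xi> \<xi>)) {0..T}"
      unfolding DD_def L2_self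
      by (intro has_integral_add has_integral_mult_right integrable_integral i)
    have I2: "((\<lambda>t. momentum \<xi> t \<bullet> Dv \<xi> t + force \<xi> t \<bullet> \<xi> t) has_integral B \<xi> \<xi>) {0..T}"
      unfolding B_def by (intro integrable_integral integrable_continuous_real cont_B_integrand that)
    show ?thesis
      by (rule has_integral_le[OF I2 I1 ptw])
  qed
  ultimately show ?thesis using that by blast
qed

text \<open>A function vanishing on a fine enough grid has small \<open>L\<^sup>2\<close> norm compared with its derivative,
  so only boundedly many independent functions fit below the zero level of the form.\<close>

lemma nonpositive_card_bound:
  obtains M :: nat where
    "\<And>F. finite F \<Longrightarrow> F \<subseteq> C1 \<Longrightarrow> cfun.independent F \<Longrightarrow>
       (\<And>z. z \<in> cfun.span F \<Longrightarrow> B z z \<le> 0) \<Longrightarrow> card F \<le> M"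
proof -
  obtain \<alpha> b where \<alpha>: "\<alpha> > 0" "b \<ge> 0"
    and lower: "\<And>\<xi>. \<xi> \<in> C1 \<Longrightarrow> B \<xi> \<xi> \<ge> \<alpha> * DD \<xi> - b * L2 \<xi> \<xi>"
    using B_coercive by blast
  \<comment> \<open>For a function vanishing on the grid of mesh \<open>T / N\<close>, this makes
    \<open>b * L2 z z\<close> smaller than the coercive term \<open>\<alpha> * DD z\<close> unless
    the energy is 0.\<close>
  obtain N :: nat where N: "real N > b * T\<^sup>2 / \<alpha>" using reals_Archimedean2 by blast
  moreover have "b * T\<^sup>2 / \<alpha> \<ge> 0" using \<alpha> by simp
  ultimately have N0: "real N > 0" by linarith
  define p where "p i = real i * T / real N" for i
  \<comment> \<open>One functional per coordinate and grid point, both end points included; their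
    number is the bound \<open>M\<close>.\<close>
  define E where "E = {..N} \<times> (UNIV :: 'n set)"
  define l where "l e z = z (p (fst e)) $ snd e" for e :: "nat \<times> 'n" and z :: "real \<Rightarrow> complex^'n"
  have p: "p i \<in> {0..T}" if "i \<le> N" for i
    using that N0 T_pos by (auto simp: p_def field_simps)
  have near: "\<exists>i\<le>N. \<bar>t - p i\<bar> \<le> T / real N" if t: "t \<in> {0..T}" for t
  proof -
    define i where "i = nat \<lfloor>t * real N / T\<rfloor>"
    have nn: "t * real N / T \<ge> 0" using t T_pos N0 by simp
    have "real i \<le> t * real N / T" "t * real N / T < real i + 1"
      using nn by (auto simp: i_def)
    then have i: "real i * T \<le> t * real N" "t * real N < (real i + 1) * T"
      using T_pos by (auto simp: field_simps)
    have "t * real N \<le> T * real N" using t N0 by (intro mult_right_mono) auto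
    then have "real i * T \<le> real N * T" using i(1) by (simp add: mult.commute)
    then have "i \<le> N" using T_pos by simp
    moreover have "\<bar>t - p i\<bar> \<le> T / real N"
    proof -
      have "t - p i = (t * real N - real i * T) / real N"
        using N0 by (simp add: p_def field_simps)
      moreover have "\<bar>t * real N - real i * T\<bar> \<le> T"
        using i by (simp add: algebra_simps abs_le_iff)
      ultimately show ?thesis using N0 by (simp add: divide_right_mono)
    qed
    ultimately show ?thesis by blast
  qed
  have "card F \<le> card E"
    if F: "finite F" "F \<subseteq> C1" "cfun.independent F" "\<And>z. z \<in> cfun.span F \<Longrightarrow> B z z \<le> 0" for F
  proof (rule ccontr)
    assume "\<not> card F \<le> card E"
    then have "card E < card F" by simp
    moreover have "finite E" by (simp add: E_def)
    ultimately obtain z where z: "z \<in> cfun.span F" "z \<noteq> 0" "\<And>e. e \<in> E \<Longrightarrow> l e z = 0"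
      using cfun.exists_common_zero[OF F(1,3) _ _ cfun.subspace_UNIV, of E l]
      by (auto simp: l_def scale_cfun_def)
    have zC: "z \<in> C1" using z(1) F(2) cfun.span_minimal[OF _ subspace_C1] by blast
    have zp: "z (p i) = 0" if "i \<le> N" for i
      using z(3)[of "(i, _)"] that by (simp add: E_def l_def vec_eq_iff)
    have ptw: "(norm (z t))\<^sup>2 \<le> T / real N * DD z" if t: "t \<in> {0..T}" for t
    proof -
      obtain i where i: "i \<le> N" "\<bar>t - p i\<bar> \<le> T / real N" using near[OF t] by blast
      have "(norm (z t))\<^sup>2 \<le> \<bar>t - p i\<bar> * DD z"
        using C1_Hoelder[OF zC p[OF i(1)] t] zp[OF i(1)] by simp
      also have "\<dots> \<le> T / real N * DD z" by (intro mult_right_mono i DD_nonneg zC)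
      finally show ?thesis .
    qed
    have "L2 z z \<le> integral {0..T} (\<lambda>_. T / real N * DD z)"
      unfolding L2_self
      by (intro integral_le ptw integrable_continuous_real continuous_intros C1_cont zC)
    also have "\<dots> = T\<^sup>2 / real N * DD z"
      using T_pos by (simp add: power2_eq_square)
    finally have "b * L2 z z \<le> b * (T\<^sup>2 / real N * DD z)"
      using \<alpha> by (intro mult_left_mono)
    then have "(\<alpha> - b * T\<^sup>2 / real N) * DD z \<le> 0"
      using lower[OF zC] F(4)[OF z(1)] by (simp add: algebra_simps)
    moreover have "\<alpha> - b * T\<^sup>2 / real N > 0"
      using N N0 \<alpha> by (simp add: field_simps)
    ultimately have "DD z = 0"
      using DD_nonneg[OF zC] by (simp add: mult_le_0_iff)
    then have "z t = 0" if "t \<in> {0..T}" for t using ptw[OF that] by simp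
    then have "z = 0" using C1_zero_outside[OF zC] by (auto simp: fun_eq_iff)
    then show False using z(2) by simp
  qed
  then show ?thesis using that by blast
qed

end

section \<open>Regularity of eigenfunctions\<close>

lemma AE_lebesgue_on_Icc:
  "(AE t in lebesgue_on {a..b::real}. p t) \<longleftrightarrow> (AE t in lborel. t \<in> {a..b} \<longrightarrow> p t)"
proof -
  have "(AE t in lebesgue_on {a..b}. p t) \<longleftrightarrow> (AE t in lebesgue. t \<in> {a..b} \<longrightarrow> p t)"
    by (rule AE_restrict_space_iff) simp
  then show ?thesis by (simp only: AE_completion_iff)
qed

context interval
begin

lemma W12_continuous:
  assumes "W12 T f g"
  shows "continuous_on {0..T} f"
proof -
  have g: "t \<in> {0..T} \<Longrightarrow> (g has_integral (f t - f 0)) {0..t}" for t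
    using assms by (simp add: W12_def)
  have "g integrable_on {0..T}" using g[of T] T_pos by auto
  then have "continuous_on {0..T} (\<lambda>t. f 0 + integral {0..t} g)"
    by (intro continuous_intros indefinite_integral_continuous_1)
  moreover have "f 0 + integral {0..t} g = f t" if "t \<in> {0..T}" for t
    using integral_unique[OF g[OF that]] by simp
  ultimately show ?thesis
    using continuous_on_cong[of "{0..T}" "{0..T}" "\<lambda>t. f 0 + integral {0..t} g" f] by simp
qed

text \<open>Altering the weak derivative on a null set leaves all integrals unchanged, so the
  absolutely continuous representative is a classical primitive of the continuous function
  \<open>g'\<close>.\<close>

lemma W12_has_derivative:
  assumes "W12 T f g" "AE t in lebesgue_on {0..T}. g t = g' t" "continuous_on {0..T} g'"
    and "t \<in> {0..T}"
  shows "(f has_vector_derivative g' t) (at t within {0..T})"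
proof -
  have ae: "AE t in lborel. t \<in> {0..T} \<longrightarrow> g t = g' t"
    using assms(2) by (simp only: AE_lebesgue_on_Icc)
  have g: "(g' has_integral (f t - f 0)) {0..t}" if "t \<in> {0..T}" for t
  proof -
    have "AE s in lborel. s \<in> {0..t} \<longrightarrow> g s = g' s"
      using ae by (rule eventually_mono) (use that in auto)
    then have "(g has_integral (f t - f 0)) {0..t} = (g' has_integral (f t - f 0)) {0..t}"
      by (rule has_integral_AE)
    then show ?thesis using assms(1) that by (simp add: W12_def)
  qed
  have "((\<lambda>s. f 0 + integral {0..s} g') has_vector_derivative 0 + g' t) (at t within {0..T})"
    by (intro has_vector_derivative_add has_vector_derivative_const
        integral_has_vector_derivative[OF assms(3,4)])
  moreover have "f 0 + integral {0..s} g' = f s" if "s \<in> {0..T}" for s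
    using integral_unique[OF g[OF that]] by simp
  ultimately show ?thesis
    using has_vector_derivative_transform[OF assms(4), of f "\<lambda>s. f 0 + integral {0..s} g'"]
    by simp
qed

lemma L2_on_continuous:
  fixes f :: "real \<Rightarrow> complex^'n"
  assumes "continuous_on {0..T} f"
  shows "L2_on T f"
  unfolding L2_on_def
proof
  show "f \<in> borel_measurable (lebesgue_on {0..T})"
    by (intro continuous_imp_measurable_on_sets_lebesgue assms) auto
  have "(\<lambda>t. (norm (f t))\<^sup>2) absolutely_integrable_on {0..T}"
    by (intro absolutely_integrable_continuous_real continuous_intros assms)
  then show "integrable (lebesgue_on {0..T}) (\<lambda>t. (norm (f t))\<^sup>2)"
    by (simp add: set_integrable_def integrable_restrict_space)
qed

lemma W12_C1:
  fixes f :: "real \<Rightarrow> complex^'n"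
  assumes "\<And>t. t \<in> {0..T} \<Longrightarrow> (f has_vector_derivative g t) (at t within {0..T})"
    and "continuous_on {0..T} g"
  shows "W12 T f g"
  unfolding W12_def
proof (intro conjI ballI L2_on_continuous assms(2))
  fix t assume t: "t \<in> {0..T}"
  show "(g has_integral (f t - f 0)) {0..t}"
  proof (rule fundamental_theorem_of_calculus)
    fix s assume "s \<in> {0..t}"
    then show "(f has_vector_derivative g s) (at s within {0..t})"
      using t by (intro has_vector_derivative_within_subset[OF assms(1)]) auto
  qed (use t in auto)
qed

end

context sturm_liouville
begin

text \<open>Moving \<mu> into \<open>R\<close> turns the eigenvalue equation into the homogeneous
  one. Green's formula and linearity for eigenfunctions, and later the whole limit argument, are
  obtained by applying results about solutions to the shifted coefficients.\<close>

lemma shifted: "coefficients T P Q (\<lambda>t. R t - mat \<mu>)"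
proof
  show "continuous_on {0..T} (\<lambda>t. R t - mat \<mu>)"
    by (intro continuous_intros cont_R)
qed (use T_pos cont_P cont_Q sym_P sym_R in \<open>auto simp: transpose_minus_mat transpose_mat\<close>)

definition eigen :: "real \<Rightarrow> (real \<Rightarrow> complex^'n) \<Rightarrow> bool"
  where "eigen \<mu> = coefficients.solution T P Q (\<lambda>t. R t - mat \<mu>)"

lemma shifted_force: "coefficients.force T Q (\<lambda>t. R t - mat \<mu>) \<xi> t = force \<xi> t - \<mu> *\<^sub>R \<xi> t"
proof -
  interpret S: coefficients T P Q "\<lambda>t. R t - mat \<mu>" by (rule shifted)
  show ?thesis
    by (simp add: S.force_def force_def cmv_diff_left cmv_mat of_real_vscale)
qed

lemma shifted_B:
  assumes "\<xi> \<in> C1" "\<eta> \<in> C1"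
  shows "coefficients.B T P Q (\<lambda>t. R t - mat \<mu>) \<xi> \<eta> = B \<xi> \<eta> - \<mu> * L2 \<xi> \<eta>"
proof -
  interpret S: coefficients T P Q "\<lambda>t. R t - mat \<mu>" by (rule shifted)
  have "((\<lambda>t. (momentum \<xi> t \<bullet> Dv \<eta> t + force \<xi> t \<bullet> \<eta> t) - \<mu> * (\<xi> t \<bullet> \<eta> t)) has_integral
      B \<xi> \<eta> - \<mu> * L2 \<xi> \<eta>) {0..T}"
    unfolding B_def L2_def
    by (intro has_integral_diff has_integral_mult_right integrable_integral
        integrable_continuous_real cont_B_integrand continuous_intros C1_cont assms)
  then show ?thesis
    unfolding S.B_def shifted_force
    by (intro integral_unique) (simp add: inner_diff_left algebra_simps)
qed

lemma eigen_iff: "eigen \<mu> \<xi> \<longleftrightarrow> \<xi> \<in> C1 \<and>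
    (\<forall>t\<in>{0..T}. (momentum \<xi> has_vector_derivative (force \<xi> t - \<mu> *\<^sub>R \<xi> t)) (at t within {0..T}))"
  unfolding eigen_def coefficients.solution_def[OF shifted] shifted_force by (rule refl)

lemma eigen_C1: "eigen \<mu> \<xi> \<Longrightarrow> \<xi> \<in> C1"
  by (simp add: eigen_iff)

lemma eigen_0: "eigen 0 = solution"
  by (simp add: fun_eq_iff eigen_iff solution_def)

lemma eigen_Green:
  assumes "eigen \<mu> \<xi>" "\<phi> \<in> C1"
  shows "B \<xi> \<phi> = \<mu> * L2 \<xi> \<phi> + momentum \<xi> T \<bullet> \<phi> T - momentum \<xi> 0 \<bullet> \<phi> 0"
  using coefficients.B_solution[OF shifted assms(1)[unfolded eigen_def] assms(2)]
    shifted_B[OF eigen_C1[OF assms(1)] assms(2)] by simp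

text \<open>Serves where derivative and momentum are given by formulas of their own: for weak
  eigenfunctions, for limits and for orbits of the flow.\<close>

lemma eigenI:
  assumes supp: "\<And>t. t \<notin> {0..T} \<Longrightarrow> \<xi> t = 0"
    and \<xi>: "\<And>t. t \<in> {0..T} \<Longrightarrow> (\<xi> has_vector_derivative g t) (at t within {0..T})"
    and g: "continuous_on {0..T} g"
    and y: "\<And>t. t \<in> {0..T} \<Longrightarrow> y t = cmv (P t) (g t) + cmv (Q t) (\<xi> t)"
    and y': "\<And>t. t \<in> {0..T} \<Longrightarrow>
      (y has_vector_derivative (cmv (transpose (Q t)) (g t) + cmv (R t) (\<xi> t) - \<mu> *\<^sub>R \<xi> t)) (at t within {0..T})"
  shows "eigen \<mu> \<xi> \<and> (\<forall>t\<in>{0..T}. momentum \<xi> t = y t)"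
proof -
  have C: "\<xi> \<in> C1" using C1_I[OF supp \<xi> g] .
  have D: "Dv \<xi> t = g t" if "t \<in> {0..T}" for t using Dv_eq[OF that \<xi>[OF that]] .
  have m: "momentum \<xi> t = y t" if "t \<in> {0..T}" for t
    using that by (simp add: momentum_def D y)
  have "eigen \<mu> \<xi>"
    unfolding eigen_iff
  proof (intro conjI ballI C)
    fix t assume t: "t \<in> {0..T}"
    show "(momentum \<xi> has_vector_derivative (force \<xi> t - \<mu> *\<^sub>R \<xi> t)) (at t within {0..T})"
      by (rule has_vector_derivative_transform[OF t m])
         (use y'[OF t] D[OF t] in \<open>auto simp: force_def\<close>)
  qed
  with m show ?thesis by blast
qed

text \<open>A boundary condition is an arbitrary predicate. These two are linear and read the
  momentum only at the ends, which is what the eigenspace arguments rely on.\<close>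

definition boundary :: "('n boundary_condition) \<Rightarrow> bool" where
  "boundary \<Lambda> \<longleftrightarrow> \<Lambda> = Dirichlet \<or> \<Lambda> = Neumann"

lemma boundary_cong:
  "boundary \<Lambda> \<Longrightarrow> y 0 = y' 0 \<Longrightarrow> y T = y' T \<Longrightarrow> \<Lambda> T \<xi> y \<longleftrightarrow> \<Lambda> T \<xi> y'"
  by (auto simp: boundary_def Dirichlet_def Neumann_def)

text \<open>A regularity bootstrap: \<xi> and the momentum are continuous, hence so is the
  derivative recovered by inverting \<open>P\<close>, hence also the derivative of the momentum.
  Weak eigenfunctions are thus classical.\<close>

lemma sturm_eigenspace_iff:
  assumes "boundary \<Lambda>"
  shows "\<xi> \<in> sturm_eigenspace P Q R T \<Lambda> \<mu> \<longleftrightarrow> eigen \<mu> \<xi> \<and> \<Lambda> T \<xi> (momentum \<xi>)"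
proof
  assume "\<xi> \<in> sturm_eigenspace P Q R T \<Lambda> \<mu>"
  then obtain g y h where supp: "\<And>t. t \<notin> {0..T} \<Longrightarrow> \<xi> t = 0"
    and \<xi>: "W12 T \<xi> g" and y: "W12 T y h"
    and ae1: "AE t in lebesgue_on {0..T}. y t = cmv (P t) (g t) + cmv (Q t) (\<xi> t)"
    and bd: "\<Lambda> T \<xi> y"
    and ae2: "AE t in lebesgue_on {0..T}. complex_of_real \<mu> *s \<xi> t
        = - h t + cmv (transpose (Q t)) (g t) + cmv (R t) (\<xi> t)"
    unfolding sturm_eigenspace_def sturm_graph_def cmv_def by blast
  define g' where "g' t = cmv (matrix_inv (P t)) (y t - cmv (Q t) (\<xi> t))" for t
  have c\<xi>: "continuous_on {0..T} \<xi>" and cy: "continuous_on {0..T} y"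
    using W12_continuous \<xi> y by blast+
  have inv1: "cmv (P t) (g' t) = y t - cmv (Q t) (\<xi> t)" if "t \<in> {0..T}" for t
    using pos_def_invertible(1)[OF pos_P[OF that]] by (simp add: g'_def flip: cmv_mult)
  have cg: "continuous_on {0..T} g'"
    by (rule continuous_on_matrix_solve[OF cont_P pos_P _ inv1])
       (auto intro!: continuous_intros cont_coeffs c\<xi> cy)
  have aeg: "AE t in lebesgue_on {0..T}. g t = g' t"
    unfolding AE_lebesgue_on_Icc
  proof (rule eventually_mono[OF ae1[unfolded AE_lebesgue_on_Icc]], intro impI)
    fix t assume t: "t \<in> {0..T}"
      and "t \<in> {0..T} \<longrightarrow> y t = cmv (P t) (g t) + cmv (Q t) (\<xi> t)"
    then have "y t - cmv (Q t) (\<xi> t) = cmv (P t) (g t)" by simp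
    then show "g t = g' t"
      using pos_def_invertible(2)[OF pos_P[OF t]] by (simp add: g'_def flip: cmv_mult)
  qed
  define h' where "h' t = cmv (transpose (Q t)) (g' t) + cmv (R t) (\<xi> t) - \<mu> *\<^sub>R \<xi> t" for t
  have ch: "continuous_on {0..T} h'"
    unfolding h'_def by (intro continuous_intros cont_coeffs cg c\<xi>)
  have aeh: "AE t in lebesgue_on {0..T}. h t = h' t"
    using aeg ae2
  proof eventually_elim
    case (elim t)
    then show "h t = h' t" by (simp add: h'_def of_real_vscale algebra_simps)
  qed
  have e: "eigen \<mu> \<xi> \<and> (\<forall>t\<in>{0..T}. momentum \<xi> t = y t)"
  proof (rule eigenI)
    show "(\<xi> has_vector_derivative g' t) (at t within {0..T})" if "t \<in> {0..T}" for t
      by (rule W12_has_derivative[OF \<xi> aeg cg that])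
    show "y t = cmv (P t) (g' t) + cmv (Q t) (\<xi> t)" if "t \<in> {0..T}" for t
      using inv1[OF that] by simp
    show "(y has_vector_derivative (cmv (transpose (Q t)) (g' t) + cmv (R t) (\<xi> t) - \<mu> *\<^sub>R \<xi> t))
        (at t within {0..T})" if "t \<in> {0..T}" for t
      using W12_has_derivative[OF y aeh ch that] by (simp add: h'_def)
  qed (use supp cg in auto)
  moreover have "\<Lambda> T \<xi> (momentum \<xi>) \<longleftrightarrow> \<Lambda> T \<xi> y"
    using e T_pos by (intro boundary_cong[OF assms]) auto
  ultimately show "eigen \<mu> \<xi> \<and> \<Lambda> T \<xi> (momentum \<xi>)" using bd by blast
next
  assume *: "eigen \<mu> \<xi> \<and> \<Lambda> T \<xi> (momentum \<xi>)"
  then have C: "\<xi> \<in> C1" using eigen_C1 by blast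
  let ?h = "\<lambda>t. force \<xi> t - \<mu> *\<^sub>R \<xi> t"
  have "W12 T \<xi> (Dv \<xi>)" by (intro W12_C1 C1_deriv C1_cont_Dv C)
  moreover have "W12 T (momentum \<xi>) ?h"
    using * by (intro W12_C1 continuous_intros cont_force C1_cont C) (auto simp: eigen_iff)
  moreover have "momentum \<xi> t = cmatrix (P t) *v Dv \<xi> t + cmatrix (Q t) *v \<xi> t" for t
    by (simp add: momentum_def cmv_def)
  moreover have "complex_of_real \<mu> *s \<xi> t
      = - ?h t + cmatrix (transpose (Q t)) *v Dv \<xi> t + cmatrix (R t) *v \<xi> t" for t
    by (simp add: force_def cmv_def of_real_vscale)
  ultimately have "sturm_graph P Q R T \<Lambda> \<xi> (\<lambda>t. complex_of_real \<mu> *s \<xi> t)"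
    unfolding sturm_graph_def using * by (intro exI conjI AE_I2) blast+
  then show "\<xi> \<in> sturm_eigenspace P Q R T \<Lambda> \<mu>"
    using C1_zero_outside[OF C] by (auto simp: sturm_eigenspace_def)
qed

abbreviation E :: "'n boundary_condition \<Rightarrow> real \<Rightarrow> (real \<Rightarrow> complex^'n) set"
  where "E \<equiv> sturm_eigenspace P Q R T"

lemma E_C1: "boundary \<Lambda> \<Longrightarrow> \<xi> \<in> E \<Lambda> \<mu> \<Longrightarrow> \<xi> \<in> C1"
  using sturm_eigenspace_iff eigen_C1 by blast

lemma eigen_add: "eigen \<mu> \<xi> \<Longrightarrow> eigen \<mu> \<eta> \<Longrightarrow> eigen \<mu> (\<xi> + \<eta>)"
  unfolding eigen_def by (rule coefficients.solution_add[OF shifted])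

lemma eigen_scale: "eigen \<mu> \<xi> \<Longrightarrow> eigen \<mu> (scale_cfun c \<xi>)"
  unfolding eigen_def by (rule coefficients.solution_scale[OF shifted])

lemma zero_momentum: "t \<in> {0..T} \<Longrightarrow> momentum 0 t = 0"
  and zero_force: "t \<in> {0..T} \<Longrightarrow> force 0 t = 0"
  using momentum_scale[OF C1_0, of t 0] force_scale[OF C1_0, of t 0]
  by (simp_all only: cfun.scale_zero_left vec.scale_zero_left)

lemma eigen_zero: "eigen \<mu> 0"
proof -
  have "(momentum 0 has_vector_derivative force 0 t - \<mu> *\<^sub>R 0 t) (at t within {0..T})"
    if t: "t \<in> {0..T}" for t
  proof (rule has_vector_derivative_transform[OF t zero_momentum])
    show "((\<lambda>_. 0) has_vector_derivative force 0 t - \<mu> *\<^sub>R 0 t) (at t within {0..T})"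
      using zero_force[OF t] by simp
  qed
  then show ?thesis
    unfolding eigen_iff using C1_0 by blast
qed

lemma subspace_E:
  assumes "boundary \<Lambda>"
  shows "cfun.subspace (E \<Lambda> \<mu>)"
proof (rule cfun.subspaceI)
  have T0: "0 \<in> {0..T}" "T \<in> {0..T}" using T_pos by auto
  note zero_momentum[OF T0(1)] zero_momentum[OF T0(2)]
  then have "\<Lambda> T 0 (momentum 0)"
    using assms[unfolded boundary_def] by (elim disjE) (simp_all add: Dirichlet_def Neumann_def)
  then show "0 \<in> E \<Lambda> \<mu>"
    unfolding sturm_eigenspace_iff[OF assms] using eigen_zero by blast
  show "\<xi> + \<eta> \<in> E \<Lambda> \<mu>" if "\<xi> \<in> E \<Lambda> \<mu>" "\<eta> \<in> E \<Lambda> \<mu>" for \<xi> \<eta>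
  proof -
    have e: "eigen \<mu> \<xi>" "eigen \<mu> \<eta>" and b: "\<Lambda> T \<xi> (momentum \<xi>)" "\<Lambda> T \<eta> (momentum \<eta>)"
      using that unfolding sturm_eigenspace_iff[OF assms] by blast+
    have "\<Lambda> T (\<xi> + \<eta>) (momentum (\<xi> + \<eta>))"
      using assms[unfolded boundary_def] b momentum_add[OF e[THEN eigen_C1] T0(1)]
        momentum_add[OF e[THEN eigen_C1] T0(2)]
      by (elim disjE) (simp_all add: Dirichlet_def Neumann_def)
    then show ?thesis
      unfolding sturm_eigenspace_iff[OF assms] using eigen_add[OF e] by blast
  qed
  show "scale_cfun c \<xi> \<in> E \<Lambda> \<mu>" if "\<xi> \<in> E \<Lambda> \<mu>" for c \<xi>
  proof -
    have e: "eigen \<mu> \<xi>" and b: "\<Lambda> T \<xi> (momentum \<xi>)"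
      using that unfolding sturm_eigenspace_iff[OF assms] by blast+
    have "\<Lambda> T (scale_cfun c \<xi>) (momentum (scale_cfun c \<xi>))"
      using assms[unfolded boundary_def] b momentum_scale[OF eigen_C1[OF e] T0(1)]
        momentum_scale[OF eigen_C1[OF e] T0(2)]
      by (elim disjE) (simp_all add: Dirichlet_def Neumann_def scale_cfun_apply)
    then show ?thesis
      unfolding sturm_eigenspace_iff[OF assms] using eigen_scale[OF e] by blast
  qed
qed

text \<open>In each boundary term one factor vanishes: the momentum under the Neumann condition, the
  test function otherwise. Neumann eigenfunctions may thus be tested with all of
  \<open>C1\<close>.\<close>

lemma B_E:
  assumes "boundary \<Lambda>" "\<xi> \<in> E \<Lambda> \<mu>" "\<phi> \<in> C1" "\<Lambda> = Neumann \<or> \<phi> 0 = 0 \<and> \<phi> T = 0"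
  shows "B \<xi> \<phi> = \<mu> * L2 \<xi> \<phi>"
proof -
  have e: "eigen \<mu> \<xi>" and b: "\<Lambda> T \<xi> (momentum \<xi>)"
    using assms(2) unfolding sturm_eigenspace_iff[OF assms(1)] by blast+
  have "momentum \<xi> T \<bullet> \<phi> T = 0" "momentum \<xi> 0 \<bullet> \<phi> 0 = 0"
    using b assms(4) unfolding Neumann_def by auto
  then show ?thesis using eigen_Green[OF e assms(3)] by simp
qed

lemma B_E_E:
  assumes "boundary \<Lambda>" "\<xi> \<in> E \<Lambda> \<mu>" "\<eta> \<in> E \<Lambda> \<nu>"
  shows "B \<xi> \<eta> = \<mu> * L2 \<xi> \<eta>"
proof (rule B_E[OF assms(1,2)])
  show "\<eta> \<in> C1" using E_C1 assms by blast
  show "\<Lambda> = Neumann \<or> \<eta> 0 = 0 \<and> \<eta> T = 0"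
    using assms by (auto simp: sturm_eigenspace_iff boundary_def Dirichlet_def)
qed

lemma E_orthogonal:
  assumes "boundary \<Lambda>" "\<xi> \<in> E \<Lambda> \<mu>" "\<eta> \<in> E \<Lambda> \<nu>" "\<mu> \<noteq> \<nu>"
  shows "L2 \<xi> \<eta> = 0"
proof -
  have "\<mu> * L2 \<xi> \<eta> = \<nu> * L2 \<xi> \<eta>"
    using B_E_E[OF assms(1-3)] B_E_E[OF assms(1,3,2)] B_sym[of \<xi> \<eta>] L2_sym[of \<xi> \<eta>]
    by metis
  then show ?thesis using assms(4) by (metis mult_cancel_right)
qed

text \<open>Distinct eigenspaces are orthogonal both for \<open>L2\<close> and for the form, so all
  cross terms drop out.\<close>

lemma E_sum:
  assumes "boundary \<Lambda>" "finite M" "\<And>\<mu>. \<mu> \<in> M \<Longrightarrow> d \<mu> \<in> E \<Lambda> \<mu>"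
  shows "L2 (\<Sum>\<mu>\<in>M. d \<mu>) (\<Sum>\<mu>\<in>M. d \<mu>) = (\<Sum>\<mu>\<in>M. L2 (d \<mu>) (d \<mu>))"
    and "B (\<Sum>\<mu>\<in>M. d \<mu>) (\<Sum>\<mu>\<in>M. d \<mu>) = (\<Sum>\<mu>\<in>M. \<mu> * L2 (d \<mu>) (d \<mu>))"
proof -
  have C: "d \<mu> \<in> C1" if "\<mu> \<in> M" for \<mu> using assms that E_C1 by blast
  have S: "(\<Sum>\<mu>\<in>M. d \<mu>) \<in> C1" using C by (intro C1_sum)
  have *: "L2 (d \<mu>) (\<Sum>\<mu>\<in>M. d \<mu>) = L2 (d \<mu>) (d \<mu>)" if "\<mu> \<in> M" for \<mu>
  proof -
    have "L2 (d \<mu>) (\<Sum>\<mu>\<in>M. d \<mu>) = (\<Sum>\<nu>\<in>M. L2 (d \<mu>) (d \<nu>))"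
      using C that by (intro L2_sum_right)
    also have "\<dots> = (\<Sum>\<nu>\<in>M. if \<nu> = \<mu> then L2 (d \<mu>) (d \<mu>) else 0)"
      using E_orthogonal[OF assms(1,3,3)] that by (intro sum.cong) auto
    finally show ?thesis using that assms(2) by simp
  qed
  have "B (d \<mu>) (\<Sum>\<mu>\<in>M. d \<mu>) = \<mu> * L2 (d \<mu>) (\<Sum>\<mu>\<in>M. d \<mu>)" if "\<mu> \<in> M" for \<mu>
  proof -
    have "B (d \<mu>) (\<Sum>\<nu>\<in>M. d \<nu>) = (\<Sum>\<nu>\<in>M. B (d \<mu>) (d \<nu>))"
      using C that by (intro B_sum_right)
    also have "\<dots> = (\<Sum>\<nu>\<in>M. \<mu> * L2 (d \<mu>) (d \<nu>))"
      using assms that by (intro sum.cong B_E_E[OF assms(1)]) auto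
    also have "\<dots> = \<mu> * L2 (d \<mu>) (\<Sum>\<nu>\<in>M. d \<nu>)"
      using C that by (simp add: L2_sum_right sum_distrib_left)
    finally show ?thesis .
  qed
  then have "(\<Sum>\<mu>\<in>M. B (d \<mu>) (\<Sum>\<mu>\<in>M. d \<mu>)) = (\<Sum>\<mu>\<in>M. \<mu> * L2 (d \<mu>) (d \<mu>))"
    using * by (intro sum.cong) auto
  then show "B (\<Sum>\<mu>\<in>M. d \<mu>) (\<Sum>\<mu>\<in>M. d \<mu>) = (\<Sum>\<mu>\<in>M. \<mu> * L2 (d \<mu>) (d \<mu>))"
    using B_sum_left[of M d, OF C S] by simp
  have "(\<Sum>\<mu>\<in>M. L2 (d \<mu>) (\<Sum>\<mu>\<in>M. d \<mu>)) = (\<Sum>\<mu>\<in>M. L2 (d \<mu>) (d \<mu>))"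
    using * by (intro sum.cong) auto
  then show "L2 (\<Sum>\<mu>\<in>M. d \<mu>) (\<Sum>\<mu>\<in>M. d \<mu>) = (\<Sum>\<mu>\<in>M. L2 (d \<mu>) (d \<mu>))"
    using L2_sum_left[of M d, OF C S] by simp
qed

lemma E_sum_eq_0:
  assumes "boundary \<Lambda>" "finite M" "\<And>\<mu>. \<mu> \<in> M \<Longrightarrow> d \<mu> \<in> E \<Lambda> \<mu>"
    and "(\<Sum>\<mu>\<in>M. d \<mu>) = 0" "\<mu> \<in> M"
  shows "d \<mu> = 0"
proof -
  have C: "d \<mu> \<in> C1" if "\<mu> \<in> M" for \<mu> using assms that E_C1 by blast
  have "(\<Sum>\<mu>\<in>M. L2 (d \<mu>) (d \<mu>)) = 0"
    using E_sum(1)[of \<Lambda> M d, OF assms(1-3)] L2_0_left[OF C1_0] unfolding assms(4) by metis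
  moreover have "L2 (d \<nu>) (d \<nu>) \<ge> 0" if "\<nu> \<in> M" for \<nu>
    by (intro L2_nonneg C that)
  ultimately have "L2 (d \<mu>) (d \<mu>) = 0"
    using sum_nonneg_0[OF assms(2), of "\<lambda>\<mu>. L2 (d \<mu>) (d \<mu>)"] assms(5) by blast
  then show ?thesis using L2_eq_0 C assms(5) by blast
qed

end

section \<open>Limits of almost solutions\<close>

context interval
begin

text \<open>Produces test functions with prescribed derivative and initial value; the cut-off
  outside [0,T] puts them into \<open>C1\<close>.\<close>

definition prim :: "complex^'n \<Rightarrow> (real \<Rightarrow> complex^'n) \<Rightarrow> real \<Rightarrow> complex^'n"
  where "prim c g t = (if t \<in> {0..T} then c + integral {0..t} g else 0)"

lemma prim_has_derivative:
  assumes "continuous_on {0..T} g" "t \<in> {0..T}"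
  shows "(prim c g has_vector_derivative g t) (at t within {0..T})"
proof -
  have "((\<lambda>s. c + integral {0..s} g) has_vector_derivative 0 + g t) (at t within {0..T})"
    by (intro has_vector_derivative_add has_vector_derivative_const
        integral_has_vector_derivative[OF assms])
  then show ?thesis
    by (intro has_vector_derivative_transform[OF assms(2), of "prim c g" "\<lambda>s. c + integral {0..s} g"])
       (auto simp: prim_def)
qed

lemma prim_C1: "continuous_on {0..T} g \<Longrightarrow> prim c g \<in> C1"
  by (rule C1_I[OF _ prim_has_derivative]) (auto simp: prim_def)

lemma Dv_prim: "continuous_on {0..T} g \<Longrightarrow> t \<in> {0..T} \<Longrightarrow> Dv (prim c g) t = g t"
  by (intro Dv_eq prim_has_derivative)

lemma prim_0: "prim c g 0 = c"
  using T_pos by (simp add: prim_def)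

text \<open>The comparison of \<open>\<xi> t\<close> with \<open>\<xi> s\<close> is squared and
  averaged over \<open>s\<close>, which replaces the zero of \<xi> that a Poincare estimate would
  start from.\<close>

lemma C1_bound:
  assumes "\<xi> \<in> C1" "t \<in> {0..T}"
  shows "(norm (\<xi> t))\<^sup>2 \<le> 2 / T * L2 \<xi> \<xi> + 2 * T * DD \<xi>"
proof -
  have ptw: "(norm (\<xi> t))\<^sup>2 \<le> 2 * (norm (\<xi> s))\<^sup>2 + 2 * T * DD \<xi>" if s: "s \<in> {0..T}" for s
  proof -
    have "norm (\<xi> t) \<le> norm (\<xi> s) + norm (\<xi> t - \<xi> s)"
      using norm_triangle_ineq[of "\<xi> s" "\<xi> t - \<xi> s"] by simp
    then have "(norm (\<xi> t))\<^sup>2 \<le> (norm (\<xi> s) + norm (\<xi> t - \<xi> s))\<^sup>2"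
      by (intro power_mono) auto
    also have "\<dots> \<le> 2 * (norm (\<xi> s))\<^sup>2 + 2 * (norm (\<xi> t - \<xi> s))\<^sup>2"
      using sum_squares_bound[of "norm (\<xi> s)" "norm (\<xi> t - \<xi> s)"]
      by (simp add: power2_sum)
    also have "(norm (\<xi> t - \<xi> s))\<^sup>2 \<le> \<bar>t - s\<bar> * DD \<xi>"
      by (rule C1_Hoelder[OF assms(1) s assms(2)])
    also have "\<bar>t - s\<bar> * DD \<xi> \<le> T * DD \<xi>"
      using s assms by (intro mult_right_mono DD_nonneg) auto
    finally show ?thesis by simp
  qed
  have i: "(\<lambda>s. (norm (\<xi> s))\<^sup>2) integrable_on {0..T}"
    by (intro integrable_continuous_real continuous_intros C1_cont assms)
  have I1: "((\<lambda>_. (norm (\<xi> t))\<^sup>2) has_integral (T * (norm (\<xi> t))\<^sup>2)) {0..T}"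
    using has_integral_const_real[of "(norm (\<xi> t))\<^sup>2" 0 T] T_pos by simp
  have I2: "((\<lambda>s. 2 * (norm (\<xi> s))\<^sup>2 + 2 * T * DD \<xi>) has_integral
      (2 * L2 \<xi> \<xi> + T * (2 * T * DD \<xi>))) {0..T}"
    using has_integral_const_real[of "2 * T * DD \<xi>" 0 T] T_pos unfolding L2_self
    by (intro has_integral_add has_integral_mult_right integrable_integral i) simp_all
  have "T * (norm (\<xi> t))\<^sup>2 \<le> 2 * L2 \<xi> \<xi> + T * (2 * T * DD \<xi>)"
    by (rule has_integral_le[OF I1 I2 ptw])
  then show ?thesis using T_pos by (simp add: field_simps)
qed

text \<open>Poincare's inequality, from the Hoelder estimate based at the zero
  \<open>s\<close>.\<close>

lemma L2_le_of_zero: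
  assumes "\<xi> \<in> C1" "s \<in> {0..T}" "\<xi> s = 0"
  shows "L2 \<xi> \<xi> \<le> T\<^sup>2 * DD \<xi>"
proof -
  have "(norm (\<xi> t))\<^sup>2 \<le> T * DD \<xi>" if t: "t \<in> {0..T}" for t
  proof -
    have "(norm (\<xi> t))\<^sup>2 \<le> \<bar>t - s\<bar> * DD \<xi>"
      using C1_Hoelder[OF assms(1,2) t] assms(3) by simp
    also have "\<dots> \<le> T * DD \<xi>"
      using t assms by (intro mult_right_mono DD_nonneg) auto
    finally show ?thesis .
  qed
  then have "L2 \<xi> \<xi> \<le> integral {0..T} (\<lambda>_. T * DD \<xi>)"
    unfolding L2_self
    by (intro integral_le integrable_continuous_real continuous_intros C1_cont assms)
  then show ?thesis using T_pos by (simp add: power2_eq_square)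
qed

lemma uniform_imp_L1:
  fixes f :: "nat \<Rightarrow> real \<Rightarrow> complex^'n"
  assumes f: "\<And>n. continuous_on {0..T} (f n)" and l: "continuous_on {0..T} l"
    and unif: "\<And>e. e > 0 \<Longrightarrow> \<exists>N. \<forall>n\<ge>N. \<forall>t\<in>{0..T}. norm (f n t - l t) < e"
  shows "(\<lambda>n. integral {0..T} (\<lambda>t. norm (f n t - l t))) \<longlonglongrightarrow> 0"
proof (rule LIMSEQ_I)
  fix e :: real assume "e > 0"
  then have "e / (2 * T) > 0" using T_pos by simp
  from unif[OF this] obtain N where N: "\<forall>n\<ge>N. \<forall>t\<in>{0..T}. norm (f n t - l t) < e / (2 * T)" ..
  have "norm (integral {0..T} (\<lambda>t. norm (f n t - l t)) - 0) < e" if "n \<ge> N" for n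
  proof -
    have "integral {0..T} (\<lambda>t. norm (f n t - l t)) \<le> integral {0..T} (\<lambda>_. e / (2 * T))"
      using N that
      by (intro integral_le integrable_continuous_real continuous_intros f l) (auto intro: less_imp_le)
    also have "\<dots> = e / 2" using T_pos by simp
    also have "\<dots> < e" using \<open>e > 0\<close> by simp
    finally have "integral {0..T} (\<lambda>t. norm (f n t - l t)) < e" .
    moreover have "integral {0..T} (\<lambda>t. norm (f n t - l t)) \<ge> 0"
      by (intro integral_nonneg integrable_continuous_real continuous_intros f l) auto
    ultimately show ?thesis by simp
  qed
  then show "\<exists>N. \<forall>n\<ge>N. norm (integral {0..T} (\<lambda>t. norm (f n t - l t)) - 0) < e" by blast
qed

lemma integral_limit_of_L1:
  fixes f :: "nat \<Rightarrow> real \<Rightarrow> complex^'n"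
  assumes f: "\<And>n. continuous_on {0..T} (f n)" and l: "continuous_on {0..T} l"
    and lim: "(\<lambda>n. integral {0..T} (\<lambda>t. norm (f n t - l t))) \<longlonglongrightarrow> 0"
    and t: "t \<in> {0..T}"
  shows "(\<lambda>n. integral {0..t} (f n)) \<longlonglongrightarrow> integral {0..t} l"
proof -
  have sub: "continuous_on {0..t} (f n)" "continuous_on {0..t} l" for n
    using t by (auto intro!: continuous_on_subset[OF f] continuous_on_subset[OF l])
  have "norm (integral {0..t} (f n) - integral {0..t} l) \<le> integral {0..T} (\<lambda>t. norm (f n t - l t))" for n
  proof -
    have "integral {0..t} (f n) - integral {0..t} l = integral {0..t} (\<lambda>s. f n s - l s)"
      by (intro Henstock_Kurzweil_Integration.integral_diff[symmetric] integrable_continuous_real sub)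
    also have "norm \<dots> \<le> integral {0..t} (\<lambda>s. norm (f n s - l s))"
      by (intro integral_norm_bound_integral integrable_continuous_real continuous_intros sub) auto
    also have "\<dots> \<le> integral {0..T} (\<lambda>s. norm (f n s - l s))"
      using t by (intro integral_subset_le integrable_continuous_real continuous_intros f l sub) auto
    finally show ?thesis .
  qed
  then have "(\<lambda>n. integral {0..t} (f n) - integral {0..t} l) \<longlonglongrightarrow> 0"
    by (intro Lim_null_comparison[OF _ lim] always_eventually allI)
  then show ?thesis by (rule LIM_zero_cancel)
qed

end

context sturm_liouville
begin

text \<open>\<open>r\<close> measures the failure of the once-integrated equation of du Bois-Reymond.\<close>

lemma almost_solution_estimates:
  assumes \<xi>: "\<xi> \<in> C1" and \<epsilon>: "\<epsilon> \<ge> 0"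
    and weak: "\<And>\<phi>. \<phi> \<in> C1 \<Longrightarrow> (B \<xi> \<phi>)\<^sup>2 \<le> \<epsilon> * (DD \<phi> + L2 \<phi> \<phi>)"
  defines "y \<equiv> prim 0 (force \<xi>)"
  defines "r \<equiv> (\<lambda>t. momentum \<xi> t - y t)"
  shows "integral {0..T} (\<lambda>t. (norm (r t))\<^sup>2) \<le> \<epsilon> * (1 + T\<^sup>2)"
    and "(norm (y T))\<^sup>2 \<le> \<epsilon> * T"
proof -
  have T0: "0 \<in> {0..T}" "T \<in> {0..T}" using T_pos by auto
  have cf: "continuous_on {0..T} (force \<xi>)" by (rule cont_force[OF \<xi>])
  have yC: "y \<in> C1" unfolding y_def by (rule prim_C1[OF cf])
  have y0: "y 0 = 0" by (simp add: y_def prim_0)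
  have cr: "continuous_on {0..T} r"
    unfolding r_def by (intro continuous_intros cont_momentum \<xi> C1_cont yC)
  \<comment> \<open>Integration by parts of the force term, with \<open>y 0 = 0\<close>, leaves the
    residual and one end term. Each of them is isolated below by a suitable \<phi>.\<close>
  have B_eq: "B \<xi> \<phi> = integral {0..T} (\<lambda>t. r t \<bullet> Dv \<phi> t) + y T \<bullet> \<phi> T" if \<phi>: "\<phi> \<in> C1" for \<phi>
  proof -
    have "((\<lambda>t. y t \<bullet> Dv \<phi> t + force \<xi> t \<bullet> \<phi> t) has_integral (y T \<bullet> \<phi> T - y 0 \<bullet> \<phi> 0)) {0..T}"
    proof (rule fundamental_theorem_of_calculus)
      fix t assume t: "t \<in> {0..T}"
      show "((\<lambda>t. y t \<bullet> \<phi> t) has_vector_derivative (y t \<bullet> Dv \<phi> t + force \<xi> t \<bullet> \<phi> t)) (at t within {0..T})"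
        using bounded_bilinear.has_vector_derivative[OF bounded_bilinear_inner
            prim_has_derivative[OF cf t] C1_deriv[OF \<phi> t]]
        by (simp add: y_def)
    qed (use T_pos in auto)
    moreover have "((\<lambda>t. r t \<bullet> Dv \<phi> t) has_integral integral {0..T} (\<lambda>t. r t \<bullet> Dv \<phi> t)) {0..T}"
      by (intro integrable_integral integrable_continuous_real continuous_intros cr C1_cont_Dv \<phi>)
    ultimately have "((\<lambda>t. r t \<bullet> Dv \<phi> t + (y t \<bullet> Dv \<phi> t + force \<xi> t \<bullet> \<phi> t)) has_integral
        integral {0..T} (\<lambda>t. r t \<bullet> Dv \<phi> t) + (y T \<bullet> \<phi> T - y 0 \<bullet> \<phi> 0)) {0..T}"
      by (intro has_integral_add)
    moreover have "r t \<bullet> Dv \<phi> t + (y t \<bullet> Dv \<phi> t + force \<xi> t \<bullet> \<phi> t)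
        = momentum \<xi> t \<bullet> Dv \<phi> t + force \<xi> t \<bullet> \<phi> t" for t
      by (simp add: r_def inner_diff_left)
    ultimately show ?thesis
      unfolding B_def using y0 by (simp add: integral_unique)
  qed
  define \<rho> where "\<rho> = integral {0..T} (\<lambda>t. (norm (r t))\<^sup>2)"
  have "\<rho> \<ge> 0"
    unfolding \<rho>_def by (intro integral_nonneg integrable_continuous_real continuous_intros cr) auto
  have "\<rho> \<le> \<epsilon> * (1 + T\<^sup>2)"
  proof (cases "\<rho> = 0")
    case False
    \<comment> \<open>The primitive of the residual, normalized to vanish at \<open>T\<close>: the
      end term drops out and the form takes the value \<rho>.\<close>
    define \<phi> where "\<phi> = prim (- integral {0..T} r) r"
    have \<phi>C: "\<phi> \<in> C1" unfolding \<phi>_def by (rule prim_C1[OF cr])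
    have D\<phi>: "Dv \<phi> t = r t" if "t \<in> {0..T}" for t
      unfolding \<phi>_def by (rule Dv_prim[OF cr that])
    have \<phi>T: "\<phi> T = 0" using T0 by (simp add: \<phi>_def prim_def)
    have "DD \<phi> = \<rho>"
      unfolding DD_def \<rho>_def by (rule integral_cong) (simp add: D\<phi>)
    moreover have "B \<xi> \<phi> = \<rho>"
    proof -
      have "integral {0..T} (\<lambda>t. r t \<bullet> Dv \<phi> t) = \<rho>"
        unfolding \<rho>_def by (rule integral_cong) (simp add: D\<phi> power2_norm_eq_inner)
      then show ?thesis using B_eq[OF \<phi>C] \<phi>T by simp
    qed
    moreover have "L2 \<phi> \<phi> \<le> T\<^sup>2 * DD \<phi>" by (rule L2_le_of_zero[OF \<phi>C T0(2) \<phi>T])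
    ultimately have "\<rho>\<^sup>2 \<le> \<epsilon> * (\<rho> + T\<^sup>2 * \<rho>)"
      using weak[OF \<phi>C] \<epsilon> by (smt (verit) mult_left_mono)
    then have "\<rho> * \<rho> \<le> (\<epsilon> * (1 + T\<^sup>2)) * \<rho>" by (simp add: power2_eq_square algebra_simps)
    then show ?thesis using False \<open>\<rho> \<ge> 0\<close> by (simp add: mult_le_cancel_right)
  qed (use \<epsilon> in auto)
  then show "integral {0..T} (\<lambda>t. (norm (r t))\<^sup>2) \<le> \<epsilon> * (1 + T\<^sup>2)" by (simp add: \<rho>_def)
  show "(norm (y T))\<^sup>2 \<le> \<epsilon> * T"
  proof (cases "y T = 0")
    case False
    \<comment> \<open>A constant test function has derivative 0, so only the end term with
      \<open>y T\<close> remains.\<close>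
    define \<phi> where "\<phi> = prim (y T) (\<lambda>_. 0)"
    have \<phi>C: "\<phi> \<in> C1" unfolding \<phi>_def by (rule prim_C1) auto
    have D\<phi>: "Dv \<phi> t = 0" if "t \<in> {0..T}" for t
      unfolding \<phi>_def by (rule Dv_prim) (use that in auto)
    have \<phi>: "\<phi> t = y T" if "t \<in> {0..T}" for t using that by (simp add: \<phi>_def prim_def)
    have "DD \<phi> = integral {0..T} (\<lambda>_. 0)"
      unfolding DD_def by (rule integral_cong) (simp add: D\<phi>)
    then have "DD \<phi> = 0" by simp
    moreover have "L2 \<phi> \<phi> = integral {0..T} (\<lambda>_. (norm (y T))\<^sup>2)"
      unfolding L2_self by (rule integral_cong) (simp add: \<phi>)
    then have "L2 \<phi> \<phi> = T * (norm (y T))\<^sup>2" using T_pos by simp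
    moreover have "integral {0..T} (\<lambda>t. r t \<bullet> Dv \<phi> t) = integral {0..T} (\<lambda>_. 0)"
      by (rule integral_cong) (simp add: D\<phi>)
    then have "B \<xi> \<phi> = (norm (y T))\<^sup>2"
      using B_eq[OF \<phi>C] \<phi>[OF T0(2)] by (simp add: power2_norm_eq_inner)
    ultimately have "((norm (y T))\<^sup>2)\<^sup>2 \<le> \<epsilon> * (T * (norm (y T))\<^sup>2)"
      using weak[OF \<phi>C] by simp
    then have "(norm (y T))\<^sup>2 * (norm (y T))\<^sup>2 \<le> (\<epsilon> * T) * (norm (y T))\<^sup>2"
      by (simp add: power2_eq_square mult_ac)
    moreover have "(norm (y T))\<^sup>2 > 0" using False by simp
    ultimately show ?thesis by (rule mult_right_le_imp_le)
  qed (use \<epsilon> T_pos in auto)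
qed

text \<open>The momenta need not be equicontinuous, but the primitives \<open>y n\<close> of the
  forces are, and the two differ by a residual that tends to 0 in L2. The derivatives are not
  compact either; their limit is read off from the limit of \<open>y n\<close> by inverting
  \<open>P\<close>, and they converge in L1, which suffices to pass to the limit in the integrated
  equations.\<close>

lemma almost_solution_limit:
  assumes \<xi>: "\<And>n. \<xi> n \<in> C1" and A: "\<And>n. L2 (\<xi> n) (\<xi> n) \<le> A" "\<And>n. DD (\<xi> n) \<le> A"
    and \<epsilon>: "\<And>n. \<epsilon> n \<ge> 0" "\<epsilon> \<longlonglongrightarrow> 0"
    and weak: "\<And>n \<phi>. \<phi> \<in> C1 \<Longrightarrow> (B (\<xi> n) \<phi>)\<^sup>2 \<le> \<epsilon> n * (DD \<phi> + L2 \<phi> \<phi>)"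
  obtains z k where "strict_mono (k :: nat \<Rightarrow> nat)" "z \<in> E Neumann 0"
    "\<And>e. e > 0 \<Longrightarrow> \<exists>N. \<forall>n\<ge>N. \<forall>t\<in>{0..T}. norm (\<xi> (k n) t - z t) < e"
proof -
  have T0: "0 \<in> {0..T}" "T \<in> {0..T}" using T_pos by auto
  obtain a where a: "a > 0" "\<And>t u. t \<in> {0..T} \<Longrightarrow> cmv (P t) u \<bullet> u \<ge> a * (norm u)\<^sup>2"
    using continuous_pos_def_bound[OF cont_P pos_P] by blast
  obtain q where q: "q > 0" "\<And>t u. t \<in> {0..T} \<Longrightarrow> norm (cmv (Q t) u) \<le> q * norm u"
    using continuous_matrix_bound[OF cont_Q] by blast
  obtain q' where q': "q' > 0" "\<And>t u. t \<in> {0..T} \<Longrightarrow> norm (cmv (transpose (Q t)) u) \<le> q' * norm u"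
    using continuous_matrix_bound[OF cont_Qt] by blast
  obtain r' where r': "r' > 0" "\<And>t u. t \<in> {0..T} \<Longrightarrow> norm (cmv (R t) u) \<le> r' * norm u"
    using continuous_matrix_bound[OF cont_R] by blast
  define y where "y n = prim 0 (force (\<xi> n))" for n
  define r where "r n t = momentum (\<xi> n) t - y n t" for n t
  have cf: "continuous_on {0..T} (force (\<xi> n))" for n by (rule cont_force[OF \<xi>])
  have yC: "y n \<in> C1" for n unfolding y_def by (rule prim_C1[OF cf])
  have y0: "y n 0 = 0" for n by (simp add: y_def prim_0)
  have Dy: "Dv (y n) t = force (\<xi> n) t" if "t \<in> {0..T}" for n t
    unfolding y_def by (rule Dv_prim[OF cf that])
  have cr: "continuous_on {0..T} (r n)" for n
    unfolding r_def by (intro continuous_intros cont_momentum \<xi> C1_cont yC)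
  have r_small: "integral {0..T} (\<lambda>t. (norm (r n t))\<^sup>2) \<le> \<epsilon> n * (1 + T\<^sup>2)"
    and yT_small: "(norm (y n T))\<^sup>2 \<le> \<epsilon> n * T" for n
    using almost_solution_estimates[OF \<xi> \<epsilon>(1) weak, of n] unfolding y_def r_def by blast+
  have "A \<ge> 0" using A(2)[of 0] DD_nonneg[OF \<xi>, of 0] by linarith
  \<comment> \<open>The terms with \<open>q'\<close> and \<open>r'\<close> bound the energy of
    \<open>y n\<close>. The further summand \<open>A\<close> lets \<open>K\<close> bound the energy
    of \<open>\<xi> n\<close> as well, and the final 1 makes it positive.\<close>
  define K where "K = (2 * q'\<^sup>2 + 2 * r'\<^sup>2 + 1) * A + 1"
  have K: "K > 0" "A \<le> K"
  proof -
    have "0 \<le> (2 * q'\<^sup>2 + 2 * r'\<^sup>2) * A" using \<open>A \<ge> 0\<close> by simp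
    then have "K \<ge> A + 1" by (simp only: K_def distrib_right)
    then show "K > 0" "A \<le> K" using \<open>A \<ge> 0\<close> by auto
  qed
  have DDy: "DD (y n) \<le> K" for n
  proof -
    have ptw: "(norm (Dv (y n) t))\<^sup>2 \<le> 2 * q'\<^sup>2 * (norm (Dv (\<xi> n) t))\<^sup>2 + 2 * r'\<^sup>2 * (norm (\<xi> n t))\<^sup>2"
      if t: "t \<in> {0..T}" for t
    proof -
      have "norm (Dv (y n) t) \<le> q' * norm (Dv (\<xi> n) t) + r' * norm (\<xi> n t)"
        unfolding Dy[OF t] force_def by (intro norm_triangle_le add_mono q' r' t)
      then have "(norm (Dv (y n) t))\<^sup>2 \<le> (q' * norm (Dv (\<xi> n) t) + r' * norm (\<xi> n t))\<^sup>2"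
        by (intro power_mono) auto
      also have "\<dots> \<le> 2 * (q' * norm (Dv (\<xi> n) t))\<^sup>2 + 2 * (r' * norm (\<xi> n t))\<^sup>2"
        using sum_squares_bound[of "q' * norm (Dv (\<xi> n) t)" "r' * norm (\<xi> n t)"]
        by (simp add: power2_sum)
      finally show ?thesis by (simp add: power_mult_distrib)
    qed
    have i: "(\<lambda>t. (norm (Dv (\<xi> n) t))\<^sup>2) integrable_on {0..T}"
      "(\<lambda>t. (norm (\<xi> n t))\<^sup>2) integrable_on {0..T}" "(\<lambda>t. (norm (Dv (y n) t))\<^sup>2) integrable_on {0..T}"
      by (intro integrable_continuous_real continuous_intros C1_cont_Dv C1_cont \<xi> yC)+
    have "DD (y n) \<le> 2 * q'\<^sup>2 * DD (\<xi> n) + 2 * r'\<^sup>2 * L2 (\<xi> n) (\<xi> n)"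
      unfolding DD_def L2_self
      by (rule has_integral_le[OF integrable_integral[OF i(3)]
           has_integral_add[OF has_integral_mult_right[OF integrable_integral[OF i(1)]]
           has_integral_mult_right[OF integrable_integral[OF i(2)]]] ptw])
    also have "\<dots> \<le> 2 * q'\<^sup>2 * A + 2 * r'\<^sup>2 * A"
      by (intro add_mono mult_left_mono A) auto
    also have "\<dots> \<le> K" using \<open>A \<ge> 0\<close> by (simp add: K_def algebra_simps)
    finally show ?thesis .
  qed
  define F where "F n t = (\<xi> n t, y n t)" for n t
  have b\<xi>: "(norm (\<xi> n t))\<^sup>2 \<le> 2 / T * A + 2 * T * A" if "t \<in> {0..T}" for n t
  proof -
    have "2 / T * L2 (\<xi> n) (\<xi> n) + 2 * T * DD (\<xi> n) \<le> 2 / T * A + 2 * T * A"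
      using T_pos by (intro add_mono mult_left_mono A) auto
    then show ?thesis using C1_bound[OF \<xi> that, of n] by linarith
  qed
  have bndy: "(norm (y n t))\<^sup>2 \<le> T * K" if "t \<in> {0..T}" for n t
  proof -
    have "(norm (y n t))\<^sup>2 \<le> \<bar>t - 0\<bar> * DD (y n)"
      using C1_Hoelder[OF yC T0(1) that, of n] y0 by simp
    also have "\<dots> \<le> T * K" using that DD_nonneg[OF yC] K by (intro mult_mono DDy) auto
    finally show ?thesis .
  qed
  have bound: "norm (F n t) \<le> sqrt (2 / T * A + 2 * T * A) + sqrt (T * K)" if "t \<in> {0..T}" for n t
  proof -
    have "norm (F n t) \<le> norm (\<xi> n t) + norm (y n t)"
      unfolding F_def by (rule norm_Pair_le)
    also have "\<dots> \<le> sqrt (2 / T * A + 2 * T * A) + sqrt (T * K)"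
      using b\<xi>[OF that] bndy[OF that] by (intro add_mono real_le_rsqrt)
    finally show ?thesis .
  qed
  have equi: "\<exists>d>0. \<forall>n t. t \<in> {0..T} \<and> norm (s - t) < d \<longrightarrow> norm (F n s - F n t) < e"
    if s: "s \<in> {0..T}" and e: "e > 0" for s e
  proof -
    \<comment> \<open>With energy at most \<open>K\<close>, the Hoelder estimate keeps the
      oscillation within distance \<open>d\<close> below \<open>e / 2\<close>.\<close>
    define d where "d = (e / 2)\<^sup>2 / K"
    have d: "d > 0" using e K by (simp add: d_def)
    have half: "norm (x s - x t) < e / 2"
      if x: "x \<in> C1" "DD x \<le> K" and t: "t \<in> {0..T}" "norm (s - t) < d" for x :: "real \<Rightarrow> complex^'n" and t
    proof -
      have "(norm (x s - x t))\<^sup>2 \<le> \<bar>s - t\<bar> * DD x"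
        by (rule C1_Hoelder[OF x(1) t(1) s])
      also have "\<dots> \<le> \<bar>s - t\<bar> * K" by (intro mult_left_mono x) auto
      also have "\<dots> < d * K" using t(2) K by (intro mult_strict_right_mono) auto
      also have "\<dots> = (e / 2)\<^sup>2" using K by (simp add: d_def)
      finally show ?thesis by (rule power2_less_imp_less) (use e in simp)
    qed
    have "norm (F n s - F n t) < e" if t: "t \<in> {0..T}" "norm (s - t) < d" for n t
    proof -
      have "norm (F n s - F n t) \<le> norm (\<xi> n s - \<xi> n t) + norm (y n s - y n t)"
        unfolding F_def diff_Pair by (rule norm_Pair_le)
      also have "\<dots> < e / 2 + e / 2"
        by (intro add_strict_mono half[OF \<xi> order_trans[OF A(2) K(2)] t] half[OF yC DDy t])
      finally show ?thesis by simp
    qed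
    then show ?thesis using d by blast
  qed
  obtain G and k :: "nat \<Rightarrow> nat" where G: "continuous_on {0..T} G" and k: "strict_mono k"
    and unif: "\<And>e. e > 0 \<Longrightarrow> \<exists>N. \<forall>n t. n \<ge> N \<and> t \<in> {0..T} \<longrightarrow> norm (F (k n) t - G t) < e"
    using Arzela_Ascoli[OF compact_Icc bound equi] by metis
  define z where "z t = (if t \<in> {0..T} then fst (G t) else 0)" for t
  define \<eta> where "\<eta> t = (if t \<in> {0..T} then snd (G t) else 0)" for t
  have cz: "continuous_on {0..T} z"
    using continuous_on_fst[OF G] by (rule continuous_on_eq) (simp add: z_def)
  have c\<eta>: "continuous_on {0..T} \<eta>"
    using continuous_on_snd[OF G] by (rule continuous_on_eq) (simp add: \<eta>_def)
  have unif2: "\<exists>N. \<forall>n\<ge>N. \<forall>t\<in>{0..T}. norm (\<xi> (k n) t - z t) < e \<and> norm (y (k n) t - \<eta> t) < e"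
    if e: "e > 0" for e
  proof -
    obtain N where N: "\<forall>n t. n \<ge> N \<and> t \<in> {0..T} \<longrightarrow> norm (F (k n) t - G t) < e"
      using unif[OF e] by blast
    have "norm (\<xi> (k n) t - z t) < e \<and> norm (y (k n) t - \<eta> t) < e" if "n \<ge> N" "t \<in> {0..T}" for n t
    proof -
      have "norm (F (k n) t - G t) < e" using N that by blast
      moreover have "\<xi> (k n) t - z t = fst (F (k n) t - G t)" "y (k n) t - \<eta> t = snd (F (k n) t - G t)"
        using that(2) by (simp_all add: F_def z_def \<eta>_def)
      ultimately show ?thesis by (metis norm_fst_le norm_snd_le order_le_less_trans surjective_pairing)
    qed
    then show ?thesis by blast
  qed
  have lim\<xi>: "(\<lambda>n. \<xi> (k n) t) \<longlonglongrightarrow> z t" and limy: "(\<lambda>n. y (k n) t) \<longlonglongrightarrow> \<eta> t" if "t \<in> {0..T}" for t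
    using unif2 that by (meson LIMSEQ_I)+
  have L1\<xi>: "(\<lambda>n. integral {0..T} (\<lambda>t. norm (\<xi> (k n) t - z t))) \<longlonglongrightarrow> 0"
    using unif2 by (intro uniform_imp_L1 C1_cont \<xi> cz) meson
  have L1y: "(\<lambda>n. integral {0..T} (\<lambda>t. norm (y (k n) t - \<eta> t))) \<longlonglongrightarrow> 0"
    using unif2 by (intro uniform_imp_L1 C1_cont yC c\<eta>) meson
  have \<epsilon>k: "(\<lambda>n. \<epsilon> (k n)) \<longlonglongrightarrow> 0"
    using LIMSEQ_subseq_LIMSEQ[OF \<epsilon>(2) k] by (simp add: o_def)
  have L1r: "(\<lambda>n. integral {0..T} (\<lambda>t. norm (r (k n) t))) \<longlonglongrightarrow> 0"
  proof (rule Lim_null_comparison)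
    have "(\<lambda>n. sqrt (T * (\<epsilon> (k n) * (1 + T\<^sup>2)))) \<longlonglongrightarrow> sqrt (T * (0 * (1 + T\<^sup>2)))"
      by (intro tendsto_intros \<epsilon>k)
    then show "(\<lambda>n. sqrt (T * (\<epsilon> (k n) * (1 + T\<^sup>2)))) \<longlonglongrightarrow> 0" by simp
    show "\<forall>\<^sub>F n in sequentially. norm (integral {0..T} (\<lambda>t. norm (r (k n) t)))
        \<le> sqrt (T * (\<epsilon> (k n) * (1 + T\<^sup>2)))"
    proof (intro always_eventually allI)
      fix n
      have "(integral {0..T} (\<lambda>t. norm (r (k n) t)))\<^sup>2
          \<le> (T - 0) * integral {0..T} (\<lambda>t. (norm (r (k n) t))\<^sup>2)"
        using T_pos by (intro integral_norm_square_le cr) auto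
      also have "\<dots> \<le> (T - 0) * (\<epsilon> (k n) * (1 + T\<^sup>2))"
        using T_pos by (intro mult_left_mono r_small) auto
      finally have "(integral {0..T} (\<lambda>t. norm (r (k n) t)))\<^sup>2 \<le> T * (\<epsilon> (k n) * (1 + T\<^sup>2))" by simp
      then have "\<bar>integral {0..T} (\<lambda>t. norm (r (k n) t))\<bar> \<le> sqrt (T * (\<epsilon> (k n) * (1 + T\<^sup>2)))"
        by (metis real_sqrt_abs real_sqrt_le_mono)
      then show "norm (integral {0..T} (\<lambda>t. norm (r (k n) t))) \<le> sqrt (T * (\<epsilon> (k n) * (1 + T\<^sup>2)))"
        by simp
    qed
  qed
  \<comment> \<open>The candidate for the derivative of \<open>z\<close>: the limit momentum
    relation solved for the velocity.\<close>
  define g where "g t = cmv (matrix_inv (P t)) (\<eta> t - cmv (Q t) (z t))" for t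
  have Pg: "cmv (P t) (g t) = \<eta> t - cmv (Q t) (z t)" if "t \<in> {0..T}" for t
    using pos_def_invertible(1)[OF pos_P[OF that]] by (simp add: g_def flip: cmv_mult)
  have cg: "continuous_on {0..T} g"
    by (rule continuous_on_matrix_solve[OF cont_P pos_P _ Pg])
       (auto intro!: continuous_intros cont_coeffs cz c\<eta>)
  define h where "h t = cmv (transpose (Q t)) (g t) + cmv (R t) (z t)" for t
  have ch: "continuous_on {0..T} h"
    unfolding h_def by (intro continuous_intros cont_coeffs cg cz)
  \<comment> \<open>Through the lower bound for \<open>P\<close>, the error of the derivative is
    controlled by the residual and by the errors of \<open>y\<close> and \<xi>, all of which vanish
    in L1.\<close>
  have L1g: "(\<lambda>n. integral {0..T} (\<lambda>t. norm (Dv (\<xi> (k n)) t - g t))) \<longlonglongrightarrow> 0"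
  proof (rule Lim_null_comparison)
    let ?b = "\<lambda>n. (1 / a) * (integral {0..T} (\<lambda>t. norm (r (k n) t))
        + integral {0..T} (\<lambda>t. norm (y (k n) t - \<eta> t)) + q * integral {0..T} (\<lambda>t. norm (\<xi> (k n) t - z t)))"
    have "?b \<longlonglongrightarrow> (1 / a) * (0 + 0 + q * 0)"
      by (intro tendsto_intros L1r L1y L1\<xi>)
    then show "?b \<longlonglongrightarrow> 0" by simp
    show "\<forall>\<^sub>F n in sequentially. norm (integral {0..T} (\<lambda>t. norm (Dv (\<xi> (k n)) t - g t))) \<le> ?b n"
    proof (intro always_eventually allI)
      fix n
      have ptw: "norm (Dv (\<xi> (k n)) t - g t)
          \<le> (1 / a) * (norm (r (k n) t) + norm (y (k n) t - \<eta> t) + q * norm (\<xi> (k n) t - z t))"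
        if t: "t \<in> {0..T}" for t
      proof -
        let ?u = "Dv (\<xi> (k n)) t - g t"
        have "cmv (P t) ?u = r (k n) t + (y (k n) t - \<eta> t) - cmv (Q t) (\<xi> (k n) t - z t)"
          by (simp add: cmv_diff Pg[OF t] r_def momentum_def)
        then have "norm (cmv (P t) ?u)
            = norm (r (k n) t + (y (k n) t - \<eta> t) - cmv (Q t) (\<xi> (k n) t - z t))"
          by (rule arg_cong)
        also have "\<dots> \<le> norm (r (k n) t) + norm (y (k n) t - \<eta> t)
            + norm (cmv (Q t) (\<xi> (k n) t - z t))"
          using norm_triangle_ineq4[of "r (k n) t + (y (k n) t - \<eta> t)" "cmv (Q t) (\<xi> (k n) t - z t)"]
            norm_triangle_ineq[of "r (k n) t" "y (k n) t - \<eta> t"] by linarith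
        also have "\<dots> \<le> norm (r (k n) t) + norm (y (k n) t - \<eta> t) + q * norm (\<xi> (k n) t - z t)"
          by (intro add_left_mono q t)
        finally have 1: "norm (cmv (P t) ?u) \<le> \<dots>" .
        have "a * (norm ?u)\<^sup>2 \<le> norm (cmv (P t) ?u) * norm ?u"
          using a(2)[OF t, of ?u] norm_cauchy_schwarz[of "cmv (P t) ?u" ?u] by linarith
        then have "a * norm ?u \<le> norm (cmv (P t) ?u)"
          by (cases "?u = 0") (auto simp: power2_eq_square)
        with 1 show ?thesis using a(1) by (simp add: field_simps)
      qed
      have i: "(\<lambda>t. norm (r (k n) t)) integrable_on {0..T}"
        "(\<lambda>t. norm (y (k n) t - \<eta> t)) integrable_on {0..T}"
        "(\<lambda>t. norm (\<xi> (k n) t - z t)) integrable_on {0..T}"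
        "(\<lambda>t. norm (Dv (\<xi> (k n)) t - g t)) integrable_on {0..T}"
        by (intro integrable_continuous_real continuous_intros cr C1_cont C1_cont_Dv yC \<xi> c\<eta> cz cg)+
      have "integral {0..T} (\<lambda>t. norm (Dv (\<xi> (k n)) t - g t)) \<le> ?b n"
      by (rule has_integral_le[OF integrable_integral[OF i(4)]
           has_integral_mult_right[OF has_integral_add[OF has_integral_add[OF integrable_integral[OF i(1)]
           integrable_integral[OF i(2)]]
           has_integral_mult_right[OF integrable_integral[OF i(3)]]]] ptw])
      moreover have "integral {0..T} (\<lambda>t. norm (Dv (\<xi> (k n)) t - g t)) \<ge> 0"
        by (intro integral_nonneg i) auto
      ultimately show "norm (integral {0..T} (\<lambda>t. norm (Dv (\<xi> (k n)) t - g t))) \<le> ?b n" by simp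
    qed
  qed
  have L1h: "(\<lambda>n. integral {0..T} (\<lambda>t. norm (force (\<xi> (k n)) t - h t))) \<longlonglongrightarrow> 0"
  proof (rule Lim_null_comparison)
    let ?b = "\<lambda>n. q' * integral {0..T} (\<lambda>t. norm (Dv (\<xi> (k n)) t - g t))
        + r' * integral {0..T} (\<lambda>t. norm (\<xi> (k n) t - z t))"
    have "?b \<longlonglongrightarrow> q' * 0 + r' * 0"
      by (intro tendsto_intros L1g L1\<xi>)
    then show "?b \<longlonglongrightarrow> 0" by simp
    show "\<forall>\<^sub>F n in sequentially. norm (integral {0..T} (\<lambda>t. norm (force (\<xi> (k n)) t - h t))) \<le> ?b n"
    proof (intro always_eventually allI)
      fix n
      have ptw: "norm (force (\<xi> (k n)) t - h t)
          \<le> q' * norm (Dv (\<xi> (k n)) t - g t) + r' * norm (\<xi> (k n) t - z t)" if t: "t \<in> {0..T}" for t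
      proof -
        have "force (\<xi> (k n)) t - h t
            = cmv (transpose (Q t)) (Dv (\<xi> (k n)) t - g t) + cmv (R t) (\<xi> (k n) t - z t)"
          by (simp add: force_def h_def cmv_diff)
        then show ?thesis
          using norm_triangle_le[OF add_mono[OF q'(2)[OF t] r'(2)[OF t]]] by simp
      qed
      have i: "(\<lambda>t. norm (\<xi> (k n) t - z t)) integrable_on {0..T}"
        "(\<lambda>t. norm (Dv (\<xi> (k n)) t - g t)) integrable_on {0..T}"
        "(\<lambda>t. norm (force (\<xi> (k n)) t - h t)) integrable_on {0..T}"
        by (intro integrable_continuous_real continuous_intros C1_cont C1_cont_Dv cf \<xi> cz cg ch)+
      have "integral {0..T} (\<lambda>t. norm (force (\<xi> (k n)) t - h t)) \<le> ?b n"
      by (rule has_integral_le[OF integrable_integral[OF i(3)]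
           has_integral_add[OF has_integral_mult_right[OF integrable_integral[OF i(2)]]
           has_integral_mult_right[OF integrable_integral[OF i(1)]]] ptw])
      moreover have "integral {0..T} (\<lambda>t. norm (force (\<xi> (k n)) t - h t)) \<ge> 0"
        by (intro integral_nonneg i) auto
      ultimately show "norm (integral {0..T} (\<lambda>t. norm (force (\<xi> (k n)) t - h t))) \<le> ?b n" by simp
    qed
  qed
  have z_eq: "z t = prim (z 0) g t" for t
  proof (cases "t \<in> {0..T}")
    case True
    have "(\<lambda>n. integral {0..t} (Dv (\<xi> (k n)))) \<longlonglongrightarrow> integral {0..t} g"
      by (rule integral_limit_of_L1[OF C1_cont_Dv[OF \<xi>] cg L1g True])
    moreover have "integral {0..t} (Dv (\<xi> (k n))) = \<xi> (k n) t - \<xi> (k n) 0" for n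
      using C1_increment[OF \<xi> T0(1) True] True by (intro integral_unique) auto
    ultimately have "(\<lambda>n. \<xi> (k n) t - \<xi> (k n) 0) \<longlonglongrightarrow> integral {0..t} g" by simp
    moreover have "(\<lambda>n. \<xi> (k n) t - \<xi> (k n) 0) \<longlonglongrightarrow> z t - z 0"
      by (intro tendsto_intros lim\<xi> True T0)
    ultimately have "integral {0..t} g = z t - z 0" by (rule LIMSEQ_unique)
    then show ?thesis using True by (simp add: prim_def)
  qed (auto simp: z_def prim_def)
  have \<eta>_eq: "\<eta> t = prim 0 h t" for t
  proof (cases "t \<in> {0..T}")
    case True
    have "(\<lambda>n. integral {0..t} (force (\<xi> (k n)))) \<longlonglongrightarrow> integral {0..t} h"
      by (rule integral_limit_of_L1[OF cf ch L1h True])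
    then have "(\<lambda>n. y (k n) t) \<longlonglongrightarrow> integral {0..t} h"
      using True by (simp add: y_def prim_def)
    then have "integral {0..t} h = \<eta> t" using limy[OF True] LIMSEQ_unique by blast
    then show ?thesis using True by (simp add: prim_def)
  qed (auto simp: \<eta>_def prim_def)
  \<comment> \<open>The natural boundary condition at \<open>T\<close>, which comes from testing
    with constants; at 0 it holds by the choice of the primitive.\<close>
  have \<eta>T: "\<eta> T = 0"
  proof -
    have "(\<lambda>n. (norm (y (k n) T))\<^sup>2) \<longlonglongrightarrow> 0"
    proof (rule Lim_null_comparison)
      have "(\<lambda>n. \<epsilon> (k n) * T) \<longlonglongrightarrow> 0 * T" by (intro tendsto_intros \<epsilon>k)
      then show "(\<lambda>n. \<epsilon> (k n) * T) \<longlonglongrightarrow> 0" by simp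
    qed (use yT_small in auto)
    moreover have "(\<lambda>n. (norm (y (k n) T))\<^sup>2) \<longlonglongrightarrow> (norm (\<eta> T))\<^sup>2"
      by (intro tendsto_intros limy T0)
    ultimately show ?thesis using LIMSEQ_unique by fastforce
  qed
  have "eigen 0 z \<and> (\<forall>t\<in>{0..T}. momentum z t = \<eta> t)"
  proof (rule eigenI)
    show "z t = 0" if "t \<notin> {0..T}" for t using that by (auto simp: z_def)
    have "z = prim (z 0) g" using z_eq by (rule ext)
    then show "(z has_vector_derivative g t) (at t within {0..T})" if "t \<in> {0..T}" for t
      using prim_has_derivative[OF cg that] by metis
    have "\<eta> = prim 0 h" using \<eta>_eq by (rule ext)
    then have "(\<eta> has_vector_derivative h t) (at t within {0..T})" if "t \<in> {0..T}" for t
      using prim_has_derivative[OF ch that] by metis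
    then show "(\<eta> has_vector_derivative cmv (transpose (Q t)) (g t) + cmv (R t) (z t) - 0 *\<^sub>R z t)
        (at t within {0..T})" if "t \<in> {0..T}" for t
      using that by (simp add: h_def)
    show "\<eta> t = cmv (P t) (g t) + cmv (Q t) (z t)" if "t \<in> {0..T}" for t
      using Pg[OF that] by simp
  qed (rule cg)
  moreover have "\<eta> 0 = 0" using \<eta>_eq[of 0] by (simp add: prim_0)
  ultimately have "z \<in> E Neumann 0"
    using \<eta>T T0 by (simp add: sturm_eigenspace_iff boundary_def Neumann_def)
  then show ?thesis using that[OF k] unif2 by meson
qed

end

section \<open>Orthogonal projection and families of eigenfunctions\<close>

context interval
begin

lemma L2_scale_right:
  assumes "\<xi> \<in> C1" "\<eta> \<in> C1"
  shows "L2 \<xi> (scale_cfun c \<eta>) = Re c * L2 \<xi> \<eta> + Im c * L2 \<xi> (scale_cfun \<i> \<eta>)"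
proof -
  have "scale_cfun c \<eta> = scale_cfun (complex_of_real (Re c)) \<eta>
      + scale_cfun (complex_of_real (Im c)) (scale_cfun \<i> \<eta>)"
    unfolding cfun.scale_scale cfun.scale_left_distrib[symmetric]
    by (rule arg_cong[where f = "\<lambda>c. scale_cfun c \<eta>"]) (simp add: complex_eq_iff)
  then have "L2 \<xi> (scale_cfun c \<eta>) = L2 (scale_cfun (complex_of_real (Re c)) \<eta>) \<xi>
      + L2 (scale_cfun (complex_of_real (Im c)) (scale_cfun \<i> \<eta>)) \<xi>"
    using assms by (simp only: L2_add_left C1_scale L2_sym[of \<xi>])
  then show ?thesis
    using assms by (simp only: L2_scale_real C1_scale L2_sym[of \<xi>])
qed

text \<open>The Hermitian L2 product, complex linear in its first argument, reassembled from real
  products. Its vanishing is a single complex condition, as a count of complex dimensions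
  requires.\<close>

definition hL2 :: "(real \<Rightarrow> complex^'n) \<Rightarrow> (real \<Rightarrow> complex^'n) \<Rightarrow> complex"
  where "hL2 \<xi> \<eta> = Complex (L2 \<xi> \<eta>) (L2 \<xi> (scale_cfun \<i> \<eta>))"

lemma hL2_add:
  "\<xi> \<in> C1 \<Longrightarrow> \<xi>' \<in> C1 \<Longrightarrow> \<eta> \<in> C1 \<Longrightarrow> hL2 (\<xi> + \<xi>') \<eta> = hL2 \<xi> \<eta> + hL2 \<xi>' \<eta>"
  by (simp only: hL2_def L2_add_left C1_scale complex_add)

lemma hL2_scale:
  assumes "\<xi> \<in> C1" "\<eta> \<in> C1"
  shows "hL2 (scale_cfun c \<xi>) \<eta> = c * hL2 \<xi> \<eta>"
proof -
  have "L2 (scale_cfun c \<xi>) \<eta> = Re c * L2 \<xi> \<eta> - Im c * L2 \<xi> (scale_cfun \<i> \<eta>)"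
    using L2_scale[OF assms, of c] L2_scale_right[OF assms, of "cnj c"] by simp
  moreover have "L2 (scale_cfun c \<xi>) (scale_cfun \<i> \<eta>)
      = Re c * L2 \<xi> (scale_cfun \<i> \<eta>) + Im c * L2 \<xi> \<eta>"
    using L2_scale[OF assms(1) C1_scale[OF assms(2)], of c \<i>] L2_scale_right[OF assms, of "cnj c * \<i>"]
    by (simp only: cfun.scale_scale) simp
  ultimately show ?thesis by (simp add: hL2_def complex_eq_iff)
qed

lemma hL2_span:
  assumes "\<xi> \<in> C1" "b \<subseteq> C1" "\<And>e. e \<in> b \<Longrightarrow> hL2 \<xi> e = 0" "u \<in> cfun.span b"
  shows "L2 \<xi> u = 0"
proof -
  \<comment> \<open>All complex multiples are demanded at once, because real orthogonality alone
    does not define a complex subspace.\<close>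
  have "cfun.subspace {u \<in> C1. \<forall>c. L2 \<xi> (scale_cfun c u) = 0}"
  proof (rule cfun.subspaceI, goal_cases)
    case 1
    show ?case using C1_0 assms(1) L2_0_left[of \<xi>] L2_sym[of \<xi> 0]
      by (simp only: mem_Collect_eq cfun.scale_zero_right) simp
  next
    case (2 x y)
    then show ?case using assms(1)
      by (simp only: mem_Collect_eq C1_add cfun.scale_right_distrib L2_add_right C1_scale) simp
  next
    case (3 c x)
    then show ?case using assms(1)
      by (simp only: mem_Collect_eq C1_scale cfun.scale_scale) simp
  qed
  moreover have "b \<subseteq> {u \<in> C1. \<forall>c. L2 \<xi> (scale_cfun c u) = 0}"
  proof
    fix e assume e: "e \<in> b"
    then have "L2 \<xi> e = 0" "L2 \<xi> (scale_cfun \<i> e) = 0"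
      using assms(3)[OF e] by (auto simp: hL2_def complex_eq_iff)
    then show "e \<in> {u \<in> C1. \<forall>c. L2 \<xi> (scale_cfun c u) = 0}"
      using e assms(1,2) L2_scale_right[of \<xi> e] by auto
  qed
  ultimately have "u \<in> {u \<in> C1. \<forall>c. L2 \<xi> (scale_cfun c u) = 0}"
    using assms(4) cfun.span_minimal by blast
  then have "L2 \<xi> (scale_cfun 1 u) = 0" by blast
  then show ?thesis by (simp only: cfun.scale_one)
qed

text \<open>Gram-Schmidt, one vector at a time: the new vector is first made orthogonal to the old
  span, then its component is removed from the remainder of \<phi>.\<close>

lemma L2_projection:
  assumes "finite b" "b \<subseteq> C1" "\<phi> \<in> C1"
  shows "\<exists>e\<in>cfun.span b. \<forall>u\<in>cfun.span b. L2 (\<phi> - e) u = 0"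
  using assms
proof (induction b arbitrary: \<phi> rule: finite_induct)
  case empty
  have "L2 (\<phi> - 0) 0 = 0"
    using L2_0_left[OF C1_diff[OF empty(2) C1_0]] L2_sym by metis
  then show ?case unfolding cfun.span_empty by blast
next
  case (insert a b)
  have sub: "cfun.span b \<subseteq> C1"
    using insert.prems by (intro cfun.span_minimal subspace_C1) auto
  have a: "a \<in> C1" and bC: "b \<subseteq> C1" using insert.prems by auto
  obtain p where p: "p \<in> cfun.span b" "\<forall>u\<in>cfun.span b. L2 (\<phi> - p) u = 0"
    using insert.IH[OF bC insert.prems(2)] by blast
  obtain p' where p': "p' \<in> cfun.span b" "\<forall>u\<in>cfun.span b. L2 (a - p') u = 0"
    using insert.IH[OF bC a] by blast
  define a' where "a' = a - p'"
  define \<phi>' where "\<phi>' = \<phi> - p"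
  have a'C: "a' \<in> C1" unfolding a'_def using a p' sub by (intro C1_diff) auto
  have \<phi>'C: "\<phi>' \<in> C1" unfolding \<phi>'_def using insert.prems p sub by (intro C1_diff) auto
  \<comment> \<open>The Fourier coefficient of \<open>\<phi>'\<close> along \<open>a'\<close>. If
    \<open>a'\<close> has norm 0, the quotient is 0 by convention, and \<open>a' = 0\<close> makes
    any value harmless.\<close>
  define \<alpha> where "\<alpha> = hL2 \<phi>' a' / complex_of_real (L2 a' a')"
  define e where "e = p + scale_cfun \<alpha> a'"
  have mono: "cfun.span b \<subseteq> cfun.span (insert a b)" by (rule cfun.span_mono) auto
  have a'S: "a' \<in> cfun.span (insert a b)"
    unfolding a'_def using mono p' by (intro cfun.span_diff) (auto intro: cfun.span_base)
  have eS: "e \<in> cfun.span (insert a b)"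
    unfolding e_def using mono p a'S by (intro cfun.span_add cfun.span_scale) auto
  \<comment> \<open>The Hermitian square of \<open>a'\<close> is real: moving the imaginary unit
    across the product reverses its sign.\<close>
  have L2aa: "L2 a' (scale_cfun \<i> a') = 0"
  proof -
    have "L2 a' (scale_cfun \<i> a') = L2 (scale_cfun (- \<i>) a') a'"
      using L2_scale[OF a'C a'C, of "- \<i>"] by simp
    also have "\<dots> = L2 a' (scale_cfun (- \<i>) a')" by (rule L2_sym)
    also have "\<dots> = - L2 a' (scale_cfun \<i> a')"
      using L2_scale_right[OF a'C a'C, of "- \<i>"] by simp
    finally show ?thesis by simp
  qed
  have h0: "hL2 (\<phi>' - scale_cfun \<alpha> a') a' = 0"
  proof (cases "L2 a' a' = 0")
    case True
    then have "a' = 0" by (rule L2_eq_0[OF a'C])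
    moreover have "hL2 x 0 = 0" if "x \<in> C1" for x :: "real \<Rightarrow> complex^'n"
      unfolding hL2_def cfun.scale_zero_right
      using L2_0_left[OF that] L2_sym[of x 0] by (simp add: complex_eq_iff)
    ultimately show ?thesis using C1_diff[OF \<phi>'C C1_scale[OF a'C]] by metis
  next
    case False
    have "hL2 \<phi>' a' = hL2 (\<phi>' - scale_cfun \<alpha> a') a' + hL2 (scale_cfun \<alpha> a') a'"
      using hL2_add[OF C1_diff[OF \<phi>'C C1_scale[OF a'C]] C1_scale[OF a'C] a'C, of \<alpha> \<alpha>]
      by (simp only: diff_add_cancel)
    moreover have "hL2 (scale_cfun \<alpha> a') a' = \<alpha> * complex_of_real (L2 a' a')"
      unfolding hL2_scale[OF a'C a'C] by (simp add: hL2_def L2aa complex_eq_iff)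
    ultimately show ?thesis using False by (simp add: \<alpha>_def)
  qed
  have eq: "\<phi> - e = \<phi>' - scale_cfun \<alpha> a'"
    by (simp only: \<phi>'_def e_def diff_diff_add)
  have eC: "\<phi>' - scale_cfun \<alpha> a' \<in> C1" by (intro C1_diff \<phi>'C C1_scale a'C)
  have "L2 (\<phi> - e) u = 0" if u: "u \<in> cfun.span (insert a b)" for u
  proof -
    from u obtain c where c: "u - scale_cfun c a \<in> cfun.span b"
      unfolding cfun.span_insert by blast
    define w where "w = (u - scale_cfun c a) + scale_cfun c p'"
    have w: "w \<in> cfun.span b"
      unfolding w_def by (intro cfun.span_add c cfun.span_scale p')
    have u_eq: "u = w + scale_cfun c a'"
      by (simp add: w_def a'_def cfun.scale_right_diff_distrib)
    have 1: "L2 (\<phi>' - scale_cfun \<alpha> a') (scale_cfun c a') = 0"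
      by (rule hL2_span[OF eC, of "{a'}"])
         (use a'C h0 in \<open>auto intro: cfun.span_scale cfun.span_base\<close>)
    have "L2 (scale_cfun \<alpha> a') w = L2 a' (scale_cfun (cnj \<alpha>) w)"
      using w sub by (intro L2_scale a'C) auto
    also have "\<dots> = 0" unfolding a'_def using p'(2) cfun.span_scale[OF w] by blast
    finally have 2: "L2 (\<phi>' - scale_cfun \<alpha> a') w = 0"
      using L2_diff_left[OF \<phi>'C C1_scale[OF a'C], of w \<alpha>] w sub p(2) unfolding \<phi>'_def by auto
    show ?thesis
      unfolding eq u_eq
      using L2_add_right[OF eC, of w "scale_cfun c a'"] w sub C1_scale[OF a'C] 1 2 by auto
  qed
  then show ?case using eS by blast
qed

end

context sturm_liouville
begin

lemma eigen_family:
  assumes \<Lambda>: "boundary \<Lambda>" and M: "finite M"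
    and b: "\<forall>\<mu>\<in>M. finite (b \<mu>) \<and> cfun.independent (b \<mu>) \<and> b \<mu> \<subseteq> E \<Lambda> \<mu>"
  shows "cfun.independent (\<Union>\<mu>\<in>M. b \<mu>)" "card (\<Union>\<mu>\<in>M. b \<mu>) = (\<Sum>\<mu>\<in>M. card (b \<mu>))"
    and "z \<in> cfun.span (\<Union>\<mu>\<in>M. b \<mu>) \<Longrightarrow> \<exists>d. (\<forall>\<mu>\<in>M. d \<mu> \<in> E \<Lambda> \<mu>) \<and> z = (\<Sum>\<mu>\<in>M. d \<mu>)"
proof -
  have span: "cfun.span (b \<mu>) \<subseteq> E \<Lambda> \<mu>" if "\<mu> \<in> M" for \<mu>
    using b that by (intro cfun.span_minimal subspace_E \<Lambda>) blast
  have "cfun.independent (\<Union>\<mu>\<in>M. b \<mu>) \<and> card (\<Union>\<mu>\<in>M. b \<mu>) = (\<Sum>\<mu>\<in>M. card (b \<mu>))"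
  proof (rule cfun.independent_UN_direct[OF M])
    fix d assume "\<And>\<mu>. \<mu> \<in> M \<Longrightarrow> d \<mu> \<in> cfun.span (b \<mu>)" and "(\<Sum>\<mu>\<in>M. d \<mu>) = 0"
    then show "\<forall>\<mu>\<in>M. d \<mu> = 0"
      using E_sum_eq_0[OF \<Lambda> M, of d] span by blast
  qed (use b in auto)
  then show "cfun.independent (\<Union>\<mu>\<in>M. b \<mu>)" "card (\<Union>\<mu>\<in>M. b \<mu>) = (\<Sum>\<mu>\<in>M. card (b \<mu>))"
    by blast+
  show "\<exists>d. (\<forall>\<mu>\<in>M. d \<mu> \<in> E \<Lambda> \<mu>) \<and> z = (\<Sum>\<mu>\<in>M. d \<mu>)" if "z \<in> cfun.span (\<Union>\<mu>\<in>M. b \<mu>)"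
    using cfun.span_UN_sum[OF M that] span by (metis subsetD)
qed

lemma eigen_family_C1:
  assumes "boundary \<Lambda>" "\<forall>\<mu>\<in>M. finite (b \<mu>) \<and> cfun.independent (b \<mu>) \<and> b \<mu> \<subseteq> E \<Lambda> \<mu>"
  shows "(\<Union>\<mu>\<in>M. b \<mu>) \<subseteq> C1"
  using assms E_C1 by blast

lemma eigen_family_nonpos:
  assumes "boundary \<Lambda>" "finite M" "\<And>\<mu>. \<mu> \<in> M \<Longrightarrow> d \<mu> \<in> E \<Lambda> \<mu>"
    and "\<And>\<mu>. \<mu> \<in> M \<Longrightarrow> \<mu> \<le> 0"
  shows "B (\<Sum>\<mu>\<in>M. d \<mu>) (\<Sum>\<mu>\<in>M. d \<mu>) \<le> 0"
proof -
  have "B (\<Sum>\<mu>\<in>M. d \<mu>) (\<Sum>\<mu>\<in>M. d \<mu>) = (\<Sum>\<mu>\<in>M. \<mu> * L2 (d \<mu>) (d \<mu>))"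
    using E_sum(2)[of \<Lambda> M d] assms(1-3) by blast
  also have "\<dots> \<le> 0"
    by (intro sum_nonpos mult_nonpos_nonneg assms(4) L2_nonneg) (use assms(1,3) E_C1 in blast)+
  finally show ?thesis .
qed

lemma eigen_family_neg:
  assumes "boundary \<Lambda>" "finite M" "\<And>\<mu>. \<mu> \<in> M \<Longrightarrow> d \<mu> \<in> E \<Lambda> \<mu>"
    and "\<And>\<mu>. \<mu> \<in> M \<Longrightarrow> \<mu> < 0" and "B (\<Sum>\<mu>\<in>M. d \<mu>) (\<Sum>\<mu>\<in>M. d \<mu>) = 0"
  shows "(\<Sum>\<mu>\<in>M. d \<mu>) = 0"
proof (rule sum.neutral, rule ballI)
  fix \<mu> assume \<mu>: "\<mu> \<in> M"
  have C: "d \<mu> \<in> C1" if "\<mu> \<in> M" for \<mu> using assms(1,3) that E_C1 by blast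
  have "(\<Sum>\<mu>\<in>M. - (\<mu> * L2 (d \<mu>) (d \<mu>))) = 0"
    using assms(5) E_sum(2)[of \<Lambda> M d] assms(1-3) by (simp add: sum_negf)
  moreover have "- (\<mu> * L2 (d \<mu>) (d \<mu>)) \<ge> 0" if "\<mu> \<in> M" for \<mu>
    using mult_nonpos_nonneg[of \<mu> "L2 (d \<mu>) (d \<mu>)"] assms(4)[OF that] L2_nonneg[OF C[OF that]] by simp
  ultimately have "- (\<mu> * L2 (d \<mu>) (d \<mu>)) = 0"
    using sum_nonneg_0[OF assms(2), of "\<lambda>\<mu>. - (\<mu> * L2 (d \<mu>) (d \<mu>))"] \<mu> by blast
  then have "L2 (d \<mu>) (d \<mu>) = 0" using assms(4)[OF \<mu>] by auto
  then show "d \<mu> = 0" using L2_eq_0 C \<mu> by blast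
qed

text \<open>Eigenfunctions with nonpositive eigenvalues together span a space on which the form is
  nonpositive, so one number bounds all such families. Finite multiplicity and finiteness of the
  nonpositive spectrum both follow from it.\<close>

lemma nonpositive_eigen_bound:
  assumes "boundary \<Lambda>"
  obtains m :: nat where
    "\<And>M b. finite M \<Longrightarrow> (\<And>\<mu>. \<mu> \<in> M \<Longrightarrow> \<mu> \<le> 0 \<and> finite (b \<mu>) \<and> cfun.independent (b \<mu>) \<and> b \<mu> \<subseteq> E \<Lambda> \<mu>)
      \<Longrightarrow> (\<Sum>\<mu>\<in>M. card (b \<mu>)) \<le> m"
proof -
  obtain m :: nat where m: "\<And>F. finite F \<Longrightarrow> F \<subseteq> C1 \<Longrightarrow> cfun.independent F \<Longrightarrow>
       (\<And>z. z \<in> cfun.span F \<Longrightarrow> B z z \<le> 0) \<Longrightarrow> card F \<le> m"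
    using nonpositive_card_bound by blast
  have "(\<Sum>\<mu>\<in>M. card (b \<mu>)) \<le> m"
    if M: "finite M"
      and b: "\<And>\<mu>. \<mu> \<in> M \<Longrightarrow> \<mu> \<le> 0 \<and> finite (b \<mu>) \<and> cfun.independent (b \<mu>) \<and> b \<mu> \<subseteq> E \<Lambda> \<mu>" for M b
  proof -
    have b': "\<forall>\<mu>\<in>M. finite (b \<mu>) \<and> cfun.independent (b \<mu>) \<and> b \<mu> \<subseteq> E \<Lambda> \<mu>"
      using b by blast
    note fam = eigen_family[OF assms M b']
    have "card (\<Union>\<mu>\<in>M. b \<mu>) \<le> m"
    proof (rule m)
      show "finite (\<Union>\<mu>\<in>M. b \<mu>)" using M b' by blast
      show "(\<Union>\<mu>\<in>M. b \<mu>) \<subseteq> C1" by (rule eigen_family_C1[OF assms b'])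
      show "B z z \<le> 0" if z: "z \<in> cfun.span (\<Union>\<mu>\<in>M. b \<mu>)" for z
      proof -
        obtain d where d: "\<forall>\<mu>\<in>M. d \<mu> \<in> E \<Lambda> \<mu>" "z = (\<Sum>\<mu>\<in>M. d \<mu>)" using fam(3)[OF z] by blast
        show ?thesis
          unfolding d(2) by (rule eigen_family_nonpos[OF assms M]) (use b d(1) in blast)+
      qed
    qed (rule fam(1))
    then show ?thesis using fam(2) by simp
  qed
  then show ?thesis using that by blast
qed

lemma finite_independent_E:
  assumes "boundary \<Lambda>" "\<mu> \<le> 0" "cfun.independent b" "b \<subseteq> E \<Lambda> \<mu>"
  shows "finite b"
proof (rule ccontr)
  assume inf: "infinite b"
  obtain m :: nat where m: "\<And>M b. finite M \<Longrightarrow>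
      (\<And>\<mu>. \<mu> \<in> M \<Longrightarrow> \<mu> \<le> 0 \<and> finite (b \<mu>) \<and> cfun.independent (b \<mu>) \<and> b \<mu> \<subseteq> E \<Lambda> \<mu>)
      \<Longrightarrow> (\<Sum>\<mu>\<in>M. card (b \<mu>)) \<le> m"
    using nonpositive_eigen_bound[OF assms(1)] by blast
  obtain c where c: "c \<subseteq> b" "finite c" "card c = Suc m"
    using infinite_arbitrarily_large[OF inf] by blast
  have "cfun.independent c" using cfun.independent_mono[OF assms(3) c(1)] .
  then have "(\<Sum>\<nu>\<in>{\<mu>}. card c) \<le> m"
    using c assms by (intro m) auto
  then show False using c(3) by simp
qed

lemma E_basis:
  assumes "boundary \<Lambda>" "\<mu> \<le> 0"
  obtains b where "finite b" "cfun.independent b" "b \<subseteq> E \<Lambda> \<mu>" "cfun.span b = E \<Lambda> \<mu>"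
    "card b = cfun.dim (E \<Lambda> \<mu>)"
proof -
  obtain b where b: "b \<subseteq> E \<Lambda> \<mu>" "cfun.independent b" "E \<Lambda> \<mu> \<subseteq> cfun.span b"
    "card b = cfun.dim (E \<Lambda> \<mu>)"
    using cfun.basis_exists by blast
  moreover have "cfun.span b \<subseteq> E \<Lambda> \<mu>" by (intro cfun.span_minimal b subspace_E assms)
  ultimately show ?thesis using that finite_independent_E[OF assms] by blast
qed

lemma finite_nonpos_spectrum:
  assumes "boundary \<Lambda>"
  shows "finite {\<mu>. \<mu> \<le> 0 \<and> E \<Lambda> \<mu> \<noteq> {0}}" (is "finite ?S")
proof (rule ccontr)
  assume inf: "infinite ?S"
  obtain m :: nat where m: "\<And>M b. finite M \<Longrightarrow>
      (\<And>\<mu>. \<mu> \<in> M \<Longrightarrow> \<mu> \<le> 0 \<and> finite (b \<mu>) \<and> cfun.independent (b \<mu>) \<and> b \<mu> \<subseteq> E \<Lambda> \<mu>)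
      \<Longrightarrow> (\<Sum>\<mu>\<in>M. card (b \<mu>)) \<le> m"
    using nonpositive_eigen_bound[OF assms] by blast
  obtain M where M: "M \<subseteq> ?S" "finite M" "card M = Suc m"
    using infinite_arbitrarily_large[OF inf] by blast
  have "\<exists>e. e \<in> E \<Lambda> \<mu> \<and> e \<noteq> 0" if "\<mu> \<in> M" for \<mu>
    using that M(1) cfun.subspace_0[OF subspace_E[OF assms, of \<mu>]] by blast
  then obtain e where e: "\<And>\<mu>. \<mu> \<in> M \<Longrightarrow> e \<mu> \<in> E \<Lambda> \<mu> \<and> e \<mu> \<noteq> 0" by metis
  have "cfun.independent {e \<mu>}" if "\<mu> \<in> M" for \<mu>
    using cfun.dependent_single[of "e \<mu>"] e[OF that] by blast
  then have "(\<Sum>\<mu>\<in>M. card {e \<mu>}) \<le> m"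
    using e M(1) by (intro m M(2)) auto
  then show False using M(3) by simp
qed

end

section \<open>The Neumann index bounds nonpositive subspaces\<close>

context sturm_liouville
begin

lemma boundary_Neumann: "boundary Neumann"
  by (simp add: boundary_def)

lemma boundary_Dirichlet: "boundary Dirichlet"
  by (simp add: boundary_def)

lemma shifted_sturm: "sturm_liouville T P Q (\<lambda>t. R t - mat \<mu>)"
  by (intro sturm_liouville.intro shifted sturm_liouville_axioms.intro pos_P)

lemma shifted_E: "sturm_eigenspace P Q (\<lambda>t. R t - mat \<mu>) T Neumann 0 = E Neumann \<mu>"
proof -
  interpret S: sturm_liouville T P Q "\<lambda>t. R t - mat \<mu>" by (rule shifted_sturm)
  show ?thesis
    using S.sturm_eigenspace_iff[OF S.boundary_Neumann, of _ 0]
      sturm_eigenspace_iff[OF boundary_Neumann, of _ \<mu>]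
    by (auto simp: S.eigen_0 eigen_def)
qed

text \<open>The kernel is among the removed eigenspaces, so that the form can be strictly positive
  on what remains.\<close>

definition perp :: "(real \<Rightarrow> complex^'n) set"
  where "perp = {\<xi> \<in> C1. \<forall>\<mu>\<le>0. \<forall>e\<in>E Neumann \<mu>. L2 \<xi> e = 0}"

lemma perp_C1: "\<xi> \<in> perp \<Longrightarrow> \<xi> \<in> C1"
  by (simp add: perp_def)

lemma subspace_perp: "cfun.subspace perp"
proof (rule cfun.subspaceI)
  have "L2 0 e = 0" if "e \<in> E Neumann \<mu>" for e \<mu>
    by (rule L2_0_left[OF E_C1[OF boundary_Neumann that]])
  then show "0 \<in> perp" unfolding perp_def using C1_0 by blast
next
  fix \<xi> \<eta> assume *: "\<xi> \<in> perp" "\<eta> \<in> perp"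
  have "L2 (\<xi> + \<eta>) e = 0" if "\<mu> \<le> 0" "e \<in> E Neumann \<mu>" for e \<mu>
    using * that L2_add_left[OF perp_C1[OF *(1)] perp_C1[OF *(2)] E_C1[OF boundary_Neumann that(2)]]
    by (simp add: perp_def)
  then show "\<xi> + \<eta> \<in> perp" unfolding perp_def using C1_add[OF *[THEN perp_C1]] by blast
next
  fix \<xi> c assume *: "\<xi> \<in> perp"
  have "L2 (scale_cfun c \<xi>) e = 0" if "\<mu> \<le> 0" "e \<in> E Neumann \<mu>" for e \<mu>
  proof -
    have "scale_cfun (cnj c) e \<in> E Neumann \<mu>"
      by (intro cfun.subspace_scale[OF subspace_E[OF boundary_Neumann]] that)
    then have "L2 \<xi> (scale_cfun (cnj c) e) = 0" using * that(1) unfolding perp_def by blast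
    then show ?thesis
      using L2_scale[OF perp_C1[OF *] E_C1[OF boundary_Neumann that(2)]] by metis
  qed
  then show "scale_cfun c \<xi> \<in> perp" unfolding perp_def using C1_scale[OF perp_C1[OF *]] by blast
qed

text \<open>Only finitely many eigenspaces are nontrivial here, so an L2 projection exists. The
  removed part \<open>e\<close> is a sum of Neumann eigenfunctions, for which L2 orthogonality
  implies orthogonality with respect to the form.\<close>

lemma perp_decomposition:
  assumes "\<phi> \<in> C1"
  obtains e where "e \<in> C1" "\<phi> - e \<in> perp" "\<And>\<xi>. \<xi> \<in> perp \<Longrightarrow> B \<xi> e = 0 \<and> L2 \<xi> e = 0"
proof -
  define S where "S = {\<mu>. \<mu> \<le> 0 \<and> E Neumann \<mu> \<noteq> {0}}"
  have S: "finite S" unfolding S_def by (rule finite_nonpos_spectrum[OF boundary_Neumann])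
  have "\<exists>b. finite b \<and> cfun.independent b \<and> b \<subseteq> E Neumann \<mu> \<and> cfun.span b = E Neumann \<mu>"
    if "\<mu> \<in> S" for \<mu>
  proof -
    have "\<mu> \<le> 0" using that by (simp add: S_def)
    then show ?thesis using E_basis[OF boundary_Neumann, of \<mu>] by metis
  qed
  then obtain b where b: "\<And>\<mu>. \<mu> \<in> S \<Longrightarrow> finite (b \<mu>) \<and> cfun.independent (b \<mu>) \<and>
      b \<mu> \<subseteq> E Neumann \<mu> \<and> cfun.span (b \<mu>) = E Neumann \<mu>" by metis
  then have b': "\<forall>\<mu>\<in>S. finite (b \<mu>) \<and> cfun.independent (b \<mu>) \<and> b \<mu> \<subseteq> E Neumann \<mu>" by blast
  define F where "F = (\<Union>\<mu>\<in>S. b \<mu>)"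
  have F: "finite F" "F \<subseteq> C1"
    unfolding F_def using S b' eigen_family_C1[OF boundary_Neumann b'] by blast+
  obtain e where e: "e \<in> cfun.span F" "\<forall>u\<in>cfun.span F. L2 (\<phi> - e) u = 0"
    using L2_projection[OF F assms] by blast
  have eC: "e \<in> C1" using e(1) cfun.span_minimal[OF F(2) subspace_C1] by blast
  have \<phi>eC: "\<phi> - e \<in> C1" by (rule C1_diff[OF assms eC])
  show ?thesis
  proof
    show "e \<in> C1" by (rule eC)
    have "L2 (\<phi> - e) u = 0" if u: "\<mu> \<le> 0" "u \<in> E Neumann \<mu>" for \<mu> u
    proof (cases "\<mu> \<in> S")
      case True
      then have "u \<in> cfun.span (b \<mu>)" using u b by blast
      moreover have "cfun.span (b \<mu>) \<subseteq> cfun.span F"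
        using True by (intro cfun.span_mono) (auto simp: F_def)
      ultimately show ?thesis using e(2) by blast
    next
      case False
      then have "u = 0" using u by (auto simp: S_def)
      then show ?thesis using L2_0_left[OF \<phi>eC] L2_sym by metis
    qed
    then show "\<phi> - e \<in> perp" unfolding perp_def using \<phi>eC by blast
    fix \<xi> assume \<xi>: "\<xi> \<in> perp"
    obtain d where d: "\<forall>\<mu>\<in>S. d \<mu> \<in> E Neumann \<mu>" "e = (\<Sum>\<mu>\<in>S. d \<mu>)"
      using eigen_family(3)[OF boundary_Neumann S b'] e(1) unfolding F_def by blast
    have dC: "d \<mu> \<in> C1" if "\<mu> \<in> S" for \<mu> using d(1) that E_C1[OF boundary_Neumann] by blast
    have L: "L2 \<xi> (d \<mu>) = 0" if "\<mu> \<in> S" for \<mu>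
      using \<xi> d(1) that unfolding perp_def S_def by blast
    have "B \<xi> (d \<mu>) = 0" if "\<mu> \<in> S" for \<mu>
      using B_E[OF boundary_Neumann, of "d \<mu>" \<mu> \<xi>] d(1) that perp_C1[OF \<xi>] L[OF that]
        B_sym[of \<xi> "d \<mu>"] L2_sym[of \<xi> "d \<mu>"] by simp
    then show "B \<xi> e = 0 \<and> L2 \<xi> e = 0"
      unfolding d(2) using L B_sum_right[of S d \<xi>] L2_sum_right[of S d \<xi>] dC perp_C1[OF \<xi>] by simp
  qed
qed

lemma perp_normalize:
  assumes "\<xi> \<in> perp" "\<xi> \<noteq> 0"
  obtains \<zeta> where "\<zeta> \<in> perp" "L2 \<zeta> \<zeta> = 1" "B \<zeta> \<zeta> = B \<xi> \<xi> / L2 \<xi> \<xi>"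
proof -
  have C: "\<xi> \<in> C1" by (rule perp_C1[OF assms(1)])
  have pos: "L2 \<xi> \<xi> > 0"
    using L2_nonneg[OF C] L2_eq_0[OF C] assms(2) by force
  define s where "s = 1 / sqrt (L2 \<xi> \<xi>)"
  define \<zeta> where "\<zeta> = scale_cfun (complex_of_real s) \<xi>"
  have s2: "s * s = 1 / L2 \<xi> \<xi>" using pos by (simp add: s_def field_simps)
  have \<zeta>C: "\<zeta> \<in> C1" unfolding \<zeta>_def by (rule C1_scale[OF C])
  have "L2 \<zeta> \<zeta> = s * L2 \<xi> \<zeta>" "B \<zeta> \<zeta> = s * B \<xi> \<zeta>"
    using L2_scale_real[OF C \<zeta>C] B_scale_real[OF C \<zeta>C] by (simp_all only: \<zeta>_def)
  moreover have "L2 \<xi> \<zeta> = s * L2 \<xi> \<xi>" "B \<xi> \<zeta> = s * B \<xi> \<xi>"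
    using L2_scale_real[OF C C] B_scale_real[OF C C]
    by (simp_all only: \<zeta>_def L2_sym[of \<xi> "scale_cfun _ _"] B_sym[of \<xi> "scale_cfun _ _"])
  ultimately have "L2 \<zeta> \<zeta> = (s * s) * L2 \<xi> \<xi>" "B \<zeta> \<zeta> = (s * s) * B \<xi> \<xi>" by simp_all
  then have "L2 \<zeta> \<zeta> = 1" "B \<zeta> \<zeta> = B \<xi> \<xi> / L2 \<xi> \<xi>" using s2 pos by simp_all
  moreover have "\<zeta> \<in> perp"
    unfolding \<zeta>_def by (rule cfun.subspace_scale[OF subspace_perp assms(1)])
  ultimately show ?thesis using that by blast
qed

text \<open>Otherwise the infimum \<open>\<mu> \<le> 0\<close> of the Rayleigh quotient on \<open>perp\<close> would be attained, and a
  minimiser is a Neumann eigenfunction for \<open>\<mu>\<close> orthogonal to itself.\<close>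

lemma perp_positive:
  assumes \<xi>\<^sub>0: "\<xi>\<^sub>0 \<in> perp" "B \<xi>\<^sub>0 \<xi>\<^sub>0 \<le> 0"
  shows "\<xi>\<^sub>0 = 0"
proof (rule ccontr)
  assume ne: "\<xi>\<^sub>0 \<noteq> 0"
  obtain \<alpha> b where \<alpha>: "\<alpha> > 0" "b \<ge> 0"
    and lower: "\<And>\<xi>. \<xi> \<in> C1 \<Longrightarrow> B \<xi> \<xi> \<ge> \<alpha> * DD \<xi> - b * L2 \<xi> \<xi>"
    using B_coercive by blast
  obtain C where C: "C > 0" and upper: "\<And>\<xi>. \<xi> \<in> C1 \<Longrightarrow> B \<xi> \<xi> \<le> C * (DD \<xi> + L2 \<xi> \<xi>)"
    using B_upper by blast
  define Ray where "Ray = {B \<xi> \<xi> |\<xi>. \<xi> \<in> perp \<and> L2 \<xi> \<xi> = 1}"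
  obtain \<zeta> where \<zeta>: "\<zeta> \<in> perp" "L2 \<zeta> \<zeta> = 1" "B \<zeta> \<zeta> = B \<xi>\<^sub>0 \<xi>\<^sub>0 / L2 \<xi>\<^sub>0 \<xi>\<^sub>0"
    using perp_normalize[OF \<xi>\<^sub>0(1) ne] by blast
  have \<zeta>R: "B \<zeta> \<zeta> \<in> Ray" unfolding Ray_def using \<zeta> by blast
  have \<zeta>0: "B \<zeta> \<zeta> \<le> 0"
    unfolding \<zeta>(3) using \<xi>\<^sub>0 L2_nonneg[OF perp_C1[OF \<xi>\<^sub>0(1)]] by (simp add: divide_nonpos_nonneg)
  have Ray_lower: "x \<ge> - b" if x: "x \<in> Ray" for x
  proof -
    obtain \<xi> where \<xi>: "\<xi> \<in> perp" "L2 \<xi> \<xi> = 1" "x = B \<xi> \<xi>" using x unfolding Ray_def by blast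
    have "\<alpha> * DD \<xi> \<ge> 0" using \<alpha> DD_nonneg[OF perp_C1[OF \<xi>(1)]] by simp
    then show ?thesis using lower[OF perp_C1[OF \<xi>(1)]] \<xi> by simp
  qed
  have bdd: "bdd_below Ray" by (rule bdd_belowI[OF Ray_lower])
  define \<mu> where "\<mu> = Inf Ray"
  have \<mu>0: "\<mu> \<le> 0" unfolding \<mu>_def using cInf_lower[OF \<zeta>R bdd] \<zeta>0 by linarith
  interpret S: sturm_liouville T P Q "\<lambda>t. R t - mat \<mu>" by (rule shifted_sturm)
  note J = shifted_B[of _ _ \<mu>]
  have J_nonneg: "S.B \<phi> \<phi> \<ge> 0" if \<phi>: "\<phi> \<in> perp" for \<phi>
  proof (cases "\<phi> = 0")
    case True
    show ?thesis unfolding True S.B_0_left[OF C1_0] by (rule order_refl)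
  next
    case False
    obtain \<psi> where \<psi>: "\<psi> \<in> perp" "L2 \<psi> \<psi> = 1" "B \<psi> \<psi> = B \<phi> \<phi> / L2 \<phi> \<phi>"
      by (rule perp_normalize[OF \<phi> False])
    have "B \<psi> \<psi> \<in> Ray" unfolding Ray_def using \<psi>(1,2) by blast
    then have "\<mu> \<le> B \<phi> \<phi> / L2 \<phi> \<phi>"
      unfolding \<mu>_def \<psi>(3)[symmetric] by (rule cInf_lower[OF _ bdd])
    moreover have "L2 \<phi> \<phi> > 0"
      using L2_nonneg[OF perp_C1[OF \<phi>]] L2_eq_0[OF perp_C1[OF \<phi>]] False by force
    ultimately show ?thesis
      unfolding J[OF perp_C1[OF \<phi>] perp_C1[OF \<phi>]] by (simp add: field_simps)
  qed
  have "\<exists>\<xi>. \<xi> \<in> perp \<and> L2 \<xi> \<xi> = 1 \<and> B \<xi> \<xi> < \<mu> + 1 / real (Suc n)" for n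
  proof -
    have "\<exists>x\<in>Ray. x < \<mu> + 1 / real (Suc n)"
      unfolding \<mu>_def using \<zeta>R by (intro cInf_lessD) auto
    then show ?thesis unfolding Ray_def by blast
  qed
  then obtain \<xi> where \<xi>: "\<And>n. \<xi> n \<in> perp" "\<And>n. L2 (\<xi> n) (\<xi> n) = 1"
    "\<And>n. B (\<xi> n) (\<xi> n) < \<mu> + 1 / real (Suc n)" by metis
  have \<xi>C: "\<xi> n \<in> C1" for n by (rule perp_C1[OF \<xi>(1)])
  \<comment> \<open>Collects \<open>C\<close> from the upper bound for the form,
    \<open>- \<mu>\<close> from the shift and \<open>b\<close> from the component of the test
    function outside \<open>perp\<close>.\<close>
  define C' where "C' = C + b - \<mu>"
  have C': "C' > 0" using C \<alpha> \<mu>0 by (simp add: C'_def)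
  define \<epsilon> where "\<epsilon> n = C' / real (Suc n)" for n
  \<comment> \<open>The shifted form is known to be nonnegative only on \<open>perp\<close>, so
    Cauchy-Schwarz is applied to the component \<open>p\<close>. The other component does not pair
    with \<open>\<xi> n\<close>, and its removal costs at most
    \<open>b * L2 \<phi> \<phi>\<close>.\<close>
  have weak: "(S.B (\<xi> n) \<phi>)\<^sup>2 \<le> \<epsilon> n * (DD \<phi> + L2 \<phi> \<phi>)" if \<phi>: "\<phi> \<in> C1" for n \<phi>
  proof -
    obtain e where e: "e \<in> C1" "\<phi> - e \<in> perp" "\<And>\<xi>. \<xi> \<in> perp \<Longrightarrow> B \<xi> e = 0 \<and> L2 \<xi> e = 0"
      using perp_decomposition[OF \<phi>] by blast
    define p where "p = \<phi> - e"
    have p: "p \<in> perp" "p \<in> C1" using e(2) perp_C1 unfolding p_def by blast+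
    have \<phi>_eq: "\<phi> = p + e" by (simp only: p_def diff_add_cancel)
    have Se: "S.B \<eta> e = 0" if "\<eta> \<in> perp" for \<eta>
      using J[OF perp_C1[OF that] e(1)] e(3)[OF that] by simp
    \<comment> \<open>One computation serves both forms, for each of which \<open>p\<close> and
      \<open>e\<close> are orthogonal.\<close>
    have split: "F \<phi> \<phi> = F p p + F e e"
      if F: "F = S.B \<or> F = L2" for F
    proof -
      have "F (p + e) (p + e) = (F p p + F p e) + (F p e + F e e)"
        using F S.B_add_left[OF p(2) e(1) C1_add[OF p(2) e(1)]] S.B_add_right[OF p(2) p(2) e(1)]
          S.B_add_right[OF e(1) p(2) e(1)] S.B_sym[of e p]
          L2_add_left[OF p(2) e(1) C1_add[OF p(2) e(1)]] L2_add_right[OF p(2) p(2) e(1)]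
          L2_add_right[OF e(1) p(2) e(1)] L2_sym[of e p] by (elim disjE) simp_all
      moreover have "F p e = 0" using F Se[OF p(1)] e(3)[OF p(1)] by blast
      ultimately show ?thesis unfolding \<phi>_eq by simp
    qed
    have Lp: "L2 p p \<ge> 0" and Le: "L2 e e \<ge> 0" using L2_nonneg p e by blast+
    have "S.B e e \<ge> - b * L2 e e"
    proof -
      have "\<alpha> * DD e \<ge> 0" using \<alpha> DD_nonneg[OF e(1)] by simp
      then have "B e e \<ge> - b * L2 e e" using lower[OF e(1)] by simp
      moreover have "\<mu> * L2 e e \<le> 0" using \<mu>0 Le by (simp add: mult_nonpos_nonneg)
      ultimately show ?thesis unfolding J[OF e(1) e(1)] by simp
    qed
    moreover have "b * L2 e e \<le> b * L2 \<phi> \<phi>"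
      using split[of L2] Lp \<alpha> by (intro mult_left_mono) auto
    ultimately have "S.B p p \<le> S.B \<phi> \<phi> + b * L2 \<phi> \<phi>" using split[of S.B] by simp
    also have "\<dots> \<le> C * (DD \<phi> + L2 \<phi> \<phi>) - \<mu> * L2 \<phi> \<phi> + b * L2 \<phi> \<phi>"
      unfolding J[OF \<phi> \<phi>] using upper[OF \<phi>] by simp
    also have "\<dots> \<le> C' * (DD \<phi> + L2 \<phi> \<phi>)"
    proof -
      have "(b - \<mu>) * DD \<phi> \<ge> 0" using \<mu>0 \<alpha> DD_nonneg[OF \<phi>] by simp
      then show ?thesis by (simp add: C'_def algebra_simps)
    qed
    finally have Jp: "S.B p p \<le> C' * (DD \<phi> + L2 \<phi> \<phi>)" .
    have J\<xi>: "S.B (\<xi> n) (\<xi> n) \<le> 1 / real (Suc n)"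
      unfolding J[OF \<xi>C \<xi>C] using \<xi>(2,3)[of n] by simp
    have "S.B (\<xi> n) \<phi> = S.B (\<xi> n) p"
      unfolding \<phi>_eq using S.B_add_right[OF \<xi>C p(2) e(1), of n] Se[OF \<xi>(1), of n] by simp
    moreover have "(S.B (\<xi> n) p)\<^sup>2 \<le> S.B (\<xi> n) (\<xi> n) * S.B p p"
      by (rule S.B_Cauchy_Schwarz[OF subspace_perp _ J_nonneg \<xi>(1) p(1)]) (use perp_C1 in blast)
    moreover have "\<dots> \<le> 1 / real (Suc n) * (C' * (DD \<phi> + L2 \<phi> \<phi>))"
      by (intro mult_mono J\<xi> Jp J_nonneg p) auto
    ultimately show ?thesis by (simp add: \<epsilon>_def)
  qed
  \<comment> \<open>The maximum with 1 lets \<open>A\<close> bound the normalized L2 squares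
    together with the energies.\<close>
  define A where "A = max 1 ((1 + b) / \<alpha>)"
  have DD\<xi>: "DD (\<xi> n) \<le> A" for n
  proof -
    have "B (\<xi> n) (\<xi> n) \<le> 1"
      using \<xi>(3)[of n] \<mu>0 divide_le_eq_1[of 1 "real (Suc n)"] by linarith
    then have "\<alpha> * DD (\<xi> n) \<le> 1 + b"
      using lower[OF \<xi>C, of n] \<xi>(2)[of n] by simp
    then have "DD (\<xi> n) \<le> (1 + b) / \<alpha>" using \<alpha> by (simp add: field_simps)
    then show ?thesis by (simp add: A_def)
  qed
  have \<epsilon>0: "\<epsilon> n \<ge> 0" for n using C' by (simp add: \<epsilon>_def)
  have \<epsilon>lim: "\<epsilon> \<longlonglongrightarrow> 0"
    unfolding \<epsilon>_def using tendsto_mult_right_zero[OF LIMSEQ_inverse_real_of_nat, of C']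
    by (simp add: divide_inverse)
  have L2A: "L2 (\<xi> n) (\<xi> n) \<le> A" for n by (simp add: \<xi>(2) A_def)
  obtain z k where zk: "strict_mono (k :: nat \<Rightarrow> nat)"
    "z \<in> sturm_eigenspace P Q (\<lambda>t. R t - mat \<mu>) T Neumann 0"
    and unif: "\<And>e. e > 0 \<Longrightarrow> \<exists>N. \<forall>n\<ge>N. \<forall>t\<in>{0..T}. norm (\<xi> (k n) t - z t) < e"
    using S.almost_solution_limit[OF \<xi>C L2A DD\<xi> \<epsilon>0 \<epsilon>lim weak] by metis
  have z: "z \<in> E Neumann \<mu>" using zk(2) unfolding shifted_E .
  have zC: "z \<in> C1" by (rule E_C1[OF boundary_Neumann z])
  have lim: "(\<lambda>n. L2 (\<xi> (k n) - z) (\<xi> (k n) - z)) \<longlonglongrightarrow> 0"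
  proof (rule LIMSEQ_I)
    fix e :: real assume e: "e > 0"
    define d where "d = sqrt (e / (2 * T))"
    have d: "d > 0" "d\<^sup>2 = e / (2 * T)" using e T_pos by (auto simp: d_def)
    obtain N where N: "\<forall>n\<ge>N. \<forall>t\<in>{0..T}. norm (\<xi> (k n) t - z t) < d" using unif[OF d(1)] by blast
    have "norm (L2 (\<xi> (k n) - z) (\<xi> (k n) - z) - 0) < e" if n: "n \<ge> N" for n
    proof -
      have "L2 (\<xi> (k n) - z) (\<xi> (k n) - z) \<le> integral {0..T} (\<lambda>_. e / (2 * T))"
        unfolding L2_self
      proof (intro integral_le integrable_continuous_real continuous_intros C1_cont C1_diff \<xi>C zC)
        fix t assume t: "t \<in> {0..T}"
        have "(norm (\<xi> (k n) t - z t))\<^sup>2 \<le> d\<^sup>2"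
          using N n t by (intro power_mono) (auto intro: less_imp_le)
        then show "(norm ((\<xi> (k n) - z) t))\<^sup>2 \<le> e / (2 * T)" using d by simp
      qed
      also have "\<dots> = e / 2" using T_pos by simp
      also have "\<dots> < e" using e by simp
      finally show ?thesis using L2_nonneg[OF C1_diff[OF \<xi>C zC], of "k n"] by simp
    qed
    then show "\<exists>N. \<forall>n\<ge>N. norm (L2 (\<xi> (k n) - z) (\<xi> (k n) - z) - 0) < e" by blast
  qed
  \<comment> \<open>Pythagoras: \<open>z\<close> is orthogonal to every \<open>\<xi> n\<close>
    because \<mu> \<le> 0, so the distance stays at least 1, against uniform convergence.\<close>
  have "L2 (\<xi> (k n) - z) (\<xi> (k n) - z) = 1 + L2 z z" for n
  proof -
    have "L2 (\<xi> (k n)) z = 0" using \<xi>(1)[of "k n"] z \<mu>0 unfolding perp_def by blast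
    then show ?thesis
      using L2_diff_left[OF \<xi>C zC C1_diff[OF \<xi>C zC], of "k n" "k n"]
        L2_diff_right[OF \<xi>C \<xi>C zC, of "k n" "k n"] L2_diff_right[OF zC \<xi>C zC, of "k n"]
        L2_sym[of z "\<xi> (k n)"] \<xi>(2)[of "k n"] by simp
  qed
  then have "(\<lambda>n::nat. 1 + L2 z z) \<longlonglongrightarrow> 0" using lim by simp
  then have "1 + L2 z z = 0" using LIMSEQ_const_iff by blast
  then show False using L2_nonneg[OF zC] by simp
qed

text \<open>A larger family would have in its span a nonzero function orthogonal to all counted
  eigenspaces, against positivity on \<open>perp\<close>. In the second bound the kernel is not
  counted: the function is corrected by its kernel component, which leaves the form unchanged, and
  must then itself lie in the kernel.\<close>

lemma Neumann_nonpos_bound: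
  assumes F: "finite F" "cfun.independent F" "F \<subseteq> C1"
    and nonpos: "\<And>z. z \<in> cfun.span F \<Longrightarrow> B z z \<le> 0"
  shows "card F \<le> morse_index P Q R T Neumann + nullity P Q R T Neumann"
    and "(\<And>z. z \<in> cfun.span F \<Longrightarrow> z \<in> E Neumann 0 \<Longrightarrow> z = 0) \<Longrightarrow>
      card F \<le> morse_index P Q R T Neumann"
proof -
  define S where "S = {\<mu>. \<mu> < 0 \<and> E Neumann \<mu> \<noteq> {0}}"
  have S: "finite S"
    by (rule finite_subset[OF _ finite_nonpos_spectrum[OF boundary_Neumann]]) (auto simp: S_def)
  have "\<exists>b. finite b \<and> b \<subseteq> E Neumann \<mu> \<and> cfun.span b = E Neumann \<mu> \<and> card b = cfun.dim (E Neumann \<mu>)"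
    if "\<mu> \<le> 0" for \<mu>
    using E_basis[OF boundary_Neumann that] by metis
  then obtain b where b: "\<And>\<mu>. \<mu> \<le> 0 \<Longrightarrow> finite (b \<mu>) \<and> b \<mu> \<subseteq> E Neumann \<mu> \<and>
      cfun.span (b \<mu>) = E Neumann \<mu> \<and> card (b \<mu>) = cfun.dim (E Neumann \<mu>)" by metis
  have FC: "cfun.span F \<subseteq> C1" by (rule cfun.span_minimal[OF F(3) subspace_C1])
  have common: "\<exists>z\<in>cfun.span F. z \<noteq> 0 \<and> (\<forall>\<mu>\<in>M. \<forall>e\<in>E Neumann \<mu>. L2 z e = 0)"
    if M: "finite M" "\<And>\<mu>. \<mu> \<in> M \<Longrightarrow> \<mu> \<le> 0"
      and card: "(\<Sum>\<mu>\<in>M. cfun.dim (E Neumann \<mu>)) < card F" for M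
  proof -
    define G where "G = (\<Union>\<mu>\<in>M. b \<mu>)"
    have bM: "finite (b \<mu>)" "b \<mu> \<subseteq> E Neumann \<mu>" "cfun.span (b \<mu>) = E Neumann \<mu>"
      "card (b \<mu>) = cfun.dim (E Neumann \<mu>)" if "\<mu> \<in> M" for \<mu>
      using b[OF M(2)[OF that]] by blast+
    have G: "finite G" "G \<subseteq> C1"
      unfolding G_def using M(1) bM(1,2) E_C1[OF boundary_Neumann] by blast+
    have "card G \<le> (\<Sum>\<mu>\<in>M. card (b \<mu>))" unfolding G_def by (rule card_UN_le[OF M(1)])
    also have "\<dots> = (\<Sum>\<mu>\<in>M. cfun.dim (E Neumann \<mu>))"
      by (intro sum.cong refl bM(4))
    finally have "card G < card F" using card by simp
    then obtain z where z: "z \<in> cfun.span F" "z \<noteq> 0" "\<And>e. e \<in> G \<Longrightarrow> hL2 z e = 0"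
      using cfun.exists_common_zero[OF F(1,2) G(1) _ subspace_C1 F(3), of "\<lambda>e z. hL2 z e"]
        hL2_add hL2_scale G(2) by (metis subsetD)
    have "L2 z e = 0" if "\<mu> \<in> M" "e \<in> E Neumann \<mu>" for \<mu> e
    proof (rule hL2_span[OF _ _ z(3)])
      show "z \<in> C1" using z(1) FC by blast
      show "b \<mu> \<subseteq> C1" using bM(2)[OF that(1)] E_C1[OF boundary_Neumann] by blast
      show "e \<in> cfun.span (b \<mu>)" using bM(3)[OF that(1)] that(2) by simp
      show "u \<in> G" if "u \<in> b \<mu>" for u using that \<open>\<mu> \<in> M\<close> by (auto simp: G_def)
    qed
    then show ?thesis using z by blast
  qed
  have E0: "L2 \<xi> e = 0" if "E Neumann \<mu> = {0}" "e \<in> E Neumann \<mu>" "\<xi> \<in> C1" for \<xi> e \<mu>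
    using that L2_0_left[OF that(3)] L2_sym by (metis singletonD)
  have morse: "morse_index P Q R T Neumann = (\<Sum>\<mu>\<in>S. cfun.dim (E Neumann \<mu>))"
    by (simp add: morse_index_def S_def)
  show "card F \<le> morse_index P Q R T Neumann + nullity P Q R T Neumann"
  proof (rule ccontr)
    assume "\<not> ?thesis"
    moreover have "(\<Sum>\<mu>\<in>insert 0 S. cfun.dim (E Neumann \<mu>))
        = nullity P Q R T Neumann + morse_index P Q R T Neumann"
      using S by (simp add: morse nullity_def S_def)
    ultimately have "(\<Sum>\<mu>\<in>insert 0 S. cfun.dim (E Neumann \<mu>)) < card F" by simp
    moreover have "finite (insert 0 S)" using S by simp
    moreover have "\<mu> \<le> 0" if "\<mu> \<in> insert 0 S" for \<mu> using that by (auto simp: S_def)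
    ultimately obtain z where z: "z \<in> cfun.span F" "z \<noteq> 0"
      "\<forall>\<mu>\<in>insert 0 S. \<forall>e\<in>E Neumann \<mu>. L2 z e = 0"
      using common[of "insert 0 S"] by blast
    have zC: "z \<in> C1" using z(1) FC by blast
    have "L2 z e = 0" if "\<mu> \<le> 0" "e \<in> E Neumann \<mu>" for \<mu> e
    proof (cases "E Neumann \<mu> = {0}")
      case True
      then show ?thesis by (rule E0[OF _ that(2) zC])
    next
      case False
      then have "\<mu> \<in> insert 0 S" using that(1) by (auto simp: S_def)
      then show ?thesis using z(3) that(2) by blast
    qed
    then have "z \<in> perp" unfolding perp_def using zC by blast
    then show False using perp_positive nonpos[OF z(1)] z(2) by blast
  qed
  show "card F \<le> morse_index P Q R T Neumann"
    if triv: "\<And>z. z \<in> cfun.span F \<Longrightarrow> z \<in> E Neumann 0 \<Longrightarrow> z = 0"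
  proof (rule ccontr)
    assume "\<not> ?thesis"
    then have "(\<Sum>\<mu>\<in>S. cfun.dim (E Neumann \<mu>)) < card F" by (simp add: morse)
    moreover have "\<mu> \<le> 0" if "\<mu> \<in> S" for \<mu> using that by (auto simp: S_def)
    ultimately obtain z where z: "z \<in> cfun.span F" "z \<noteq> 0" "\<forall>\<mu>\<in>S. \<forall>e\<in>E Neumann \<mu>. L2 z e = 0"
      using common[of S] S by blast
    have zC: "z \<in> C1" using z(1) FC by blast
    have b0: "finite (b 0)" "b 0 \<subseteq> C1" "cfun.span (b 0) = E Neumann 0"
      using b[of 0] E_C1[OF boundary_Neumann] by auto
    \<comment> \<open>The kernel component of \<open>z\<close>. Once it is subtracted, orthogonality
      holds for the eigenvalue 0 too and persists for the negative ones.\<close>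
    obtain z0 where z0: "z0 \<in> E Neumann 0" "\<forall>u\<in>E Neumann 0. L2 (z - z0) u = 0"
      using L2_projection[OF b0(1,2) zC] unfolding b0(3) by blast
    have z0C: "z0 \<in> C1" by (rule E_C1[OF boundary_Neumann z0(1)])
    have z1C: "z - z0 \<in> C1" by (rule C1_diff[OF zC z0C])
    have "L2 (z - z0) e = 0" if e: "\<mu> \<le> 0" "e \<in> E Neumann \<mu>" for \<mu> e
    proof -
      consider "\<mu> = 0" | "\<mu> < 0" "E Neumann \<mu> = {0}" | "\<mu> \<in> S"
        using e(1) unfolding S_def by fastforce
      then show ?thesis
      proof cases
        case 1
        then show ?thesis using z0(2) e(2) by blast
      next
        case 2
        then show ?thesis using E0[OF _ e(2) z1C] by blast
      next
        case 3
        then have "L2 z0 e = 0" using E_orthogonal[OF boundary_Neumann z0(1) e(2)] by (auto simp: S_def)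
        moreover have "L2 z e = 0" using z(3) 3 e(2) by blast
        ultimately show ?thesis
          using L2_diff_left[OF zC z0C E_C1[OF boundary_Neumann e(2)]] by simp
      qed
    qed
    then have perp: "z - z0 \<in> perp" unfolding perp_def using z1C by blast
    have B0: "B z0 u = 0" if "u \<in> C1" for u
      using B_E[OF boundary_Neumann z0(1) that] by simp
    have "B (z - z0) (z - z0) = B z z"
      using B_diff_left[OF zC z0C z1C] B_diff_right[OF zC zC z0C] B0[OF z1C] B0[OF zC] B_sym[of z z0]
      by simp
    then have "z - z0 = 0" using perp_positive[OF perp] nonpos[OF z(1)] by simp
    then have "z = z0" by (rule eq_iff_diff_eq_0[THEN iffD2])
    then show False using triv[OF z(1)] z0(1) z(2) by blast
  qed
qed

end

section \<open>Isotropic spaces of solutions\<close>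

context sturm_liouville
begin

text \<open>Only negative eigenvalues enter, so the form is negative definite on the span. This
  definiteness separates the family from isotropic spaces of solutions.\<close>

lemma Dirichlet_negative_family:
  obtains D where "finite D" "cfun.independent D" "D \<subseteq> C1" "card D = morse_index P Q R T Dirichlet"
    "\<And>d. d \<in> cfun.span D \<Longrightarrow> d 0 = 0 \<and> d T = 0 \<and> B d d \<le> 0 \<and> (B d d = 0 \<longrightarrow> d = 0)"
proof -
  define S where "S = {\<mu>. \<mu> < 0 \<and> E Dirichlet \<mu> \<noteq> {0}}"
  have S: "finite S"
    by (rule finite_subset[OF _ finite_nonpos_spectrum[OF boundary_Dirichlet]]) (auto simp: S_def)
  have "\<exists>b. finite b \<and> cfun.independent b \<and> b \<subseteq> E Dirichlet \<mu> \<and> card b = cfun.dim (E Dirichlet \<mu>)"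
    if "\<mu> \<in> S" for \<mu>
  proof -
    have "\<mu> \<le> 0" using that by (simp add: S_def)
    then show ?thesis using E_basis[OF boundary_Dirichlet, of \<mu>] by metis
  qed
  then obtain b where b: "\<And>\<mu>. \<mu> \<in> S \<Longrightarrow> finite (b \<mu>) \<and> cfun.independent (b \<mu>) \<and>
      b \<mu> \<subseteq> E Dirichlet \<mu> \<and> card (b \<mu>) = cfun.dim (E Dirichlet \<mu>)" by metis
  then have b': "\<forall>\<mu>\<in>S. finite (b \<mu>) \<and> cfun.independent (b \<mu>) \<and> b \<mu> \<subseteq> E Dirichlet \<mu>" by blast
  note fam = eigen_family[OF boundary_Dirichlet S b']
  define D where "D = (\<Union>\<mu>\<in>S. b \<mu>)"
  show ?thesis
  proof
    show "finite D" unfolding D_def using S b' by blast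
    show "cfun.independent D" unfolding D_def by (rule fam(1))
    show "D \<subseteq> C1" unfolding D_def by (rule eigen_family_C1[OF boundary_Dirichlet b'])
    have "card D = (\<Sum>\<mu>\<in>S. cfun.dim (E Dirichlet \<mu>))"
      unfolding D_def fam(2) using b by (intro sum.cong) auto
    then show "card D = morse_index P Q R T Dirichlet" by (simp add: morse_index_def S_def)
    fix d assume "d \<in> cfun.span D"
    then obtain c where c: "\<forall>\<mu>\<in>S. c \<mu> \<in> E Dirichlet \<mu>" "d = (\<Sum>\<mu>\<in>S. c \<mu>)"
      using fam(3) unfolding D_def by blast
    have "(\<Sum>\<mu>\<in>M. c \<mu>) 0 = 0 \<and> (\<Sum>\<mu>\<in>M. c \<mu>) T = 0" if "M \<subseteq> S" for M
      using finite_subset[OF that S] that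
    proof (induction M rule: finite_induct)
      case (insert \<mu> M)
      have "c \<mu> 0 = 0 \<and> c \<mu> T = 0"
        using c(1) insert.prems by (simp add: sturm_eigenspace_iff[OF boundary_Dirichlet] Dirichlet_def)
      then show ?case using insert by simp
    qed simp
    then have "d 0 = 0 \<and> d T = 0" unfolding c(2) by blast
    moreover have "B d d \<le> 0"
      unfolding c(2) by (rule eigen_family_nonpos[OF boundary_Dirichlet S]) (use c(1) S_def in auto)
    moreover have "d = 0" if "B d d = 0"
      using that unfolding c(2)
      by (intro eigen_family_neg[OF boundary_Dirichlet S]) (use c(1) S_def in auto)
    ultimately show "d 0 = 0 \<and> d T = 0 \<and> B d d \<le> 0 \<and> (B d d = 0 \<longrightarrow> d = 0)" by blast
  qed
qed

text \<open>Dirichlet functions are orthogonal to solutions for the index form, by Green's formula.\<close>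

lemma isotropic_solutions_bound:
  assumes G: "finite G" "cfun.independent G"
    and sol: "\<And>s. s \<in> cfun.span G \<Longrightarrow> solution s"
    and iso: "\<And>s s'. s \<in> cfun.span G \<Longrightarrow> s' \<in> cfun.span G \<Longrightarrow> B s s' = 0"
  shows "card G + morse_index P Q R T Dirichlet
      \<le> morse_index P Q R T Neumann + nullity P Q R T Neumann"
    and "(\<And>s. s \<in> cfun.span G \<Longrightarrow> momentum s 0 = 0 \<Longrightarrow> s = 0) \<Longrightarrow>
      card G + morse_index P Q R T Dirichlet \<le> morse_index P Q R T Neumann"
proof -
  obtain D where D: "finite D" "cfun.independent D" "D \<subseteq> C1"
    "card D = morse_index P Q R T Dirichlet"
    and Dneg: "\<And>d. d \<in> cfun.span D \<Longrightarrow> d 0 = 0 \<and> d T = 0 \<and> B d d \<le> 0 \<and> (B d d = 0 \<longrightarrow> d = 0)"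
    using Dirichlet_negative_family by metis
  have DC: "cfun.span D \<subseteq> C1" by (rule cfun.span_minimal[OF D(3) subspace_C1])
  have GC: "cfun.span G \<subseteq> C1" using sol solution_C1 by blast
  have Bsd: "B s d = 0" if "s \<in> cfun.span G" "d \<in> cfun.span D" for s d
    using B_solution[OF sol[OF that(1)], of d] DC that(2) Dneg[OF that(2)] by auto
  \<comment> \<open>Isotropy makes the form vanish on a common element, and negative definiteness
    then makes the element 0.\<close>
  have int: "cfun.span D \<inter> cfun.span G \<subseteq> {0}"
    using Dneg iso by blast
  define F where "F = D \<union> G"
  have indF: "cfun.independent F" and disj: "D \<inter> G = {}"
    unfolding F_def using cfun.independent_disjoint_Un[OF D(2) G(2) int] by blast+
  have cardF: "card F = card G + morse_index P Q R T Dirichlet"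
    unfolding F_def using card_Un_disjoint[OF D(1) G(1) disj] D(4) by simp
  have F: "finite F" "F \<subseteq> C1"
    unfolding F_def using D G GC cfun.span_superset[of G] by blast+
  have split: "\<exists>d s. d \<in> cfun.span D \<and> s \<in> cfun.span G \<and> z = d + s" if "z \<in> cfun.span F" for z
    using that unfolding F_def cfun.span_Un by blast
  \<comment> \<open>The two spans are orthogonal for the form and the second is isotropic, so only
    the Dirichlet part contributes.\<close>
  have BF: "B z d = B d d" "B z z = B d d"
    if ds: "d \<in> cfun.span D" "s \<in> cfun.span G" "z = d + s" for z d s
  proof -
    have C: "d \<in> C1" "s \<in> C1" using ds DC GC by blast+
    show "B z d = B d d"
      unfolding ds(3) using B_add_left[OF C C(1)] Bsd[OF ds(2,1)] by simp
    moreover have "B z s = 0"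
      unfolding ds(3) using B_add_left[OF C C(2)] Bsd[OF ds(2,1)] iso[OF ds(2,2)] B_sym[of d s] by simp
    moreover have "B z z = B z d + B z s"
      using B_add_right[OF C1_add[OF C] C] unfolding ds(3) .
    ultimately show "B z z = B d d" by simp
  qed
  have nonpos: "B z z \<le> 0" if "z \<in> cfun.span F" for z
    using split[OF that] BF(2) Dneg by metis
  show "card G + morse_index P Q R T Dirichlet
      \<le> morse_index P Q R T Neumann + nullity P Q R T Neumann"
    using Neumann_nonpos_bound(1)[OF F(1) indF F(2) nonpos] cardF by simp
  show "card G + morse_index P Q R T Dirichlet \<le> morse_index P Q R T Neumann"
    if triv: "\<And>s. s \<in> cfun.span G \<Longrightarrow> momentum s 0 = 0 \<Longrightarrow> s = 0"
  proof -
    have "z = 0" if z: "z \<in> cfun.span F" "z \<in> E Neumann 0" for z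
    proof -
      obtain d s where ds: "d \<in> cfun.span D" "s \<in> cfun.span G" "z = d + s"
        using split[OF z(1)] by blast
      have "d \<in> C1" using ds(1) DC by blast
      \<comment> \<open>A Neumann kernel function pairs to 0 with all of \<open>C1\<close>; hence
        the Dirichlet part is 0, and a solution with zero initial momentum remains.\<close>
      then have "B z d = 0" using B_E[OF boundary_Neumann z(2)] by simp
      then have "d = 0" using BF(1)[OF ds] Dneg[OF ds(1)] by simp
      then have "z = s" unfolding ds(3) by (simp only: add_0)
      moreover have "momentum z 0 = 0"
        using z(2) by (simp add: sturm_eigenspace_iff[OF boundary_Neumann] Neumann_def)
      ultimately show ?thesis using triv ds(2) by blast
    qed
    then show ?thesis
      using Neumann_nonpos_bound(2)[OF F(1) indF F(2) nonpos] cardF by metis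
  qed
qed

end

text \<open>Applying \<open>A\<close> and subtracting \<open>a\<close> times the relation removes
  the eigenvector for \<open>a\<close> and scales the others by the nonzero factors
  \<open>\<mu> - a\<close>.\<close>

lemma eigenvectors_sum_eq_0:
  fixes A :: "complex^'m \<Rightarrow> complex^'m"
  assumes add: "\<And>u v. A (u + v) = A u + A v" and scale: "\<And>c u. A (c *s u) = c *s A u"
    and "finite F" "\<And>\<mu>. \<mu> \<in> F \<Longrightarrow> A (d \<mu>) = \<mu> *s d \<mu>" "(\<Sum>\<mu>\<in>F. d \<mu>) = 0" "\<nu> \<in> F"
  shows "d \<nu> = 0"
  using assms(3-)
proof (induction F arbitrary: d \<nu> rule: finite_induct)
  case (insert a F)
  have A0: "A 0 = 0" using scale[of 0 0] by simp
  have A_sum: "A (\<Sum>\<mu>\<in>F. d \<mu>) = (\<Sum>\<mu>\<in>F. \<mu> *s d \<mu>)"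
  proof -
    have "A (\<Sum>\<mu>\<in>G. d \<mu>) = (\<Sum>\<mu>\<in>G. \<mu> *s d \<mu>)" if "G \<subseteq> F" for G
      using finite_subset[OF that insert.hyps(1)] that
      by (induction G rule: finite_induct) (auto simp: A0 add insert.prems(1))
    then show ?thesis by blast
  qed
  have s: "d a = - (\<Sum>\<mu>\<in>F. d \<mu>)"
    using insert.prems(2) insert.hyps by (simp add: eq_neg_iff_add_eq_0)
  have "A (d a) = - A (\<Sum>\<mu>\<in>F. d \<mu>)"
    unfolding s using scale[of "-1"] by simp
  then have "a *s d a = - (\<Sum>\<mu>\<in>F. \<mu> *s d \<mu>)" using insert.prems(1)[of a] A_sum by simp
  then have "(\<Sum>\<mu>\<in>F. \<mu> *s d \<mu>) = a *s (\<Sum>\<mu>\<in>F. d \<mu>)"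
    unfolding s by simp
  then have 0: "(\<Sum>\<mu>\<in>F. (\<mu> - a) *s d \<mu>) = 0"
    by (simp add: vec.scale_left_diff_distrib sum_subtractf vec.scale_sum_right)
  have dF: "d \<mu> = 0" if "\<mu> \<in> F" for \<mu>
  proof -
    have "(\<mu> - a) *s d \<mu> = 0"
    proof (rule insert.IH[OF _ 0 that])
      show "A ((\<mu> - a) *s d \<mu>) = \<mu> *s ((\<mu> - a) *s d \<mu>)" if "\<mu> \<in> F" for \<mu>
        using insert.prems(1)[of \<mu>] that by (simp only: scale insertI2 vec.scale_scale mult.commute)
    qed
    moreover have "\<mu> \<noteq> a" using that insert.hyps by blast
    ultimately show ?thesis by simp
  qed
  then have "d a = 0" using s by simp
  then show ?case using dF insert.prems(3) by blast
qed simp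

section \<open>The monodromy of a brake orbit\<close>

text \<open>In the convention of \<open>B_matrix\<close> the first block is the momentum and the
  second the position.\<close>

definition upper :: "'a^('n::finite + 'n) \<Rightarrow> 'a^'n" where "upper v = (\<chi> i. v $ Inl i)"
definition lower :: "'a^('n::finite + 'n) \<Rightarrow> 'a^'n" where "lower v = (\<chi> i. v $ Inr i)"

lemma upper_lower_eq_iff: "v = w \<longleftrightarrow> upper v = upper w \<and> lower v = lower w"
proof -
  have "(\<forall>i. v $ i = w $ i) \<longleftrightarrow> (\<forall>i. v $ Inl i = w $ Inl i) \<and> (\<forall>i. v $ Inr i = w $ Inr i)"
    by (metis sum.exhaust)
  then show ?thesis by (simp add: vec_eq_iff upper_def lower_def)
qed

lemma upper_lower_simps [simp]:
  "upper (v + w) = upper v + upper w" "lower (v + w) = lower v + lower w"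
  "upper (c *s v) = c *s upper v" "lower (c *s v) = c *s lower v"
  "upper (0 :: complex^('n::finite + 'n)) = 0" "lower (0 :: complex^('n + 'n)) = 0"
  for v w :: "complex^('n::finite + 'n)"
  by (simp_all add: upper_def lower_def vec_eq_iff)

lemma sum_UNIV_Plus:
  "(\<Sum>i\<in>UNIV. f i) = (\<Sum>i\<in>UNIV. f (Inl i)) + (\<Sum>i\<in>UNIV. f (Inr i))"
  for f :: "'a::finite + 'b::finite \<Rightarrow> 'c::comm_monoid_add"
  by (subst UNIV_Plus_UNIV[symmetric], subst sum.Plus) (auto simp: o_def)

lemma upper_block: "upper (cmv (block_matrix A B C D) u) = cmv A (upper u) + cmv B (lower u)"
  and lower_block: "lower (cmv (block_matrix A B C D) u) = cmv C (upper u) + cmv D (lower u)"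
  by (simp_all add: vec_eq_iff upper_def lower_def cmv_nth sum_UNIV_Plus block_matrix_def)

lemma bounded_linear_cmv_left: "bounded_linear (\<lambda>A :: real^'n^'m. cmv A v)"
proof -
  have "linear (\<lambda>A :: real^'n^'m. cmv A v)"
  proof (rule linearI)
    show "cmv (r *\<^sub>R A) v = r *\<^sub>R cmv A v" for r and A :: "real^'n^'m"
      by (simp add: vec_eq_iff cmv_nth scaleR_sum_right) (simp add: scaleR_conv_of_real mult.assoc)
  qed (rule cmv_add_left)
  then show ?thesis by (simp add: linear_conv_bounded_linear)
qed

lemma bounded_linear_upper: "bounded_linear (upper :: complex^('n::finite + 'n) \<Rightarrow> complex^'n)"
  and bounded_linear_lower: "bounded_linear (lower :: complex^('n::finite + 'n) \<Rightarrow> complex^'n)"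
  by (auto simp flip: linear_conv_bounded_linear intro!: linearI simp: upper_def lower_def vec_eq_iff)

definition hermitian :: "complex^'n \<Rightarrow> complex^'n \<Rightarrow> complex"
  where "hermitian u w = (\<Sum>i\<in>UNIV. u $ i * cnj (w $ i))"

lemma Re_hermitian: "Re (hermitian u w) = u \<bullet> w"
  by (simp add: hermitian_def inner_vec_def inner_complex_def)

lemma hermitian_simps [simp]:
  "hermitian (c *s u) w = c * hermitian u w" "hermitian u (c *s w) = cnj c * hermitian u w"
  "hermitian (u + u') w = hermitian u w + hermitian u' w"
  "hermitian u (w + w') = hermitian u w + hermitian u w'"
  "hermitian 0 w = 0" "hermitian u 0 = 0"
  by (simp_all add: hermitian_def sum_distrib_left algebra_simps sum.distrib)

text \<open>Passes from a real identity, valid after replacing \<open>v\<close> by every multiple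
  \<open>c *s v\<close>, to the Hermitian identity.\<close>

lemma complex_eq_of_Re_multiples:
  assumes "\<And>c. Re (c * a) = Re (c * b)"
  shows "a = b"
  using assms[of 1] assms[of "- \<i>"] by (simp add: complex_eq_iff)

section \<open>Orbits of the flow, their reflection and the resulting symmetries\<close>

locale brake_system =
  fixes T :: real and P Q R :: "real \<Rightarrow> real^'n^'n"
    and \<gamma> :: "real \<Rightarrow> real^('n::finite + 'n)^('n + 'n)"
  assumes T_pos': "T > 0" and coeffs: "brake_coefficients T P Q R"
    and fundamental: "fundamental_solution P Q R \<gamma>"
begin

sublocale sturm_liouville T P Q R
  using T_pos' coeffs
  by unfold_locales
     (auto simp: brake_coefficients_def periodic_symmetric_def intro: continuous_on_subset)

text \<open>The parities about 0 and the period \<open>T\<close> combine to parities about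
  \<open>T / 2\<close>.\<close>

lemma reflect_coeffs: "P (T - t) = P t" "Q (T - t) = - Q t" "R (T - t) = R t"
proof -
  have *: "\<And>s. P (s + T) = P s" "\<And>s. Q (s + T) = Q s" "\<And>s. R (s + T) = R s"
    "\<And>s. P (- s) = P s" "\<And>s. Q (- s) = - Q s" "\<And>s. R (- s) = R s"
    using coeffs unfolding brake_coefficients_def periodic_symmetric_def by blast+
  show "P (T - t) = P t" "Q (T - t) = - Q t" "R (T - t) = R t"
    using *(1-3)[of "- t"] *(4-6)[of t] by (simp_all add: add.commute)
qed

definition xc :: "complex^('n + 'n) \<Rightarrow> real \<Rightarrow> complex^'n" where "xc v t = lower (cmv (\<gamma> t) v)"
definition yc :: "complex^('n + 'n) \<Rightarrow> real \<Rightarrow> complex^'n" where "yc v t = upper (cmv (\<gamma> t) v)"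
definition gc :: "complex^('n + 'n) \<Rightarrow> real \<Rightarrow> complex^'n"
  where "gc v t = cmv (matrix_inv (P t)) (yc v t - cmv (Q t) (xc v t))"

text \<open>Hamilton's equations: \<open>J_matrix\<close> exchanges, up to sign, the two blocks of
  \<open>B_matrix\<close> applied to the state; the first is the velocity \<open>gc\<close>, the
  second minus the force.\<close>

lemma xc_deriv: "(xc v has_vector_derivative gc v t) (at t)"
  and yc_deriv: "(yc v has_vector_derivative
      (cmv (transpose (Q t)) (gc v t) + cmv (R t) (xc v t))) (at t)"
proof -
  let ?u = "cmv (\<gamma> t) v" and ?B = "B_matrix (P t) (Q t) (R t)"
  have "(\<gamma> has_vector_derivative (J_matrix ** ?B ** \<gamma> t)) (at t)"
    using fundamental by (simp add: fundamental_solution_def)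
  from bounded_linear.has_vector_derivative[OF bounded_linear_cmv_left this, of v]
  have d: "((\<lambda>t. cmv (\<gamma> t) v) has_vector_derivative cmv J_matrix (cmv ?B ?u)) (at t)"
    by (simp only: cmv_mult)
  have "lower (cmv J_matrix (cmv ?B ?u)) = upper (cmv ?B ?u)"
    by (simp add: J_matrix_def lower_block)
  also have "\<dots> = gc v t"
    by (simp add: B_matrix_def upper_block gc_def cmv_minus_left cmv_mult cmv_diff xc_def yc_def)
  finally show "(xc v has_vector_derivative gc v t) (at t)"
    using bounded_linear.has_vector_derivative[OF bounded_linear_lower d]
    unfolding xc_def[abs_def] by (simp only:)
  have "upper (cmv J_matrix (cmv ?B ?u)) = - lower (cmv ?B ?u)"
    by (simp add: J_matrix_def upper_block cmv_minus_left)
  also have "\<dots> = cmv (transpose (Q t)) (gc v t) + cmv (R t) (xc v t)"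
    by (simp add: B_matrix_def lower_block gc_def cmv_minus_left cmv_diff_left cmv_mult cmv_diff
        xc_def yc_def matrix_mul_assoc)
  finally show "(yc v has_vector_derivative
      (cmv (transpose (Q t)) (gc v t) + cmv (R t) (xc v t))) (at t)"
    using bounded_linear.has_vector_derivative[OF bounded_linear_upper d]
    unfolding yc_def[abs_def] by (simp only:)
qed

lemma pos_P': "pos_def_matrix (P t)"
  using coeffs by (simp add: brake_coefficients_def)

lemma P_gc: "cmv (P t) (gc v t) = yc v t - cmv (Q t) (xc v t)"
  using pos_def_invertible(1)[OF pos_P'] by (simp add: gc_def flip: cmv_mult)

lemma cont_xc: "continuous_on S (xc v)" and cont_yc: "continuous_on S (yc v)"
  using xc_deriv yc_deriv
  by (meson continuous_at_imp_continuous_on has_vector_derivative_continuous)+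

lemma cont_gc: "continuous_on {0..T} (gc v)"
  by (rule continuous_on_matrix_solve[OF cont_P pos_P _ P_gc])
     (auto intro!: continuous_intros cont_xc cont_yc cont_coeffs)

definition orbit :: "complex^('n + 'n) \<Rightarrow> real \<Rightarrow> complex^'n"
  where "orbit v t = (if t \<in> {0..T} then xc v t else 0)"

lemma orbit_eigen: "eigen 0 (orbit v) \<and> (\<forall>t\<in>{0..T}. momentum (orbit v) t = yc v t)"
proof (rule eigenI)
  fix t assume t: "t \<in> {0..T}"
  show "(orbit v has_vector_derivative gc v t) (at t within {0..T})"
    by (rule has_vector_derivative_transform[OF t _ has_vector_derivative_at_within[OF xc_deriv]])
       (simp add: orbit_def)
  show "yc v t = cmv (P t) (gc v t) + cmv (Q t) (orbit v t)"
    using t by (simp add: orbit_def P_gc)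
  show "(yc v has_vector_derivative (cmv (transpose (Q t)) (gc v t) + cmv (R t) (orbit v t)
      - 0 *\<^sub>R orbit v t)) (at t within {0..T})"
    using has_vector_derivative_at_within[OF yc_deriv] t by (simp add: orbit_def)
qed (auto simp: orbit_def cont_gc)

definition reflected :: "complex^('n + 'n) \<Rightarrow> real \<Rightarrow> complex^'n"
  where "reflected v t = (if t \<in> {0..T} then xc v (T - t) else 0)"

lemma has_vector_derivative_reflect:
  assumes "(f has_vector_derivative f') (at (T - t))"
  shows "((\<lambda>t. f (T - t)) has_vector_derivative - f') (at t within S)"
proof -
  have "((\<lambda>t. T - t) has_vector_derivative - 1) (at t)"
    by (auto intro!: derivative_eq_intros)
  from vector_diff_chain_at[OF this assms] show ?thesis
    by (simp add: o_def has_vector_derivative_at_within)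
qed

text \<open>Time reversal changes the sign of the velocity, and oddness of \<open>Q\<close> that of
  the mixed terms; the reversed orbit therefore solves the same equation with opposite
  momentum.\<close>

lemma reflected_eigen:
  "eigen 0 (reflected v) \<and> (\<forall>t\<in>{0..T}. momentum (reflected v) t = - yc v (T - t))"
proof (rule eigenI)
  fix t assume t: "t \<in> {0..T}"
  show "(reflected v has_vector_derivative - gc v (T - t)) (at t within {0..T})"
    by (rule has_vector_derivative_transform[OF t _ has_vector_derivative_reflect[OF xc_deriv]])
       (simp add: reflected_def)
  show "- yc v (T - t) = cmv (P t) (- gc v (T - t)) + cmv (Q t) (reflected v t)"
    using t P_gc[of "T - t" v]
    by (simp add: reflected_def reflect_coeffs cmv_minus cmv_minus_left)
  have "((\<lambda>t. - yc v (T - t)) has_vector_derivative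
      - (- (cmv (transpose (Q (T - t))) (gc v (T - t)) + cmv (R (T - t)) (xc v (T - t)))))
      (at t within {0..T})"
    by (intro has_vector_derivative_minus has_vector_derivative_reflect yc_deriv)
  moreover have "transpose (- Q t) = - transpose (Q t)" by (simp add: transpose_def vec_eq_iff)
  ultimately show "((\<lambda>t. - yc v (T - t)) has_vector_derivative
      (cmv (transpose (Q t)) (- gc v (T - t)) + cmv (R t) (reflected v t) - 0 *\<^sub>R reflected v t))
      (at t within {0..T})"
    using t by (simp add: reflected_def reflect_coeffs cmv_minus cmv_minus_left)
next
  show "continuous_on {0..T} (\<lambda>t. - gc v (T - t))"
    by (intro continuous_intros continuous_on_compose2[OF cont_gc]) auto
qed (auto simp: reflected_def)

definition M :: "complex^('n + 'n) \<Rightarrow> complex^('n + 'n)" where "M v = cmv (\<gamma> T) v"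

lemma M_add: "M (u + v) = M u + M v" and M_scale: "M (c *s v) = c *s M v"
  by (simp_all add: M_def cmv_add cmv_vscale)

lemma boundary_values:
  "xc v 0 = lower v" "yc v 0 = upper v" "xc v T = lower (M v)" "yc v T = upper (M v)"
  using fundamental by (simp_all add: xc_def yc_def M_def fundamental_solution_def)

lemma orbit_solution: "solution (orbit v)"
  using orbit_eigen by (simp add: eigen_0)

lemma reflected_solution: "solution (reflected v)"
  using reflected_eigen by (simp add: eigen_0)

lemma B_orbit: "B (orbit v) (orbit w) = upper (M v) \<bullet> lower (M w) - upper v \<bullet> lower w"
proof -
  have "0 \<in> {0..T}" "T \<in> {0..T}" using T_pos by auto
  then show ?thesis
    using B_solution[OF orbit_solution solution_C1[OF orbit_solution], of v w] orbit_eigen[of v]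
    by (simp add: orbit_def boundary_values)
qed

text \<open>Symmetry of the form on two orbits, written out at both ends by Green's formula, says
  that the monodromy preserves the symplectic form.\<close>

lemma symplectic:
  "hermitian (upper (M v)) (lower (M w)) - hermitian (lower (M v)) (upper (M w))
    = hermitian (upper v) (lower w) - hermitian (lower v) (upper w)"
proof (rule complex_eq_of_Re_multiples)
  fix c
  have "B (orbit (c *s v)) (orbit w) = B (orbit w) (orbit (c *s v))" by (rule B_sym)
  then have "upper (M (c *s v)) \<bullet> lower (M w) - lower (M (c *s v)) \<bullet> upper (M w)
      = upper (c *s v) \<bullet> lower w - lower (c *s v) \<bullet> upper w"
    unfolding B_orbit by (simp add: inner_commute)
  then show "Re (c * (hermitian (upper (M v)) (lower (M w)) - hermitian (lower (M v)) (upper (M w))))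
    = Re (c * (hermitian (upper v) (lower w) - hermitian (lower v) (upper w)))"
    unfolding right_diff_distrib hermitian_simps(1)[symmetric] M_scale[symmetric]
      upper_lower_simps(3,4)[symmetric]
    by (simp only: Re_hermitian minus_complex.simps)
qed

text \<open>The same symmetry for an orbit and a reflected orbit. In terms of the involution
  \<open>N\<close> below, the symplectic pairing of \<open>M v\<close> with \<open>N w\<close>
  equals that of \<open>v\<close> with \<open>N (M w)\<close>.\<close>

lemma reversible:
  "hermitian (upper (M v)) (lower w) + hermitian (lower (M v)) (upper w)
    = hermitian (upper v) (lower (M w)) + hermitian (lower v) (upper (M w))"
proof (rule complex_eq_of_Re_multiples)
  fix c
  have T0: "0 \<in> {0..T}" "T \<in> {0..T}" using T_pos by auto
  have "B (orbit (c *s v)) (reflected w) = B (reflected w) (orbit (c *s v))" by (rule B_sym)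
  then have "upper (M (c *s v)) \<bullet> lower w + lower (M (c *s v)) \<bullet> upper w
      = upper (c *s v) \<bullet> lower (M w) + lower (c *s v) \<bullet> upper (M w)"
    using B_solution[OF orbit_solution solution_C1[OF reflected_solution], of "c *s v" w]
      B_solution[OF reflected_solution solution_C1[OF orbit_solution], of w "c *s v"]
      orbit_eigen[of "c *s v"] reflected_eigen[of w] T0
    by (simp add: orbit_def reflected_def boundary_values inner_commute)
  then show "Re (c * (hermitian (upper (M v)) (lower w) + hermitian (lower (M v)) (upper w)))
    = Re (c * (hermitian (upper v) (lower (M w)) + hermitian (lower v) (upper (M w))))"
    unfolding distrib_left hermitian_simps(1)[symmetric] M_scale[symmetric]
      upper_lower_simps(3,4)[symmetric]
    by (simp only: Re_hermitian plus_complex.simps)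
qed

text \<open>The action of the reflection on states: momentum changes sign, position stays. The
  reflected orbit of \<open>v\<close> runs from \<open>N (M v)\<close> to
  \<open>N v\<close>.\<close>

definition N :: "complex^('n + 'n) \<Rightarrow> complex^('n + 'n)"
  where "N v = (\<chi> i. case i of Inl j \<Rightarrow> - v $ Inl j | Inr j \<Rightarrow> v $ Inr j)"

lemma upper_lower_N [simp]: "upper (N v) = - upper v" "lower (N v) = lower v"
  by (simp_all add: upper_def lower_def N_def vec_eq_iff)

lemma hermitian_minus [simp]: "hermitian u (- w) = - hermitian u w"
  by (simp add: hermitian_def sum_negf)

lemma symplectic_nondegenerate:
  fixes w :: "complex^('n + 'n)"
  assumes "\<And>v. hermitian (upper v) (lower w) - hermitian (lower v) (upper w) = 0"
  shows "w = 0"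
proof -
  \<comment> \<open>A quarter turn of \<open>w\<close>, against which the symplectic pairing becomes
    the sum of the squared norms of the two blocks.\<close>
  let ?v = "(\<chi> i. case i of Inl j \<Rightarrow> w $ Inr j | Inr j \<Rightarrow> - w $ Inl j) :: complex^('n + 'n)"
  have "upper ?v = lower w" "lower ?v = - upper w"
    by (simp_all add: upper_def lower_def vec_eq_iff)
  moreover have "hermitian (- u) u' = - hermitian u u'" for u u' :: "complex^'n"
    by (simp add: hermitian_def sum_negf)
  ultimately have "hermitian (lower w) (lower w) + hermitian (upper w) (upper w) = 0"
    using assms[of ?v] by simp
  then have "lower w \<bullet> lower w + upper w \<bullet> upper w = 0"
    by (metis Re_hermitian plus_complex.simps(1) zero_complex.simps(1))
  then have "lower w = 0" "upper w = 0"
    using inner_ge_zero[of "lower w"] inner_ge_zero[of "upper w"] by (auto simp: add_nonneg_eq_0_iff)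
  then show ?thesis by (simp add: upper_lower_eq_iff[of w])
qed

text \<open>By invariance a kernel vector pairs to 0 with everything, so \<open>M\<close> is
  injective and, in finite dimension, surjective.\<close>

lemma surj_M: "surj M"
proof -
  have lin: "linear M"
    by (rule linearI) (simp_all add: M_def cmv_add cmv_scaleR)
  have "w = 0" if "M w = 0" for w
    by (rule symplectic_nondegenerate) (use symplectic[of _ w] that in simp)
  then have "inj M" using linear_injective_0[OF lin] by blast
  then show ?thesis using linear_injective_imp_surjective[OF lin] by blast
qed

text \<open>The relation expresses that the reflected orbit ends at \<open>N w\<close>. Instead of
  invoking uniqueness for the differential equation, both sides are compared by pairing them
  symplectically with every \<open>M v\<close>.\<close>

lemma M_N_M: "M (N (M w)) = N w"
proof -
  have "N w - M (N (M w)) = 0"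
  proof (rule symplectic_nondegenerate)
    fix u
    obtain v where u: "u = M v" using surj_M by (metis surjD)
    have minus: "upper (a - b) = upper a - upper b" "lower (a - b) = lower a - lower b"
      for a b :: "complex^('n + 'n)" by (simp_all add: upper_def lower_def vec_eq_iff)
    have hdiff: "hermitian a (b - c) = hermitian a b - hermitian a c" for a b c :: "complex^'n"
      by (simp add: hermitian_def sum_subtractf algebra_simps)
    show "hermitian (upper u) (lower (N w - M (N (M w)))) -
        hermitian (lower u) (upper (N w - M (N (M w)))) = 0"
      using symplectic[of v "N (M w)"] reversible[of v w]
      by (simp add: u minus hdiff) algebra
  qed
  then show ?thesis by simp
qed

lemma N_eigenvector:
  assumes "M v = \<nu> *s v" "\<nu> \<noteq> 0"
  shows "M (N v) = inverse \<nu> *s N v"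
proof -
  have Ns: "N (c *s v) = c *s N v" for c
    by (simp add: upper_lower_eq_iff[of "N (c *s v)"])
  have "N v = \<nu> *s M (N v)"
    using M_N_M[of v] by (simp add: assms(1) Ns M_scale)
  then show ?thesis using assms(2) by (metis vec.scale_scale left_inverse vec.scale_one)
qed

text \<open>Let a and b be the two Hermitian products of opposite blocks. Symplecticity gives
  \<open>(\<nu> * cnj \<mu> - 1) * (a - b) = 0\<close>, reversibility
  \<open>(\<nu> - cnj \<mu>) * (a + b) = 0\<close>. In the closed upper half plane \<nu> can be the
  conjugate of \<mu> only if both are real, here 1 or -1; then \<open>\<nu> * cnj \<mu> = 1\<close>,
  and in that case the eigenvalue factors cancel outright. A real eigenvalue other than these,
  paired with itself, would leave a + b undetermined.\<close>

lemma eigenvectors_isotropic: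
  assumes v: "M v = \<nu> *s v" and w: "M w = \<mu> *s w"
    and \<nu>: "\<nu> \<in> upper_half_plane \<union> {1, - 1}" and \<mu>: "\<mu> \<in> upper_half_plane \<union> {1, - 1}"
  shows "hermitian (upper (M v)) (lower (M w)) = hermitian (upper v) (lower w)"
proof (cases "\<nu> * cnj \<mu> = 1")
  case True
  then show ?thesis by (simp add: v w mult.commute[of "cnj \<mu>"] flip: mult.assoc)
next
  case False
  let ?a = "hermitian (upper v) (lower w)" and ?b = "hermitian (lower v) (upper w)"
  have "(\<nu> * cnj \<mu>) * (?a - ?b) = ?a - ?b"
    using symplectic[of v w] by (simp add: v w algebra_simps)
  then have "(\<nu> * cnj \<mu> - 1) * (?a - ?b) = 0" by (simp add: algebra_simps)
  then have ab: "?a = ?b" using False by simp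
  have "\<nu> * (?a + ?b) = cnj \<mu> * (?a + ?b)"
    using reversible[of v w] by (simp add: v w algebra_simps)
  moreover have "\<nu> \<noteq> cnj \<mu>"
  proof
    assume *: "\<nu> = cnj \<mu>"
    have "Im \<nu> \<ge> 0" "Im \<mu> \<ge> 0" using \<nu> \<mu> by (auto simp: upper_half_plane_def)
    then have "Im \<nu> = 0" "Im \<mu> = 0" using * by auto
    then have "\<nu> \<in> {1, - 1}" using \<nu> by (auto simp: upper_half_plane_def)
    then show False using False * by auto
  qed
  ultimately have "?a + ?b = 0" by simp
  then have "?a = 0" using ab by simp
  then show ?thesis by (simp add: v w)
qed

lemma matrix_eigenspace_iff: "v \<in> matrix_eigenspace (cmatrix (\<gamma> T)) \<mu> \<longleftrightarrow> M v = \<mu> *s v"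
proof -
  have "mat \<mu> *v v = \<mu> *s v" for v :: "complex^('n + 'n)"
    by (simp add: vec_eq_iff matrix_vector_mult_def mat_def if_distrib[of "\<lambda>x. x * _"] cong: if_cong)
  then show ?thesis
    by (simp add: matrix_eigenspace_def matrix_vector_mult_diff_rdistrib M_def cmv_def)
qed

definition eigspan :: "complex set \<Rightarrow> (complex^('n + 'n)) set" where
  "eigspan A = vec.span (\<Union>\<mu> \<in> matrix_spectrum (cmatrix (\<gamma> T)) \<inter> A. matrix_eigenspace (cmatrix (\<gamma> T)) \<mu>)"

text \<open>Both sides are linear in \<open>v\<close> and conjugate linear in \<open>w\<close>, so
  the identity extends from eigenvectors to their span in one argument after the other.\<close>

lemma eigspan_isotropic:
  assumes A: "A \<subseteq> upper_half_plane \<union> {1, - 1}" and "v \<in> eigspan A" "w \<in> eigspan A"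
  shows "hermitian (upper (M v)) (lower (M w)) = hermitian (upper v) (lower w)"
proof -
  let ?X = "\<Union>\<mu> \<in> matrix_spectrum (cmatrix (\<gamma> T)) \<inter> A. matrix_eigenspace (cmatrix (\<gamma> T)) \<mu>"
  have 1: "hermitian (upper (M v)) (lower (M w)) = hermitian (upper v) (lower w)"
    if "v \<in> ?X" "w \<in> ?X" for v w
    using that A eigenvectors_isotropic[of v _ w] by (auto simp: matrix_eigenspace_iff) blast
  have 2: "hermitian (upper (M v)) (lower (M w)) = hermitian (upper v) (lower w)"
    if v: "v \<in> eigspan A" and w: "w \<in> ?X" for v w
    using v unfolding eigspan_def
  proof (induction rule: vec.span_induct)
    case base
    show ?case by (rule vec.subspaceI) (auto simp: M_add M_scale M_def[of 0])
  qed (rule 1[OF _ w])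
  show ?thesis
    using assms(3) unfolding eigspan_def
  proof (induction rule: vec.span_induct)
    case base
    show ?case by (rule vec.subspaceI) (auto simp: M_add M_scale M_def[of 0])
  qed (rule 2[OF assms(2)])
qed

text \<open>If \<open>v\<close> is fixed by \<open>N\<close>, its components for \<open>\<lambda>\<close> and \<open>1/\<lambda>\<close> cancel, although these
  eigenvalues lie in different half planes.\<close>

lemma eigspan_upper_eq_0:
  assumes v: "v \<in> eigspan upper_half_plane" and "upper v = 0"
  shows "v = 0"
proof -
  let ?E = "matrix_eigenspace (cmatrix (\<gamma> T))"
  obtain t r where t: "finite t"
    "t \<subseteq> (\<Union>\<mu> \<in> matrix_spectrum (cmatrix (\<gamma> T)) \<inter> upper_half_plane. ?E \<mu>)"
    "v = (\<Sum>a\<in>t. r a *s a)"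
    using v unfolding eigspan_def vec.span_explicit by blast
  then have "\<forall>a\<in>t. \<exists>\<mu>. \<mu> \<in> upper_half_plane \<and> a \<in> ?E \<mu>" by blast
  then obtain m where m: "\<And>a. a \<in> t \<Longrightarrow> m a \<in> upper_half_plane \<and> a \<in> ?E (m a)" by metis
  \<comment> \<open>Only the eigenvalues occurring in one representation of \<open>v\<close> are
    kept, so that all sums below are finite.\<close>
  define F where "F = m ` t"
  have F: "finite F" "F \<subseteq> upper_half_plane" using t m by (auto simp: F_def)
  have "v \<in> vec.span (\<Union>\<mu>\<in>F. ?E \<mu>)"
    unfolding t(3) using m by (intro vec.span_sum vec.span_scale vec.span_base) (auto simp: F_def)
  then obtain d where d: "\<And>\<mu>. \<mu> \<in> F \<Longrightarrow> d \<mu> \<in> vec.span (?E \<mu>)" "v = (\<Sum>\<mu>\<in>F. d \<mu>)"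
    using vec.span_UN_sum[OF F(1)] by blast
  have sub: "vec.subspace (?E \<mu>)" for \<mu>
    by (rule vec.subspaceI)
       (simp_all add: matrix_eigenspace_iff M_add M_scale vec.scale_right_distrib M_def[of 0] mult.commute)
  have dM: "M (d \<mu>) = \<mu> *s d \<mu>" if "\<mu> \<in> F" for \<mu>
    using d(1)[OF that] vec.span_eq_iff[THEN iffD2, OF sub] by (simp add: matrix_eigenspace_iff)
  have F0: "\<mu> \<noteq> 0" "Im \<mu> > 0" if "\<mu> \<in> F" for \<mu> using F(2) that by (auto simp: upper_half_plane_def)
  have disj: "F \<inter> inverse ` F = {}"
  proof -
    have "Im (inverse \<mu>) < 0" if "\<mu> \<in> F" for \<mu>
      using F0(2)[OF that] F0(1)[OF that] by (simp add: divide_neg_pos sum_power2_gt_zero_iff complex_eq_iff)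
    then show ?thesis using F0(2) by fastforce
  qed
  \<comment> \<open>Writes \<open>v - N v\<close>, which is 0, as one sum of eigenvectors: those of
    \<open>v\<close> over \<open>F\<close>, and their negated reflections over the inverses of
    \<open>F\<close>.\<close>
  define d' where "d' \<mu> = (if \<mu> \<in> F then d \<mu> else - N (d (inverse \<mu>)))" for \<mu>
  have Nv: "N v = v" using assms(2) by (simp add: upper_lower_eq_iff[of "N v"])
  have N_add: "N (a + b) = N a + N b" for a b by (simp add: upper_lower_eq_iff[of "N (a + b)"])
  have N0: "N 0 = 0" by (simp add: upper_lower_eq_iff[of "N 0"])
  have N_sum: "N (\<Sum>\<mu>\<in>G. d \<mu>) = (\<Sum>\<mu>\<in>G. N (d \<mu>))" for G
    by (induction G rule: infinite_finite_induct) (simp_all add: N0 N_add)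
  have "(\<Sum>\<mu>\<in>F \<union> inverse ` F. d' \<mu>) = (\<Sum>\<mu>\<in>F. d' \<mu>) + (\<Sum>\<mu>\<in>inverse ` F. d' \<mu>)"
    using F(1) disj by (intro sum.union_disjoint) auto
  also have "(\<Sum>\<mu>\<in>F. d' \<mu>) = v" unfolding d(2) by (intro sum.cong) (auto simp: d'_def)
  also have "(\<Sum>\<mu>\<in>inverse ` F. d' \<mu>) = (\<Sum>\<mu>\<in>F. d' (inverse \<mu>))"
    by (subst sum.reindex) (auto simp: inj_on_def)
  also have "\<dots> = (\<Sum>\<mu>\<in>F. - N (d \<mu>))"
    using disj by (intro sum.cong) (auto simp: d'_def)
  also have "\<dots> = - N v" unfolding d(2) N_sum by (simp add: sum_negf)
  finally have sum0: "(\<Sum>\<mu>\<in>F \<union> inverse ` F. d' \<mu>) = 0" by (simp add: Nv)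
  have M_minus: "M (- u) = - M u" for u using M_scale[of "-1" u] by simp
  have "d' \<mu> = 0" if "\<mu> \<in> F \<union> inverse ` F" for \<mu>
  proof (rule eigenvectors_sum_eq_0[OF M_add M_scale _ _ sum0 that])
    show "finite (F \<union> inverse ` F)" using F by simp
    fix \<mu> assume \<mu>: "\<mu> \<in> F \<union> inverse ` F"
    show "M (d' \<mu>) = \<mu> *s d' \<mu>"
    proof (cases "\<mu> \<in> F")
      case True
      then show ?thesis by (simp add: d'_def dM)
    next
      case False
      then obtain \<nu> where \<nu>: "\<nu> \<in> F" "\<mu> = inverse \<nu>" using \<mu> by blast
      then show ?thesis
        using False N_eigenvector[OF dM[OF \<nu>(1)] F0(1)[OF \<nu>(1)]] by (simp add: d'_def M_minus)
    qed
  qed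
  then have "d' \<mu> = 0" if "\<mu> \<in> F" for \<mu> using that by blast
  then have "d \<mu> = 0" if "\<mu> \<in> F" for \<mu> using that by (metis d'_def)
  then show ?thesis unfolding d(2) by simp
qed

lemma orbit_linear: "orbit (u + v) = orbit u + orbit v" "orbit (c *s v) = scale_cfun c (orbit v)"
  by (auto simp: fun_eq_iff orbit_def xc_def scale_cfun_def cmv_add cmv_vscale)

lemma momentum_orbit_0: "momentum (orbit v) 0 = upper v"
  using orbit_eigen[of v] T_pos by (simp add: boundary_values)

text \<open>Momentum and position at time 0 are the two blocks of \<open>v\<close>, so the orbit
  determines its initial data.\<close>

lemma orbit_eq_0: "orbit v = 0 \<Longrightarrow> v = 0"
proof -
  assume *: "orbit v = 0"
  have "momentum 0 0 = 0" using T_pos by (intro zero_momentum) simp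
  then have "upper v = 0" using momentum_orbit_0[of v] * by metis
  moreover have "orbit v 0 = 0" using * by (simp only: zero_fun_apply)
  then have "lower v = 0" using T_pos by (simp add: orbit_def boundary_values)
  ultimately show "v = 0" by (simp add: upper_lower_eq_iff[of v])
qed

text \<open>Sending initial data to the orbit is complex linear and injective, so the eigenspaces
  keep their dimension as a space of solutions; the boundary term of the form on it is the
  difference of the two sides of \<open>eigspan_isotropic\<close>, in real part.\<close>

lemma eigensum_bound:
  assumes A: "A \<subseteq> upper_half_plane \<union> {1, - 1}"
  shows "eigensum_dim (cmatrix (\<gamma> T)) A + morse_index P Q R T Dirichlet
      \<le> morse_index P Q R T Neumann + nullity P Q R T Neumann"
    and "A = upper_half_plane \<Longrightarrow> eigensum_dim (cmatrix (\<gamma> T)) A + morse_index P Q R T Dirichlet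
      \<le> morse_index P Q R T Neumann"
proof -
  interpret O: Vector_Spaces.linear "(*s)" scale_cfun orbit
    by unfold_locales (simp_all add: orbit_linear del: plus_fun_apply)
  obtain b where b: "b \<subseteq> eigspan A" "vec.independent b" "eigspan A \<subseteq> vec.span b"
    "card b = vec.dim (eigspan A)"
    using vec.basis_exists by blast
  have span_b: "vec.span b = eigspan A"
    using b(1,3) vec.span_minimal[OF b(1)] unfolding eigspan_def by (simp add: vec.subspace_span subset_antisym)
  define G where "G = orbit ` b"
  have inj: "inj orbit"
    using O.inj_iff_eq_0 orbit_eq_0 by blast
  have G: "finite G" "cfun.independent G" "card G = eigensum_dim (cmatrix (\<gamma> T)) A"
  proof -
    show "finite G" unfolding G_def using vec.finiteI_independent[OF b(2)] by simp
    show "cfun.independent G" unfolding G_def by (rule O.independent_inj_image[OF b(2) inj])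
    show "card G = eigensum_dim (cmatrix (\<gamma> T)) A"
      unfolding G_def using card_image[OF inj_on_subset[OF inj]] b(4)
      by (simp add: eigensum_dim_def eigspan_def)
  qed
  have span_G: "cfun.span G = orbit ` eigspan A"
    unfolding G_def O.span_image span_b by (rule refl)
  have sol: "solution s" if "s \<in> cfun.span G" for s
    using that orbit_solution unfolding span_G by blast
  have iso: "B s s' = 0" if ss: "s \<in> cfun.span G" "s' \<in> cfun.span G" for s s'
  proof -
    obtain v w where "v \<in> eigspan A" "w \<in> eigspan A" "s = orbit v" "s' = orbit w"
      using ss unfolding span_G by blast
    then show ?thesis
      using arg_cong[where f = Re, OF eigspan_isotropic[OF A]] by (simp add: B_orbit Re_hermitian)
  qed
  show "eigensum_dim (cmatrix (\<gamma> T)) A + morse_index P Q R T Dirichlet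
      \<le> morse_index P Q R T Neumann + nullity P Q R T Neumann"
    using isotropic_solutions_bound(1)[OF G(1,2) sol iso] unfolding G(3) by blast
  show "eigensum_dim (cmatrix (\<gamma> T)) A + morse_index P Q R T Dirichlet \<le> morse_index P Q R T Neumann"
    if AU: "A = upper_half_plane"
  proof -
    \<comment> \<open>The initial momentum of an orbit is the upper block of its data, so its
      vanishing means that the data are fixed by \<open>N\<close>.\<close>
    have "s = 0" if s: "s \<in> cfun.span G" "momentum s 0 = 0" for s
    proof -
      obtain v where v: "v \<in> eigspan upper_half_plane" "s = orbit v"
        using s(1) AU unfolding span_G by blast
      then have "v = 0" using eigspan_upper_eq_0 s(2) momentum_orbit_0 by metis
      then show ?thesis using v(2) O.zero by blast
    qed
    then show ?thesis using isotropic_solutions_bound(2)[OF G(1,2) sol iso] unfolding G(3) by blast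
  qed
qed

end

theorem theorem1p8:
  fixes T :: real
    and L :: "real \<times> (real^'n) \<times> (real^'n) \<Rightarrow> real"
    and x :: "real \<Rightarrow> real^'n"
    and P Q R :: "real \<Rightarrow> real^'n^'n"
    and \<gamma> :: "real \<Rightarrow> real^('n::finite + 'n)^('n + 'n)"
  assumes "T > 0"
    and "admissible_lagrangian T L"
    and "brake_orbit T L x"
    and "P = coeff_P L x" and "Q = coeff_Q L x" and "R = coeff_R L x"
    and "fundamental_solution P Q R \<gamma>"
  shows "int (eigensum_dim (cmatrix (\<gamma> T)) (upper_half_plane \<union> {1, - 1}))
           \<le> int (morse_index P Q R T Neumann) + int (nullity P Q R T Neumann)
              - int (morse_index P Q R T Dirichlet)
       \<and> int (eigensum_dim (cmatrix (\<gamma> T)) upper_half_plane)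
           \<le> int (morse_index P Q R T Neumann) - int (morse_index P Q R T Dirichlet)"
proof -
  interpret brake_system T P Q R \<gamma>
    using assms by unfold_locales (simp_all add: brake_orbit_def)
  show ?thesis
    using eigensum_bound(1)[OF order_refl] eigensum_bound(2)[OF Un_upper1 refl] by linarith
qed

end
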